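(* Let $\alpha\in\,]0,1]\cap\mathbb{Q}$ and let $\mathcal F$ be an $[\alpha]$-primitive fresco with nilpotent order $k$. Assume that $\mathcal F=\tilde{\mathcal A}e\subset\Xi^{(k-1)}_\alpha\otimes V$ for some finite dimensional complex vector space $V$. Let $p$ be the rank of $\mathcal F/S_{k-1}(\mathcal F)$. Then there exist $p$ linearly independent vectors $v_1,\dots,v_p$ in $V$ such that $e$ may be written $$e=\sum_{j=1}^pS_j(b)\,s^{\alpha+m_j-1}(\mathrm{Log}\,s)^{k-1}\otimes v_j+\psi,$$ where $\psi\in\Xi^{(k-2)}_\alpha\otimes V$, the $m_j$ are non-negative integers, and the $S_j$ are invertible elements of $\mathbb{C}[[b]]$. Moreover we may choose the vectors $v_1,\dots,v_p$ such that $m_1<\dots<m_p$. When this last condition is fulfilled, the $k$-th Bernstein polynomial of $\mathcal F$ is equal to $\prod_{j=1}^p(x+\alpha+m_j)$.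
   Context: **(a,b)-modules and frescos.** $\tilde{\mathcal A}$ is the algebra of series $\sum_{\nu\ge0}P_\nu(a)b^\nu$, $P_\nu\in\mathbb{C}[a]$, with the relation $ab-ba=b^2$; it contains $\mathbb{C}[[b]]$. An (a,b)-module is a free $\mathbb{C}[[b]]$-module of finite rank with a $\mathbb{C}$-linear endomorphism $a$ satisfying $ab-ba=b^2$ (so it is a left $\tilde{\mathcal A}$-module); its rank is its rank over $\mathbb{C}[[b]]$. For $\alpha\in\,]0,1]\cap\mathbb{Q}$ and $N\ge0$ let $\Xi^{(N)}_\alpha=\bigoplus_{j=0}^N\mathbb{C}[[s]]\,s^{\alpha-1}(\mathrm{Log}\,s)^j$, where $a$ is multiplication by $s$ and $b$ is termwise integration from $0$; $\Xi_\alpha^{(-1)}=0$. For a finite dimensional complex vector space $V$, $\tilde{\mathcal A}$ acts on $\Xi_\alpha^{(N)}\otimes V$ through the first factor. A fresco is an (a,b)-module generated by one element over $\tilde{\mathcal A}$ which is isomorphic to an $\tilde{\mathcal A}$-submodule of some finite direct sum of modules $\Xi^{(N)}_{\alpha'}\otimes V$. It is $[\alpha]$-primitive if it embeds in some $\Xi^{(N)}_\alpha\otimes V$. For $\lambda$ a positive rational number, $\mathcal{E}_\lambda=\tilde{\mathcal A}/\tilde{\mathcal A}(a-\lambda b)$. **Bernstein polynomials.** The Bernstein polynomial $B_{\mathcal F}$ of a fresco is the minimal polynomial of $-b^{-1}a$ acting on $\mathcal{F}^\sharp/b\mathcal{F}^\sharp$, where $\mathcal{F}^\sharp=\sum_{j\ge0}(b^{-1}a)^j\mathcal{F}\subset\mathcal{F}[b^{-1}]$;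 its degree is the rank of $\mathcal F$. An (a,b)-module is semi-simple if it embeds in a finite direct sum of modules $\mathcal{E}_\lambda$. For a fresco $\mathcal F$, $S_0(\mathcal F)=0$, $S_1(\mathcal F)$ is its largest semi-simple submodule and $S_j(\mathcal F)$ is the preimage in $\mathcal F$ of $S_1(\mathcal F/S_{j-1}(\mathcal F))$; if $\mathcal F\subset\Xi_\alpha^{(N)}\otimes V$ then $S_j(\mathcal F)=\mathcal F\cap(\Xi_\alpha^{(j-1)}\otimes V)$. The nilpotent order $d(\mathcal F)$ is the smallest $d$ with $S_d(\mathcal F)=\mathcal F$. If $\mathcal F$ is $[\alpha]$-primitive, its $j$-th Bernstein polynomial is $B^j_{\mathcal F}(x):=B_{S_j(\mathcal F)/S_{j-1}(\mathcal F)}(x-r_j)$ with $r_j=\mathrm{rank}(\mathcal F/S_j(\mathcal F))$, so that $\prod_jB^j_{\mathcal F}=B_{\mathcal F}$. *)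

theory Defs
  imports
    "HOL-Computational_Algebra.Polynomial"
    "HOL-Computational_Algebra.Formal_Power_Series"
    "HOL-Algebra.Module"
    "HOL-Algebra.AbelCoset"
    "HOL-Library.FuncSet"
    "HOL-Library.Function_Algebras"
begin

section \<open>Modules over \<open>\<complex>[[b]]\<close> with an operator \<open>a\<close>\<close>

text \<open>
  The ring \<open>\<complex>[[b]]\<close> is the type \<open>complex fps\<close>, with \<open>b\<close> being \<open>fps_X\<close>. A record below packages
  a \<open>\<complex>[[b]]\<close>-module and the operator \<open>a\<close>. The multiplication and unit of the parent record
  play no role, except for the algebra \<open>Atilde\<close> itself.
\<close>

definition Cb :: "complex fps ring" where
  "Cb = \<lparr>carrier = UNIV, mult = (*), one = 1, zero = 0, add = (+)\<rparr>"

record 'm abm = "(complex fps, 'm) module" +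
  aop :: "'m \<Rightarrow> 'm"

definition bop :: "'m abm \<Rightarrow> 'm \<Rightarrow> 'm" where
  "bop E x = fps_X \<odot>\<^bsub>E\<^esub> x"

definition has_rank :: "'m abm \<Rightarrow> nat \<Rightarrow> bool" where
  "has_rank E n \<longleftrightarrow> (\<exists>u \<in> {..<n} \<rightarrow> carrier E. \<forall>x \<in> carrier E.
     \<exists>!c. c \<in> extensional {..<n} \<and> x = (\<Oplus>\<^bsub>E\<^esub> i\<in>{..<n}. c i \<odot>\<^bsub>E\<^esub> u i))"

definition ab_rank :: "'m abm \<Rightarrow> nat" where
  "ab_rank E = (THE n. has_rank E n)"

definition ab_module :: "'m abm \<Rightarrow> bool" where
  "ab_module E \<longleftrightarrow> Module.module Cb E \<and> (\<exists>n. has_rank E n) \<and>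
     aop E \<in> carrier E \<rightarrow> carrier E \<and>
     (\<forall>x \<in> carrier E. \<forall>y \<in> carrier E. aop E (x \<oplus>\<^bsub>E\<^esub> y) = aop E x \<oplus>\<^bsub>E\<^esub> aop E y) \<and>
     (\<forall>c. \<forall>x \<in> carrier E. aop E (fps_const c \<odot>\<^bsub>E\<^esub> x) = fps_const c \<odot>\<^bsub>E\<^esub> aop E x) \<and>
     (\<forall>x \<in> carrier E. aop E (bop E x) \<ominus>\<^bsub>E\<^esub> bop E (aop E x) = bop E (bop E x))"

definition ab_hom :: "'m abm \<Rightarrow> 'n abm \<Rightarrow> ('m \<Rightarrow> 'n) set" where
  "ab_hom E G = {f \<in> carrier E \<rightarrow> carrier G.
     (\<forall>x \<in> carrier E. \<forall>y \<in> carrier E. f (x \<oplus>\<^bsub>E\<^esub> y) = f x \<oplus>\<^bsub>G\<^esub> f y) \<and>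
     (\<forall>S. \<forall>x \<in> carrier E. f (S \<odot>\<^bsub>E\<^esub> x) = S \<odot>\<^bsub>G\<^esub> f x) \<and>
     (\<forall>x \<in> carrier E. f (aop E x) = aop G (f x))}"

definition embeds :: "'m abm \<Rightarrow> 'n abm \<Rightarrow> bool" where
  "embeds E G \<longleftrightarrow> (\<exists>f \<in> ab_hom E G. inj_on f (carrier E))"

definition ab_submodule :: "'m set \<Rightarrow> 'm abm \<Rightarrow> bool" where
  "ab_submodule M E \<longleftrightarrow> submodule M Cb E \<and> (\<forall>x \<in> M. aop E x \<in> M)"

definition sub :: "'m abm \<Rightarrow> 'm set \<Rightarrow> 'm abm" where
  "sub E M = E\<lparr>carrier := M\<rparr>"

text \<open>The map induced by \<open>\<phi>\<close> on the cosets of \<open>M\<close> (it is well defined when \<open>\<phi>\<close> is additive and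
  preserves \<open>M\<close>).\<close>

definition coset_map :: "'m abm \<Rightarrow> 'm set \<Rightarrow> ('m \<Rightarrow> 'm) \<Rightarrow> 'm set \<Rightarrow> 'm set" where
  "coset_map E M \<phi> C = (\<Union>x\<in>C. M +>\<^bsub>E\<^esub> \<phi> x)"

definition quot :: "'m abm \<Rightarrow> 'm set \<Rightarrow> 'm set abm" where
  "quot E M = \<lparr>carrier = a_rcosets\<^bsub>E\<^esub> M, mult = undefined, one = undefined,
     zero = M, add = set_add E, smult = (\<lambda>S. coset_map E M (\<lambda>x. S \<odot>\<^bsub>E\<^esub> x)),
     aop = coset_map E M (aop E)\<rparr>"

definition dsum :: "nat \<Rightarrow> (nat \<Rightarrow> 'm abm) \<Rightarrow> (nat \<Rightarrow> 'm) abm" where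
  "dsum n E = \<lparr>carrier = (\<Pi>\<^sub>E i\<in>{..<n}. carrier (E i)), mult = undefined, one = undefined,
     zero = (\<lambda>i\<in>{..<n}. \<zero>\<^bsub>E i\<^esub>), add = (\<lambda>x y. \<lambda>i\<in>{..<n}. x i \<oplus>\<^bsub>E i\<^esub> y i),
     smult = (\<lambda>S x. \<lambda>i\<in>{..<n}. S \<odot>\<^bsub>E i\<^esub> x i), aop = (\<lambda>x. \<lambda>i\<in>{..<n}. aop (E i) (x i))\<rparr>"

text \<open>\<open>poly_act E \<phi> q x\<close> is \<open>q(\<phi>) x\<close>.\<close>

definition poly_act :: "'m abm \<Rightarrow> ('m \<Rightarrow> 'm) \<Rightarrow> complex poly \<Rightarrow> 'm \<Rightarrow> 'm" where
  "poly_act E \<phi> q x = (\<Oplus>\<^bsub>E\<^esub> i\<in>{..degree q}. fps_const (poly.coeff q i) \<odot>\<^bsub>E\<^esub> (\<phi> ^^ i) x)"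

definition min_poly :: "'m abm \<Rightarrow> ('m \<Rightarrow> 'm) \<Rightarrow> complex poly" where
  "min_poly E \<phi> = (THE p. lead_coeff p = 1 \<and>
     (\<forall>q. (\<forall>x \<in> carrier E. poly_act E \<phi> q x = \<zero>\<^bsub>E\<^esub>) \<longleftrightarrow> p dvd q))"


section \<open>The algebra of series \<open>\<Sum>\<^sub>\<nu> P\<^sub>\<nu>(a) b\<^sup>\<nu>\<close>\<close>

text \<open>
  The series \<open>\<Sum>\<^sub>\<nu> P\<^sub>\<nu>(a) b\<^sup>\<nu>\<close> is represented by the formal power series with coefficients \<open>P\<^sub>\<nu>\<close>.
  From \<open>ab - ba = b\<^sup>2\<close> one gets \<open>b\<^sup>\<nu> a = a b\<^sup>\<nu> - \<nu> b\<^bsup>\<nu>+1\<^esup>\<close>, so that right multiplication by \<open>a\<close> is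
  \<open>rmult_a\<close>; right multiplication by \<open>b\<close> is multiplication by \<open>fps_X\<close>. The product of \<open>f\<close> and
  \<open>g = \<Sum>\<^sub>\<mu> Q\<^sub>\<mu>(a) b\<^sup>\<mu>\<close> is then obtained by letting the terms of \<open>g\<close> act on \<open>f\<close> from the right.
\<close>

definition rmult_a :: "complex poly fps \<Rightarrow> complex poly fps" where
  "rmult_a f = fps_const [:0, 1:] * f - fps_X\<^sup>2 * fps_deriv f"

definition rmult_poly :: "complex poly \<Rightarrow> complex poly fps \<Rightarrow> complex poly fps" where
  "rmult_poly q f = (\<Sum>i\<le>degree q. fps_const [:poly.coeff q i:] * (rmult_a ^^ i) f)"

definition atilde_mult :: "complex poly fps \<Rightarrow> complex poly fps \<Rightarrow> complex poly fps" where
  "atilde_mult f g = Abs_fps (\<lambda>n. \<Sum>\<mu>\<le>n. fps_nth (rmult_poly (fps_nth g \<mu>) f) (n - \<mu>))"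

definition atilde_a :: "complex poly fps" where
  "atilde_a = fps_const [:0, 1:]"

definition Atilde :: "complex poly fps abm" where
  "Atilde = \<lparr>carrier = UNIV, mult = atilde_mult, one = 1, zero = 0, add = (+),
     smult = (\<lambda>S. atilde_mult (Abs_fps (\<lambda>n. [:fps_nth S n:]))), aop = atilde_mult atilde_a\<rparr>"

lemma rmult_a_add: "rmult_a (f + g) = rmult_a f + rmult_a g"
  by (simp add: rmult_a_def algebra_simps)

lemma rmult_a_const: "rmult_a (fps_const [:c:] * f) = fps_const [:c:] * rmult_a f"
  by (simp add: rmult_a_def algebra_simps)

lemma rmult_a_sum: "rmult_a (sum f A) = (\<Sum>x\<in>A. rmult_a (f x))"
  by (induction A rule: infinite_finite_induct) (simp_all add: rmult_a_add, simp_all add: rmult_a_def)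

lemma rmult_a_X_power:
  "rmult_a (f * fps_X ^ n) = rmult_a f * fps_X ^ n - of_nat n * f * fps_X ^ Suc n"
proof -
  have "fps_X\<^sup>2 * fps_deriv (fps_X ^ n) = of_nat n * (fps_X::complex poly fps) ^ Suc n"
  proof (induction n)
    case (Suc n)
    have "fps_X\<^sup>2 * fps_deriv (fps_X ^ Suc n) =
        fps_X\<^sup>2 * fps_X ^ n + fps_X * (fps_X\<^sup>2 * fps_deriv ((fps_X::complex poly fps) ^ n))"
      by (simp add: algebra_simps del: fps_deriv_power)
    thus ?case
      by (subst (asm) Suc.IH) (simp add: algebra_simps power2_eq_square)
  qed simp
  hence "fps_X\<^sup>2 * fps_deriv (f * fps_X ^ n) =
      f * (of_nat n * fps_X ^ Suc n) + fps_X\<^sup>2 * fps_deriv f * fps_X ^ n"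
    by (metis (no_types, opaque_lifting) distrib_left fps_deriv_mult mult.assoc mult.left_commute)
  thus ?thesis
    by (auto simp: rmult_a_def algebra_simps)
qed

lemma rmult_a_pow_add: "(rmult_a ^^ i) (f + g) = (rmult_a ^^ i) f + (rmult_a ^^ i) g"
  by (induction i) (simp_all add: rmult_a_add)

lemma rmult_a_pow_const:
  "(rmult_a ^^ i) (fps_const [:c:] * f) = fps_const [:c:] * (rmult_a ^^ i) f"
  by (induction i) (simp_all add: rmult_a_const)

lemma rmult_poly_bound:
  assumes "degree q \<le> N"
  shows "rmult_poly q f = (\<Sum>i\<le>N. fps_const [:poly.coeff q i:] * (rmult_a ^^ i) f)"
  unfolding rmult_poly_def using assms
  by (intro sum.mono_neutral_left) (auto simp: coeff_eq_0)

lemma rmult_poly_add_left: "rmult_poly (p + q) f = rmult_poly p f + rmult_poly q f"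
proof -
  define N where "N = max (degree p) (degree q)"
  have "degree (p + q) \<le> N" "degree p \<le> N" "degree q \<le> N"
    unfolding N_def using degree_add_le_max by auto
  moreover have "fps_const [:x + y:] = fps_const [:x:] + fps_const [:y::complex:]" for x y
    by simp
  ultimately show ?thesis
    by (simp add: rmult_poly_bound[where N = N] sum.distrib distrib_right del: fps_const_add)
qed

lemma rmult_poly_const_left: "rmult_poly ([:c:] * q) f = fps_const [:c:] * rmult_poly q f"
proof -
  have "fps_const [:c * x:] = fps_const [:c:] * fps_const [:x::complex:]" for x
    by (simp add: mult.commute)
  thus ?thesis
    by (simp add: rmult_poly_bound[where N = "degree q"] degree_smult_le sum_distrib_left
          mult.assoc del: fps_const_mult)
qed

lemma rmult_poly_zero_left [simp]: "rmult_poly 0 f = 0"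
  by (simp add: rmult_poly_def)

lemma rmult_poly_add: "rmult_poly q (f + g) = rmult_poly q f + rmult_poly q g"
  by (simp add: rmult_poly_def rmult_a_pow_add algebra_simps sum.distrib)

lemma rmult_poly_X: "rmult_poly ([:0, 1:] * q) f = rmult_a (rmult_poly q f)"
proof -
  have "rmult_poly ([:0, 1:] * q) f =
      (\<Sum>i\<le>Suc (degree q). fps_const [:poly.coeff (pCons 0 q) i:] * (rmult_a ^^ i) f)"
    using degree_pCons_le[of 0 q] by (simp add: rmult_poly_bound[where N = "Suc (degree q)"])
  also have "\<dots> = rmult_a (rmult_poly q f)"
    by (subst sum.atMost_Suc_shift) (simp add: rmult_poly_def rmult_a_sum rmult_a_const)
  finally show ?thesis .
qed

lemma atilde_mult_nth:
  "fps_nth (atilde_mult f g) n = fps_nth (\<Sum>\<mu>\<le>n. rmult_poly (fps_nth g \<mu>) f * fps_X ^ \<mu>) n"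
  by (auto simp: atilde_mult_def fps_sum_nth fps_X_power_mult_right_nth intro!: sum.cong)

lemma atilde_mult_nth':
  assumes "n \<le> N"
  shows "fps_nth (atilde_mult f g) n = fps_nth (\<Sum>\<mu>\<le>N. rmult_poly (fps_nth g \<mu>) f * fps_X ^ \<mu>) n"
  unfolding atilde_mult_nth fps_sum_nth using assms
  by (intro sum.mono_neutral_left) (auto simp: fps_X_power_mult_right_nth)

lemma atilde_mult_cong:
  "(\<And>i. i \<le> n \<Longrightarrow> fps_nth g i = fps_nth h i) \<Longrightarrow>
     fps_nth (atilde_mult f g) n = fps_nth (atilde_mult f h) n"
  by (simp add: atilde_mult_def)

lemma atilde_mult_add_right: "atilde_mult f (g + h) = atilde_mult f g + atilde_mult f h"
  by (simp add: atilde_mult_def rmult_poly_add_left fps_eq_iff sum.distrib)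

lemma atilde_mult_add_left: "atilde_mult (f + g) h = atilde_mult f h + atilde_mult g h"
  by (simp add: atilde_mult_def rmult_poly_add fps_eq_iff sum.distrib)

lemma atilde_mult_zero_right [simp]: "atilde_mult f 0 = 0"
  by (simp add: atilde_mult_def fps_eq_iff)

lemma atilde_mult_sum: "atilde_mult f (sum g A) = (\<Sum>x\<in>A. atilde_mult f (g x))"
  by (induction A rule: infinite_finite_induct) (simp_all add: atilde_mult_add_right)

lemma atilde_mult_const_right:
  "atilde_mult f (fps_const [:c:] * g) = fps_const [:c:] * atilde_mult f g"
  using rmult_poly_const_left[of c]
  by (simp add: atilde_mult_def fps_eq_iff sum_distrib_left)

lemma atilde_mult_X: "atilde_mult f (g * fps_X) = atilde_mult f g * fps_X"
proof (rule fps_ext)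
  fix n show "fps_nth (atilde_mult f (g * fps_X)) n = fps_nth (atilde_mult f g * fps_X) n"
    by (cases n) (simp_all add: atilde_mult_def sum.atMost_Suc_shift del: sum.atMost_Suc)
qed

lemma atilde_mult_X_power: "atilde_mult f (g * fps_X ^ n) = atilde_mult f g * fps_X ^ n"
proof (induction n)
  case (Suc n)
  have "atilde_mult f (g * fps_X ^ Suc n) = atilde_mult f (g * fps_X ^ n * fps_X)"
    by (simp add: mult_ac)
  also have "\<dots> = atilde_mult f g * fps_X ^ Suc n"
    by (subst atilde_mult_X, subst Suc) (simp add: mult_ac)
  finally show ?case .
qed simp

lemma rmult_a_cong:
  "(\<And>i. i \<le> n \<Longrightarrow> fps_nth g i = fps_nth h i) \<Longrightarrow> fps_nth (rmult_a g) n = fps_nth (rmult_a h) n"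
  by (simp add: rmult_a_def fps_X_power_mult_nth)

lemma rmult_a_nth:
  "fps_nth (rmult_a g) n = [:0, 1:] * fps_nth g n - of_nat (n - 1) * fps_nth g (n - 1)"
proof -
  consider "n = 0" | "n = 1" | m where "n = Suc (Suc m)"
    by (metis One_nat_def not0_implies_Suc)
  thus ?thesis
    by cases (simp_all add: rmult_a_def fps_X_power_mult_nth)
qed

lemma rmult_poly_of_nat: "rmult_poly (of_nat k * q) f = of_nat k * rmult_poly q f"
  using rmult_poly_const_left[of "of_nat k" q f]
  by (metis fps_of_nat of_nat_poly)

lemma rmult_poly_diff: "rmult_poly (p - q) f = rmult_poly p f - rmult_poly q f"
  using rmult_poly_add_left[of "p - q" q f] by (simp add: algebra_simps)

lemma atilde_mult_rmult_a: "atilde_mult f (rmult_a g) = rmult_a (atilde_mult f g)"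
proof (rule fps_ext)
  fix n
  define u where "u = (\<lambda>\<mu>. rmult_poly (fps_nth g \<mu>) f)"
  have shift: "(\<Sum>\<mu>\<le>n. of_nat (\<mu> - 1) * u (\<mu> - 1) * fps_X ^ \<mu>)
      = (\<Sum>\<mu><n. of_nat \<mu> * u \<mu> * fps_X ^ Suc \<mu>)"
    by (induction n) simp_all
  have "fps_nth (atilde_mult f (rmult_a g)) n =
      fps_nth (\<Sum>\<mu>\<le>n. (rmult_a (u \<mu>) - of_nat (\<mu> - 1) * u (\<mu> - 1)) * fps_X ^ \<mu>) n"
    unfolding atilde_mult_nth u_def
    by (simp only: rmult_a_nth rmult_poly_diff rmult_poly_X rmult_poly_of_nat)
  also have "(\<Sum>\<mu>\<le>n. (rmult_a (u \<mu>) - of_nat (\<mu> - 1) * u (\<mu> - 1)) * fps_X ^ \<mu>)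
      = (\<Sum>\<mu>\<le>n. rmult_a (u \<mu>) * fps_X ^ \<mu>) - (\<Sum>\<mu><n. of_nat \<mu> * u \<mu> * fps_X ^ Suc \<mu>)"
    unfolding left_diff_distrib sum_subtractf shift ..
  also have "fps_nth \<dots> n = fps_nth ((\<Sum>\<mu>\<le>n. rmult_a (u \<mu>) * fps_X ^ \<mu>)
      - (\<Sum>\<mu>\<le>n. of_nat \<mu> * u \<mu> * fps_X ^ Suc \<mu>)) n"
    by (simp add: lessThan_Suc_atMost[symmetric] fps_X_power_mult_right_nth del: power_Suc)
  also have "(\<Sum>\<mu>\<le>n. rmult_a (u \<mu>) * fps_X ^ \<mu>) - (\<Sum>\<mu>\<le>n. of_nat \<mu> * u \<mu> * fps_X ^ Suc \<mu>)
      = rmult_a (\<Sum>\<mu>\<le>n. u \<mu> * fps_X ^ \<mu>)"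
    by (simp only: rmult_a_sum rmult_a_X_power sum_subtractf)
  also have "fps_nth \<dots> n = fps_nth (rmult_a (atilde_mult f g)) n"
    unfolding u_def by (intro rmult_a_cong) (simp add: atilde_mult_nth'[of _ n])
  finally show "fps_nth (atilde_mult f (rmult_a g)) n = fps_nth (rmult_a (atilde_mult f g)) n" .
qed

lemma atilde_mult_rmult_poly: "atilde_mult f (rmult_poly q g) = rmult_poly q (atilde_mult f g)"
proof -
  have "atilde_mult f ((rmult_a ^^ i) g) = (rmult_a ^^ i) (atilde_mult f g)" for i
    by (induction i) (simp_all add: atilde_mult_rmult_a)
  thus ?thesis
    by (simp add: rmult_poly_def atilde_mult_sum atilde_mult_const_right)
qed

lemma atilde_mult_assoc: "atilde_mult (atilde_mult f g) h = atilde_mult f (atilde_mult g h)"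
proof (rule fps_ext)
  fix n
  have "fps_nth (atilde_mult f (atilde_mult g h)) n =
      fps_nth (atilde_mult f (\<Sum>\<mu>\<le>n. rmult_poly (fps_nth h \<mu>) g * fps_X ^ \<mu>)) n"
    by (intro atilde_mult_cong) (simp add: atilde_mult_nth'[of _ n])
  also have "\<dots> = fps_nth (atilde_mult (atilde_mult f g) h) n"
    by (simp add: atilde_mult_sum atilde_mult_X_power atilde_mult_rmult_poly atilde_mult_nth)
  finally show "fps_nth (atilde_mult (atilde_mult f g) h) n
      = fps_nth (atilde_mult f (atilde_mult g h)) n" ..
qed

lemma atilde_mult_one_right: "atilde_mult f 1 = f"
proof -
  have "fps_nth (rmult_poly (fps_nth 1 \<mu>) f) (n - \<mu>) = (if \<mu> = 0 then fps_nth f n else 0)" for \<mu> n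
    by (simp add: rmult_poly_def)
  thus ?thesis
    by (simp add: atilde_mult_def fps_eq_iff)
qed

lemma atilde_mult_one_left: "atilde_mult 1 g = g"
proof -
  have pow: "(rmult_a ^^ i) 1 = fps_const (monom 1 i)" for i
    by (induction i) (simp_all add: rmult_a_def monom_Suc monom_0 one_pCons)
  have "rmult_poly q 1 = fps_const q" for q
  proof -
    have "rmult_poly q 1 = (\<Sum>i\<le>degree q. fps_const (monom (poly.coeff q i) i))"
      by (simp add: rmult_poly_def pow smult_monom)
    also have "\<dots> = fps_const (\<Sum>i\<le>degree q. monom (poly.coeff q i) i)"
      by (simp add: fps_eq_iff fps_sum_nth)
    finally show ?thesis by (simp add: poly_as_sum_of_monoms)
  qed
  hence "fps_nth (atilde_mult 1 g) n = (\<Sum>\<mu>\<le>n. if \<mu> = n then fps_nth g \<mu> else 0)" for n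
    unfolding atilde_mult_def fps_nth_Abs_fps by (intro sum.cong) auto
  thus ?thesis by (simp add: fps_eq_iff)
qed

lemma ring_Atilde: "ring Atilde"
proof (intro ringI abelian_groupI monoidI)
  fix x assume "x \<in> carrier Atilde"
  show "\<exists>y\<in>carrier Atilde. y \<oplus>\<^bsub>Atilde\<^esub> x = \<zero>\<^bsub>Atilde\<^esub>"
    by (auto simp: Atilde_def intro!: exI[of _ "-x"])
qed (simp_all add: Atilde_def atilde_mult_assoc atilde_mult_one_left atilde_mult_one_right
       atilde_mult_add_left atilde_mult_add_right algebra_simps)

lemma Atilde_relation:
  "atilde_mult atilde_a fps_X - atilde_mult fps_X atilde_a = atilde_mult fps_X fps_X"
proof -
  have b: "atilde_mult f fps_X = f * fps_X" for f
    using atilde_mult_X[of f 1] by (simp add: atilde_mult_one_right)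
  have a: "atilde_mult f atilde_a = rmult_a f" for f
    using atilde_mult_rmult_a[of f 1] by (simp add: atilde_mult_one_right rmult_a_def atilde_a_def)
  show ?thesis
    by (simp add: a b) (simp add: rmult_a_def atilde_a_def power2_eq_square)
qed

text \<open>The action of \<open>\<Sum>\<^sub>\<nu> P\<^sub>\<nu>(a) b\<^sup>\<nu>\<close> on an (a,b)-module, as a \<open>b\<close>-adic limit.\<close>

definition act :: "'m abm \<Rightarrow> complex poly fps \<Rightarrow> 'm \<Rightarrow> 'm" where
  "act E P x = (THE y. y \<in> carrier E \<and> (\<forall>n. \<exists>z \<in> carrier E.
     y = (\<Oplus>\<^bsub>E\<^esub> \<nu>\<in>{..<n}. poly_act E (aop E) (fps_nth P \<nu>) ((bop E ^^ \<nu>) x)) \<oplus>\<^bsub>E\<^esub> (bop E ^^ n) z))"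

definition generated :: "'m abm \<Rightarrow> 'm \<Rightarrow> 'm set" where
  "generated E e = {act E P e | P. True}"

definition E_mod :: "rat \<Rightarrow> complex poly fps set abm" where
  "E_mod l = quot Atilde
     {atilde_mult P (atilde_a - fps_const [:of_rat l:] * fps_X) | P. True}"


section \<open>The modules \<open>\<Xi>\<^sub>\<alpha>\<^bsup>(N)\<^esup> \<otimes> V\<close>\<close>

text \<open>
  For \<open>\<gamma> > 0\<close>, the primitive of \<open>s\<^bsup>\<gamma>-1\<^esup> (Log s)\<^sup>j\<close> that vanishes at \<open>0\<close> is
  \<open>\<Sum>i\<le>j. log_int_coeff \<gamma> j i \<cdot> s\<^sup>\<gamma> (Log s)\<^sup>i\<close>.
\<close>

definition log_int_coeff :: "'a::field_char_0 \<Rightarrow> nat \<Rightarrow> nat \<Rightarrow> 'a" where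
  "log_int_coeff \<gamma> j i = (-1) ^ (j - i) * fact j / (fact i * \<gamma> ^ (j - i + 1))"

lemma log_int_coeff_deriv:
  fixes \<gamma> s :: real
  assumes "\<gamma> > 0" "s > 0"
  shows "((\<lambda>s. \<Sum>i\<le>j. log_int_coeff \<gamma> j i * (s powr \<gamma> * ln s ^ i)) has_real_derivative
           s powr (\<gamma> - 1) * ln s ^ j) (at s)"
proof (induction j)
  case 0
  show ?case using assms
    by (auto simp: log_int_coeff_def intro!: derivative_eq_intros)
next
  case (Suc j)
  let ?T = "\<lambda>j s. \<Sum>i\<le>j. log_int_coeff \<gamma> j i * (s powr \<gamma> * ln s ^ i)"
  have "log_int_coeff \<gamma> (Suc j) i = - (real (Suc j) / \<gamma>) * log_int_coeff \<gamma> j i" if "i \<le> j" for i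
    using that assms by (simp add: log_int_coeff_def Suc_diff_le field_simps)
  hence eq: "?T (Suc j) = (\<lambda>s. s powr \<gamma> * ln s ^ Suc j / \<gamma> - real (Suc j) / \<gamma> * ?T j s)"
    by (simp add: fun_eq_iff sum_distrib_left mult.assoc sum_negf log_int_coeff_def[of _ "Suc j" "Suc j"])
  have "((\<lambda>s. s powr \<gamma> * ln s ^ Suc j / \<gamma>) has_real_derivative
      (\<gamma> * s powr (\<gamma> - 1) * ln s ^ Suc j + s powr \<gamma> * (real (Suc j) * (inverse s * ln s ^ j))) / \<gamma>)
      (at s)"
    using assms by (auto intro!: derivative_eq_intros simp: field_simps simp del: power_Suc)
  hence "((\<lambda>s. s powr \<gamma> * ln s ^ Suc j / \<gamma> - real (Suc j) / \<gamma> * ?T j s) has_real_derivative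
      (\<gamma> * s powr (\<gamma> - 1) * ln s ^ Suc j + s powr \<gamma> * (real (Suc j) * (inverse s * ln s ^ j))) / \<gamma>
      - real (Suc j) / \<gamma> * (s powr (\<gamma> - 1) * ln s ^ j)) (at s)"
    by (intro DERIV_diff DERIV_cmult Suc.IH)
  also have "(\<gamma> * s powr (\<gamma> - 1) * ln s ^ Suc j + s powr \<gamma> * (real (Suc j) * (inverse s * ln s ^ j))) / \<gamma>
      - real (Suc j) / \<gamma> * (s powr (\<gamma> - 1) * ln s ^ j) = s powr (\<gamma> - 1) * ln s ^ Suc j"
    using assms by (simp add: field_simps powr_diff)
  finally show ?case unfolding eq .
qed

text \<open>
  As \<open>V\<close> is finite dimensional, \<open>\<complex>[[s]] \<otimes> V = V[[s]]\<close>, and an element of \<open>\<Xi>\<^sub>\<alpha>\<^bsup>(N)\<^esup> \<otimes> V\<close> is given by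
  the coefficients \<open>f j n \<in> V\<close> of \<open>s\<^bsup>\<alpha>+n-1\<^esup> (Log s)\<^sup>j\<close>. Here \<open>V\<close> is a subspace of the complex vector
  space with scalar multiplication \<open>scale\<close>. The parameter \<open>N\<close> is an integer, and the module is
  \<open>0\<close> for \<open>N < 0\<close>.
\<close>

definition Xi_b :: "(complex \<Rightarrow> 'v::ab_group_add \<Rightarrow> 'v) \<Rightarrow> rat \<Rightarrow> int \<Rightarrow>
    (nat \<Rightarrow> nat \<Rightarrow> 'v) \<Rightarrow> nat \<Rightarrow> nat \<Rightarrow> 'v" where
  "Xi_b scale \<alpha> N f = (\<lambda>i n. case n of 0 \<Rightarrow> 0
     | Suc n' \<Rightarrow> \<Sum>j | i \<le> j \<and> int j \<le> N. scale (log_int_coeff (of_rat \<alpha> + of_nat n') j i) (f j n'))"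

definition Xi :: "(complex \<Rightarrow> 'v::ab_group_add \<Rightarrow> 'v) \<Rightarrow> 'v set \<Rightarrow> rat \<Rightarrow> int \<Rightarrow>
    (nat \<Rightarrow> nat \<Rightarrow> 'v) abm" where
  "Xi scale V \<alpha> N = \<lparr>
     carrier = {f. (\<forall>j n. f j n \<in> V) \<and> (\<forall>j n. int j > N \<longrightarrow> f j n = 0)},
     mult = undefined, one = undefined,
     zero = (\<lambda>j n. 0),
     add = (\<lambda>f g j n. f j n + g j n),
     smult = (\<lambda>S f j n. \<Sum>l\<le>n. scale (fps_nth S l) ((Xi_b scale \<alpha> N ^^ l) f j n)),
     aop = (\<lambda>f j n. case n of 0 \<Rightarrow> 0 | Suc n' \<Rightarrow> f j n')\<rparr>"

text \<open>The element \<open>s\<^bsup>\<alpha>+m-1\<^esup> (Log s)\<^sup>l \<otimes> v\<close>.\<close>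

definition log_monom :: "nat \<Rightarrow> nat \<Rightarrow> 'v::zero \<Rightarrow> nat \<Rightarrow> nat \<Rightarrow> 'v" where
  "log_monom m l v = (\<lambda>j n. if j = l \<and> n = m then v else 0)"

text \<open>The standard spaces \<open>\<complex>\<^sup>d\<close>, used where a definition quantifies over all finite dimensional \<open>V\<close>.\<close>

definition Cd_scale :: "complex \<Rightarrow> (nat \<Rightarrow> complex) \<Rightarrow> nat \<Rightarrow> complex" where
  "Cd_scale c w = (\<lambda>i. c * w i)"

definition Cd :: "nat \<Rightarrow> (nat \<Rightarrow> complex) set" where
  "Cd d = {w. \<forall>i\<ge>d. w i = 0}"


section \<open>Frescos\<close>

definition fresco :: "'m abm \<Rightarrow> bool" where
  "fresco F \<longleftrightarrow> ab_module F \<and> (\<exists>e \<in> carrier F. carrier F = generated F e) \<and>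
     (\<exists>n \<alpha> N d. (\<forall>i<n. 0 < \<alpha> i \<and> \<alpha> i \<le> 1) \<and>
        embeds F (dsum n (\<lambda>i. Xi Cd_scale (Cd (d i)) (\<alpha> i) (int (N i)))))"

definition primitive_fresco :: "rat \<Rightarrow> 'm abm \<Rightarrow> bool" where
  "primitive_fresco \<alpha> F \<longleftrightarrow> fresco F \<and> (\<exists>N d. embeds F (Xi Cd_scale (Cd d) \<alpha> (int N)))"

definition semi_simple :: "'m abm \<Rightarrow> bool" where
  "semi_simple E \<longleftrightarrow> ab_module E \<and>
     (\<exists>n l. (\<forall>i<n. 0 < l i) \<and> embeds E (dsum n (\<lambda>i. E_mod (l i))))"

definition ss_part :: "'m abm \<Rightarrow> 'm set" where
  "ss_part E = (GREATEST M. ab_submodule M E \<and> semi_simple (sub E M))"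

primrec ss_filt :: "'m abm \<Rightarrow> nat \<Rightarrow> 'm set" where
  "ss_filt F 0 = {\<zero>\<^bsub>F\<^esub>}"
| "ss_filt F (Suc j) =
     {x \<in> carrier F. ss_filt F j +>\<^bsub>F\<^esub> x \<in> ss_part (quot F (ss_filt F j))}"

definition nilp_order :: "'m abm \<Rightarrow> nat" where
  "nilp_order F = (LEAST d. ss_filt F d = carrier F)"


section \<open>Bernstein polynomials\<close>

text \<open>\<open>E[b\<^sup>-\<^sup>1]\<close>: the pair \<open>(x, n)\<close> stands for \<open>b\<^sup>-\<^sup>n x\<close>. The operator \<open>a\<close> extends by
  \<open>a b\<^sup>-\<^sup>n = b\<^sup>-\<^sup>n a - n b\<^bsup>-n+1\<^esup>\<close>.\<close>

definition loc_rel :: "'m abm \<Rightarrow> (('m \<times> nat) \<times> ('m \<times> nat)) set" where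
  "loc_rel E = {((x, n), (y, m)). x \<in> carrier E \<and> y \<in> carrier E \<and>
     (bop E ^^ m) x = (bop E ^^ n) y}"

definition loc_frac :: "'m abm \<Rightarrow> 'm \<Rightarrow> nat \<Rightarrow> ('m \<times> nat) set" where
  "loc_frac E x n = loc_rel E `` {(x, n)}"

definition loc :: "'m abm \<Rightarrow> ('m \<times> nat) set abm" where
  "loc E = \<lparr>carrier = (carrier E \<times> UNIV) // loc_rel E, mult = undefined, one = undefined,
     zero = loc_frac E \<zero>\<^bsub>E\<^esub> 0,
     add = (\<lambda>C D. \<Union>(x, n)\<in>C. \<Union>(y, m)\<in>D.
              loc_frac E ((bop E ^^ m) x \<oplus>\<^bsub>E\<^esub> (bop E ^^ n) y) (n + m)),
     smult = (\<lambda>S C. \<Union>(x, n)\<in>C. loc_frac E (S \<odot>\<^bsub>E\<^esub> x) n),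
     aop = (\<lambda>C. \<Union>(x, n)\<in>C. loc_frac E (aop E x \<ominus>\<^bsub>E\<^esub> of_nat n \<odot>\<^bsub>E\<^esub> bop E x) n)\<rparr>"

definition binv_a :: "'m abm \<Rightarrow> ('m \<times> nat) set \<Rightarrow> ('m \<times> nat) set" where
  "binv_a E C = (\<Union>(x, n)\<in>aop (loc E) C. loc_frac E x (Suc n))"

definition sharp :: "'m abm \<Rightarrow> ('m \<times> nat) set set" where
  "sharp E = {\<Oplus>\<^bsub>loc E\<^esub> j\<in>{..n}. (binv_a E ^^ j) (loc_frac E (x j) 0) | n x. \<forall>j. x j \<in> carrier E}"

definition bernstein :: "'m abm \<Rightarrow> complex poly" where
  "bernstein F = (let Fs = sub (loc F) (sharp F); bFs = bop (loc F) ` sharp F in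
     min_poly (quot Fs bFs) (coset_map Fs bFs (\<lambda>x. \<ominus>\<^bsub>loc F\<^esub> binv_a F x)))"

text \<open>The \<open>j\<close>-th Bernstein polynomial, for \<open>j \<ge> 1\<close>.\<close>

definition bernstein_nth :: "nat \<Rightarrow> 'm abm \<Rightarrow> complex poly" where
  "bernstein_nth j F =
     bernstein (quot (sub F (ss_filt F j)) (ss_filt F (j - 1)))
       \<circ>\<^sub>p [:- of_nat (ab_rank (quot F (ss_filt F j))), 1:]"


section \<open>Expansions of a generator\<close>

text \<open>\<open>e = \<Sum>\<^sub>j S\<^sub>j(b) s\<^bsup>\<alpha>+m\<^sub>j-1\<^esup> (Log s)\<^bsup>k-1\<^esup> \<otimes> v\<^sub>j + \<psi>\<close> with \<open>v\<^sub>1, \<dots>, v\<^sub>p\<close> linearly independent.\<close>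

definition expansion :: "(complex \<Rightarrow> 'v::ab_group_add \<Rightarrow> 'v) \<Rightarrow> rat \<Rightarrow> nat \<Rightarrow> (nat \<Rightarrow> nat \<Rightarrow> 'v) \<Rightarrow> nat \<Rightarrow>
    (nat \<Rightarrow> 'v) \<Rightarrow> (nat \<Rightarrow> nat) \<Rightarrow> (nat \<Rightarrow> complex fps) \<Rightarrow> (nat \<Rightarrow> nat \<Rightarrow> 'v) \<Rightarrow> bool" where
  "expansion scale \<alpha> k e p v m S \<psi> \<longleftrightarrow>
     inj_on v {1..p} \<and> \<not> module.dependent scale (v ` {1..p}) \<and>
     (\<forall>j \<in> {1..p}. S j dvd 1) \<and>
     \<psi> \<in> carrier (Xi scale UNIV \<alpha> (int k - 2)) \<and>
     (let X = Xi scale UNIV \<alpha> (int k - 1) in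
       e = (\<Oplus>\<^bsub>X\<^esub> j\<in>{1..p}. S j \<odot>\<^bsub>X\<^esub> log_monom (m j) (k - 1) (v j)) \<oplus>\<^bsub>X\<^esub> \<psi>)"

end

theory Submission
  imports Defs
begin

text \<open>
  Expanding a power series in \<open>b\<close> turns every module below into a submodule of \<open>\<complex>[[X]]\<^sup>I\<close>, \<open>I\<close> finite,
  where \<open>b\<close> is multiplication by \<open>X\<close> and \<open>b\<^sup>-\<^sup>1 a = \<lambda> + X d/dX + T\<close>. On \<open>\<Xi>\<^sub>\<alpha>\<^bsup>(k-1)\<^esup> \<otimes> V\<close> one has \<open>\<lambda> = \<alpha>\<close>,
  and \<open>T = d/d(Log s)\<close> is nilpotent and commutes with \<open>a\<close> and \<open>b\<close>; on a sum of modules \<open>\<E>\<^sub>\<lambda>\<close> one has \<open>T = 0\<close>.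

  If \<open>M \<subseteq> \<Xi>\<^sub>\<alpha>\<^bsup>(k-1)\<^esup> \<otimes> V\<close> is semi-simple, a product \<open>q(b\<^sup>-\<^sup>1 a)\<close> of distinct linear factors makes \<open>x \<in> M\<close>
  divisible by a high power of \<open>b\<close> in the sum of the \<open>\<E>\<^sub>\<lambda>\<close>, hence, by Artin-Rees, in \<open>\<Xi>\<^sub>\<alpha>\<^bsup>(k-1)\<^esup> \<otimes> V\<close>. So \<open>q\<close>
  kills the low order coefficients of \<open>x\<close>, and since \<open>q\<close> is squarefree this gives \<open>T x = 0\<close>. Hence \<open>S\<^sub>j\<close> is the
  kernel of \<open>T\<^sup>j\<close>, and \<open>F/S\<^sub>k\<^sub>-\<^sub>1\<close> is generated by the \<open>(Log s)\<^bsup>k-1\<^esup>\<close>-part \<open>g\<close> of \<open>e\<close>.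

  The \<open>v\<^sub>j\<close> are the coefficients of \<open>g\<close> which are not in the span of the previous ones, and the \<open>m\<^sub>j\<close> are their
  indices. As the \<open>m\<^sub>j\<close> are distinct, polynomials in \<open>b\<^sup>-\<^sup>1 a\<close> isolate the leading terms of \<open>g\<close>, so that the
  saturation of \<open>F/S\<^sub>k\<^sub>-\<^sub>1\<close> is \<open>\<Oplus>\<^sub>j \<complex>[[b]] s\<^bsup>\<alpha>+m\<^sub>j-1\<^esup> v\<^sub>j\<close>. Its rank is \<open>p\<close>, and \<open>-b\<^sup>-\<^sup>1 a\<close> acts on its
  reduction modulo \<open>b\<close> diagonally with the distinct eigenvalues \<open>-(\<alpha> + m\<^sub>j)\<close>.
\<close>

section \<open>Submodules of \<open>\<complex>[[X]]\<^sup>I\<close>\<close>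

text \<open>An embedding into a sum of modules \<open>E_mod\<close> is abstract and says nothing
  about the position of the module in \<Xi>. What can be compared is divisibility by
  \<open>b^L\<close> inside the module itself: Artin-Rees turns divisibility of coordinates in one
  realization into divisibility in the module, which is visible in every other realization. Since
  \<open>b^-1 a\<close> need not preserve the module, \<open>q(b^-1 a)\<close> is replaced by a
  product of factors \<open>a - (d + \<mu>) b\<close>, at the price of one factor b for each. The
  number of factors depends on the precision wanted, but the extra power of b appears in both
  realizations and cancels, so there is no circularity. The coordinates on \<Xi> come from writing f
  as the sum of \<open>b^n u_n\<close> with \<open>u_n\<close> in the span of the
  \<open>s^(\<alpha>-1) (Log s)^j\<close>; this is possible because d/ds, the inverse of b, is
  invertible between successive homogeneous parts, as \<open>\<alpha> + n\<close> is never 0. The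
  elements of F are b-adic limits; what matters is that their coefficients of
  \<open>s^(\<alpha>+n-1) (Log s)^(k-1)\<close> stay in the span of the v_j with m_j \<le>
  n.\<close>

lemma sum_fun_apply: "(\<Sum>i\<in>A. f i) x = (\<Sum>i\<in>A. f i x :: 'b::comm_monoid_add)"
  by (induction A rule: infinite_finite_induct) auto

lemma X_power_dvd_iff: "fps_X ^ L dvd (f::complex fps) \<longleftrightarrow> (\<forall>n<L. fps_nth f n = 0)"
proof
  assume "\<forall>n<L. fps_nth f n = 0"
  hence "f = fps_X ^ L * fps_shift L f"
    by (auto simp: fps_eq_iff fps_X_power_mult_nth)
  thus "fps_X ^ L dvd f"
    by (rule dvdI)
qed (auto simp: fps_X_power_mult_nth elim!: dvdE)

lemma X_power_dvd_all_imp_zero: "(\<And>L. fps_X ^ L dvd (f::complex fps)) \<Longrightarrow> f = 0"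
  unfolding X_power_dvd_iff by (metis fps_ext fps_zero_nth lessI)

definition fps_submodule :: "('i \<Rightarrow> complex fps) set \<Rightarrow> bool" where
  "fps_submodule M \<longleftrightarrow> 0 \<in> M \<and> (\<forall>x\<in>M. \<forall>y\<in>M. x + y \<in> M) \<and> (\<forall>S. \<forall>x\<in>M. (\<lambda>i. S * x i) \<in> M)"

lemma fps_submodule_zero: "fps_submodule M \<Longrightarrow> 0 \<in> M"
  and fps_submodule_add: "fps_submodule M \<Longrightarrow> x \<in> M \<Longrightarrow> y \<in> M \<Longrightarrow> x + y \<in> M"
  and fps_submodule_smult: "fps_submodule M \<Longrightarrow> x \<in> M \<Longrightarrow> (\<lambda>i. S * x i) \<in> M"
  unfolding fps_submodule_def by blast+

lemma fps_submodule_sub_smult: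
  assumes "fps_submodule M" "x \<in> M" "u \<in> M"
  shows "(\<lambda>j. x j - q * u j) \<in> M"
proof -
  have "x + (\<lambda>j. (-q) * u j) \<in> M"
    using assms by (intro fps_submodule_add fps_submodule_smult)
  also have "x + (\<lambda>j. (-q) * u j) = (\<lambda>j. x j - q * u j)"
    by auto
  finally show ?thesis .
qed

lemma fps_submodule_kernel: "fps_submodule M \<Longrightarrow> fps_submodule {x \<in> M. x i = 0}"
  by (auto simp: fps_submodule_def)

text \<open>The i-th coordinates of the elements of M form a nonzero ideal of the discrete valuation
  ring C[[X]]. The least order e that occurs gives a generator, and multiplying by a unit normalizes
  it to \<open>X^e\<close>.\<close>

lemma fps_submodule_pivot:
  assumes M: "fps_submodule M" and x: "x \<in> M" "x i \<noteq> 0"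
  obtains u e where "u \<in> M" "u i = fps_X ^ e" "\<And>y. y \<in> M \<Longrightarrow> fps_X ^ e dvd y i"
proof -
  define e where "e = (LEAST n. \<exists>y\<in>M. y i \<noteq> 0 \<and> subdegree (y i) = n)"
  have "\<exists>y\<in>M. y i \<noteq> 0 \<and> subdegree (y i) = e"
    unfolding e_def by (rule LeastI_ex) (use x in blast)
  then obtain y where y: "y \<in> M" "y i \<noteq> 0" "subdegree (y i) = e"
    by blast
  have e: "e \<le> subdegree (z i)" if "z \<in> M" "z i \<noteq> 0" for z
    unfolding e_def by (rule Least_le) (use that in blast)
  define w where "w = inverse (fps_shift e (y i))"
  have "fps_nth (fps_shift e (y i)) 0 \<noteq> 0"
    using y nth_subdegree_nonzero[of "y i"] by simp
  hence w: "w * fps_shift e (y i) = 1"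
    unfolding w_def by (rule inverse_mult_eq_1)
  have "w * y i = w * (fps_shift e (y i) * fps_X ^ e)"
    using subdegree_decompose[of "y i"] y(3) by simp
  also have "\<dots> = fps_X ^ e"
    by (simp only: mult.assoc[symmetric] w mult_1)
  finally have "w * y i = fps_X ^ e" .
  moreover have "fps_X ^ e dvd z i" if "z \<in> M" for z
  proof (cases "z i = 0")
    case False
    with e[OF that] have "\<forall>n<e. fps_nth (z i) n = 0"
      by (intro allI impI nth_less_subdegree_zero) linarith
    thus ?thesis by (simp only: X_power_dvd_iff)
  qed simp
  ultimately show thesis
    by (rule that[OF fps_submodule_smult[OF M y(1)]])
qed

text \<open>The projection to one coordinate has a free image, generated by \<open>X^e\<close>. So M
  splits into the kernel, supported on fewer coordinates, and the multiples of a pivot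
  element.\<close>

lemma fps_submodule_basis:
  assumes "finite I" "fps_submodule M" "\<forall>x\<in>M. \<forall>i. i \<notin> I \<longrightarrow> x i = 0"
  shows "\<exists>(r::nat) u. (\<forall>i<r. u i \<in> M) \<and> (\<forall>x\<in>M. \<exists>c. x = (\<lambda>k. \<Sum>i<r. c i * u i k)) \<and>
    (\<forall>c. (\<forall>k. (\<Sum>i<r. c i * u i k) = 0) \<longrightarrow> (\<forall>i<r. c i = 0))"
  using assms
proof (induction I arbitrary: M rule: finite_induct)
  case empty
  hence "x = (\<lambda>k. 0)" if "x \<in> M" for x using that by auto
  thus ?case by (intro exI[of _ 0]) auto
next
  case (insert i I)
  define M' where "M' = {x \<in> M. x i = 0}"
  have M': "fps_submodule M'"
    unfolding M'_def by (intro fps_submodule_kernel insert)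
  have supp: "\<forall>x\<in>M'. \<forall>j. j \<notin> I \<longrightarrow> x j = 0"
    using insert.prems(2) by (auto simp: M'_def)
  obtain r :: nat and u where u: "\<forall>j<r. u j \<in> M'"
    and gen: "\<forall>x\<in>M'. \<exists>c. x = (\<lambda>k. \<Sum>j<r. c j * u j k)"
    and indep: "\<forall>c. (\<forall>k. (\<Sum>j<r. c j * u j k) = 0) \<longrightarrow> (\<forall>j<r. c j = 0)"
    using insert.IH[OF M' supp] by (elim exE conjE) (rule that; assumption)
  show ?case
  proof (cases "M' = M")
    case True
    show ?thesis
      by (rule exI[of _ r], rule exI[of _ u])
        (intro conjI u[unfolded True] gen[unfolded True] indep)
  next
    case False
    then obtain x where "x \<in> M" "x i \<noteq> 0" by (auto simp: M'_def)
    then obtain v e where v: "v \<in> M" "v i = fps_X ^ e" "\<And>y. y \<in> M \<Longrightarrow> fps_X ^ e dvd y i"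
      using fps_submodule_pivot insert.prems by metis
    define u' where "u' = u(r := v)"
    have sum: "(\<Sum>j<Suc r. c j * u' j k) = (\<Sum>j<r. c j * u j k) + c r * v k" for c k
      by (simp add: u'_def)
    have span: "\<forall>x\<in>M. \<exists>c. x = (\<lambda>k. \<Sum>j<Suc r. c j * u' j k)"
    proof
      fix x assume x: "x \<in> M"
      obtain q where q: "x i = fps_X ^ e * q" using v x by (auto elim!: dvdE)
      have "(\<lambda>j. x j - q * v j) \<in> M'"
        using fps_submodule_sub_smult[OF insert.prems(1) x v(1), of q] q v by (simp add: M'_def mult.commute)
      then obtain c where c: "(\<lambda>j. x j - q * v j) = (\<lambda>k. \<Sum>j<r. c j * u j k)"
        using gen by blast
      have "(\<Sum>j<r. (c(r := q)) j * u j k) = (\<Sum>j<r. c j * u j k)" for k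
        by (intro sum.cong) auto
      also have "(\<Sum>j<r. c j * u j k) = x k - q * v k" for k
        using fun_cong[OF c] by metis
      finally show "\<exists>c. x = (\<lambda>k. \<Sum>j<Suc r. c j * u' j k)"
        unfolding sum by (intro exI[of _ "c(r := q)"]) auto
    qed
    have indep': "\<forall>c. (\<forall>k. (\<Sum>j<Suc r. c j * u' j k) = 0) \<longrightarrow> (\<forall>j<Suc r. c j = 0)"
    proof (intro allI impI)
      fix c j assume c: "\<forall>k. (\<Sum>j<Suc r. c j * u' j k) = 0" and j: "j < Suc r"
      have "(\<Sum>j<r. c j * u j i) = 0"
        using u by (intro sum.neutral) (auto simp: M'_def)
      hence "c r = 0"
        using spec[OF c, of i] v(2) unfolding sum by simp
      moreover from this have "\<forall>j<r. c j = 0"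
        using c indep unfolding sum by simp
      ultimately show "c j = 0" using j by (auto simp: less_Suc_eq)
    qed
    have mem: "\<forall>j<Suc r. u' j \<in> M"
    proof (intro allI impI)
      fix j assume "j < Suc r"
      thus "u' j \<in> M"
        using spec[OF u, of j] v(1) by (cases "j = r") (simp_all add: u'_def M'_def)
    qed
    show ?thesis
      by (rule exI[of _ "Suc r"], rule exI[of _ u']) (intro conjI mem span indep')
  qed
qed

text \<open>The constant is the sum of the exponents e of the pivots: clearing a coordinate of x by
  its pivot means dividing by \<open>X^e\<close>, which costs e orders of divisibility. It depends
  on M only.\<close>

lemma fps_submodule_artin_rees:
  assumes "finite I" "fps_submodule M" "\<forall>x\<in>M. \<forall>i. i \<notin> I \<longrightarrow> x i = 0"
  shows "\<exists>C. \<forall>L. \<forall>x\<in>M. (\<forall>i. fps_X ^ (C + L) dvd x i) \<longrightarrow> (\<exists>y\<in>M. x = (\<lambda>i. fps_X ^ L * y i))"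
  using assms
proof (induction I arbitrary: M rule: finite_induct)
  case empty
  show ?case
  proof (intro exI allI ballI impI)
    fix L x assume x: "x \<in> M"
    have "x = (\<lambda>i. fps_X ^ L * x i)"
      using bspec[OF empty(2) x] by (intro ext) simp
    thus "\<exists>y\<in>M. x = (\<lambda>i. fps_X ^ L * y i)"
      using x by (rule bexI)
  qed
next
  case (insert i I)
  define M' where "M' = {x \<in> M. x i = 0}"
  have M': "fps_submodule M'"
    unfolding M'_def by (intro fps_submodule_kernel insert)
  have supp: "\<forall>x\<in>M'. \<forall>j. j \<notin> I \<longrightarrow> x j = 0"
    using insert.prems(2) by (auto simp: M'_def)
  obtain C where C: "\<forall>L. \<forall>x\<in>M'. (\<forall>i. fps_X ^ (C + L) dvd x i) \<longrightarrow> (\<exists>y\<in>M'. x = (\<lambda>i. fps_X ^ L * y i))"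
    using insert.IH[OF M' supp] by (elim exE) (rule that)
  show ?case
  proof (cases "M' = M")
    case True
    show ?thesis using C unfolding True by (rule exI)
  next
    case False
    then obtain x where "x \<in> M" "x i \<noteq> 0" by (auto simp: M'_def)
    then obtain v e where v: "v \<in> M" "v i = fps_X ^ e" "\<And>y. y \<in> M \<Longrightarrow> fps_X ^ e dvd y i"
      using fps_submodule_pivot insert.prems by metis
    show ?thesis
    proof (intro exI[of _ "C + e"] allI ballI impI)
      fix L x assume x: "x \<in> M" "\<forall>i. fps_X ^ (C + e + L) dvd x i"
      obtain q where q: "x i = fps_X ^ (C + e + L) * q"
        using spec[OF x(2), of i] by (elim dvdE)
      \<comment> \<open>The quotient of \<open>x i\<close> by the pivot entry \<open>X^e\<close>. It
        keeps the factor \<open>X^(C + L)\<close>, so subtracting \<open>q' * v\<close> preserves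
        this divisibility in the other coordinates.\<close>
      define q' where "q' = fps_X ^ (C + L) * q"
      have "(\<lambda>j. x j - q' * v j) \<in> M'"
        using fps_submodule_sub_smult[OF insert.prems(1) x(1) v(1), of q'] q v(2)
        by (simp add: M'_def q'_def power_add mult_ac)
      moreover have "\<forall>j. fps_X ^ (C + L) dvd x j - q' * v j"
      proof
        fix j show "fps_X ^ (C + L) dvd x j - q' * v j"
        unfolding q'_def
        by (rule dvd_diff) (use spec[OF x(2), of j] in \<open>auto simp: power_add mult_ac intro: dvd_mult_left\<close>)
      qed
      ultimately have "\<exists>y\<in>M'. (\<lambda>j. x j - q' * v j) = (\<lambda>j. fps_X ^ L * y j)"
        by (rule C[THEN spec, THEN bspec, THEN mp])
      then obtain y where y: "y \<in> M'" "(\<lambda>j. x j - q' * v j) = (\<lambda>j. fps_X ^ L * y j)"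
        by (elim bexE)
      have "x j = fps_X ^ L * (y j + fps_X ^ C * q * v j)" for j
        using fun_cong[OF y(2), of j] by (simp add: q'_def power_add algebra_simps)
      moreover have "y + (\<lambda>j. (fps_X ^ C * q) * v j) \<in> M"
        using insert.prems(1) y(1) v(1) unfolding M'_def
        by (intro fps_submodule_add fps_submodule_smult) auto
      ultimately show "\<exists>y\<in>M. x = (\<lambda>i. fps_X ^ L * y i)"
        by (rule_tac bexI[of _ "y + (\<lambda>j. (fps_X ^ C * q) * v j)"]) auto
    qed
  qed
qed

text \<open>Submodules are closed in the X-adic topology. The induction subtracts the right multiple
  of a pivot from x and shows that the remainder is a limit of elements of the kernel.\<close>

lemma fps_submodule_closed:
  assumes "finite I" "fps_submodule M" "\<forall>x\<in>M. \<forall>i. i \<notin> I \<longrightarrow> x i = 0"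
    and "\<And>L. \<exists>y\<in>M. \<forall>i. fps_X ^ L dvd x i - y i"
  shows "x \<in> M"
  using assms
proof (induction I arbitrary: M x rule: finite_induct)
  case empty
  have "x i = 0" for i
  proof (rule X_power_dvd_all_imp_zero)
    fix L show "fps_X ^ L dvd x i"
      using empty(2,3) by (metis diff_zero empty_iff)
  qed
  hence "x = 0" by auto
  thus ?case using fps_submodule_zero[OF empty(1)] by (simp only:)
next
  case (insert i I)
  define M' where "M' = {x \<in> M. x i = 0}"
  have M': "fps_submodule M'"
    unfolding M'_def by (intro fps_submodule_kernel insert)
  have supp: "\<forall>x\<in>M'. \<forall>j. j \<notin> I \<longrightarrow> x j = 0"
    using insert.prems(2) by (auto simp: M'_def)
  show ?case
  proof (cases "M' = M")
    case True
    show ?thesis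
      using insert.IH[OF M' supp, of x] insert.prems(3) unfolding True by blast
  next
    case False
    then obtain x' where "x' \<in> M" "x' i \<noteq> 0" by (auto simp: M'_def)
    then obtain v e where v: "v \<in> M" "v i = fps_X ^ e" "\<And>y. y \<in> M \<Longrightarrow> fps_X ^ e dvd y i"
      using fps_submodule_pivot insert.prems by metis
    obtain y0 where "y0 \<in> M" "fps_X ^ e dvd x i - y0 i"
      using insert.prems(3) by blast
    hence "fps_X ^ e dvd x i" using v(3) dvd_add[of "fps_X ^ e" "x i - y0 i" "y0 i"] by simp
    then obtain q where q: "x i = fps_X ^ e * q" by (auto elim!: dvdE)
    have "(\<lambda>j. x j - q * v j) \<in> M'"
    proof (rule insert.IH[OF M' supp])
      fix L
      \<comment> \<open>Precision \<open>e + L\<close> is asked for, because q and \<open>q'\<close>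
        arise by division by \<open>X^e\<close> and then agree only modulo
        \<open>X^L\<close>.\<close>
      obtain y where y: "y \<in> M" "\<And>j. fps_X ^ (e + L) dvd x j - y j"
        using insert.prems(3) by blast
      obtain q' where q': "y i = fps_X ^ e * q'" using v(3)[OF y(1)] by (auto elim!: dvdE)
      have "fps_X ^ e * fps_X ^ L dvd fps_X ^ e * (q - q')"
        using y(2)[of i] by (simp add: q q' power_add algebra_simps)
      hence "fps_X ^ L dvd q - q'" by (subst (asm) dvd_mult_cancel_left) auto
      moreover have "fps_X ^ L dvd x j - y j" for j
        using y(2)[of j] by (auto simp: power_add mult_ac intro: dvd_mult_left)
      ultimately have "fps_X ^ L dvd (x j - y j) - (q - q') * v j" for j
        by (blast intro: dvd_diff dvd_mult2)
      moreover have "(x j - y j) - (q - q') * v j = (x j - q * v j) - (y j - q' * v j)" for j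
        by (simp add: algebra_simps)
      moreover have "(\<lambda>j. y j - q' * v j) \<in> M'"
        using fps_submodule_sub_smult[OF insert.prems(1) y(1) v(1), of q'] q' v
        by (simp add: M'_def mult.commute)
      ultimately show "\<exists>y\<in>M'. \<forall>j. fps_X ^ L dvd (x j - q * v j) - y j"
        by (intro bexI[of _ "\<lambda>j. y j - q' * v j"]) auto
    qed
    hence "(\<lambda>j. x j - q * v j) \<in> M" by (simp add: M'_def)
    hence "(\<lambda>j. (x j - q * v j) - (- q) * v j) \<in> M"
      by (rule fps_submodule_sub_smult[OF insert.prems(1) _ v(1)])
    thus ?thesis by simp
  qed
qed

text \<open>Fraction-free Gaussian elimination, as the entries will be power series:
  cross-multiplication with the row \<open>r0\<close> clears the column \<open>i\<close> without
  dividing.\<close>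

lemma more_vectors_than_coordinates_dependent:
  fixes A :: "nat \<Rightarrow> 'i \<Rightarrow> 'a::idom"
  assumes "finite I" "finite R" "card I < card R"
  shows "\<exists>c. (\<exists>r\<in>R. c r \<noteq> 0) \<and> (\<forall>i\<in>I. (\<Sum>r\<in>R. c r * A r i) = 0)"
  using assms
proof (induction I arbitrary: R A rule: finite_induct)
  case empty
  then obtain r where "r \<in> R" by fastforce
  thus ?case by (intro exI[of _ "\<lambda>_. 1"]) auto
next
  case (insert i I)
  show ?case
  proof (cases "\<exists>r0\<in>R. A r0 i \<noteq> 0")
    case False
    have "card I < card R" using insert by simp
    then obtain c where "\<exists>r\<in>R. c r \<noteq> 0" "\<forall>i\<in>I. (\<Sum>r\<in>R. c r * A r i) = 0"
      using insert.IH[OF insert.prems(1)] by blast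
    thus ?thesis using False by (intro exI[of _ c]) auto
  next
    case True
    then obtain r0 where r0: "r0 \<in> R" "A r0 i \<noteq> 0" by blast
    define R' where "R' = R - {r0}"
    have R': "finite R'" "card I < card R'" "r0 \<notin> R'" "R = insert r0 R'"
      using insert r0 by (auto simp: R'_def)
    obtain c where c: "\<exists>r\<in>R'. c r \<noteq> 0"
      "\<And>j. j \<in> I \<Longrightarrow> (\<Sum>r\<in>R'. c r * (A r0 i * A r j - A r i * A r0 j)) = 0"
      using insert.IH[OF R'(1,2), of "\<lambda>r j. A r0 i * A r j - A r i * A r0 j"] by blast
    \<comment> \<open>The entry at \<open>r0\<close> makes the column \<open>i\<close> cancel; the
      factor \<open>A r0 i\<close>, being nonzero, keeps a nonzero coefficient among the
      others.\<close>
    define c' where "c' = (\<lambda>r. if r = r0 then - (\<Sum>r\<in>R'. c r * A r i) else A r0 i * c r)"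
    have "(\<Sum>r\<in>R. c' r * A r j) = (\<Sum>r\<in>R'. c r * (A r0 i * A r j - A r i * A r0 j))" for j
    proof -
      have "(\<Sum>r\<in>R. c' r * A r j) = c' r0 * A r0 j + (\<Sum>r\<in>R'. c' r * A r j)"
        using R' by simp
      also have "(\<Sum>r\<in>R'. c' r * A r j) = (\<Sum>r\<in>R'. A r0 i * c r * A r j)"
        using R' by (intro sum.cong) (auto simp: c'_def)
      finally show ?thesis
        by (simp add: c'_def sum_distrib_left sum_distrib_right algebra_simps sum_subtractf)
    qed
    moreover have "(\<Sum>r\<in>R'. c r * (A r0 i * A r i - A r i * A r0 i)) = 0"
      by (intro sum.neutral) simp
    moreover have "\<exists>r\<in>R. c' r \<noteq> 0"
      using c(1) r0 R' by (auto simp: c'_def)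
    ultimately show ?thesis using c(2) by (intro exI[of _ c']) auto
  qed
qed

section \<open>Modules embedded in \<open>\<complex>[[X]]\<^sup>I\<close>\<close>

lemma cring_Cb: "cring Cb"
proof (intro cringI abelian_groupI comm_monoidI)
  fix x assume "x \<in> carrier Cb"
  show "\<exists>y\<in>carrier Cb. y \<oplus>\<^bsub>Cb\<^esub> x = \<zero>\<^bsub>Cb\<^esub>"
    by (auto simp: Cb_def intro!: exI[of _ "-x"])
qed (simp_all add: Cb_def algebra_simps)

text \<open>The records carry bare operations. Through the injective \<phi> all group and module
  laws are inherited from C[[X]]^I, so they never have to be verified on cosets or
  fractions.\<close>

locale coords =
  fixes E :: "'m abm" (structure) and \<phi> :: "'m \<Rightarrow> 'i \<Rightarrow> complex fps"
  assumes inj: "inj_on \<phi> (carrier E)"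
    and zero_mem: "\<zero> \<in> carrier E"
    and add_mem: "x \<in> carrier E \<Longrightarrow> y \<in> carrier E \<Longrightarrow> x \<oplus> y \<in> carrier E"
    and smult_mem: "x \<in> carrier E \<Longrightarrow> S \<odot> x \<in> carrier E"
    and coord_zero: "\<phi> \<zero> = 0"
    and coord_add: "x \<in> carrier E \<Longrightarrow> y \<in> carrier E \<Longrightarrow> \<phi> (x \<oplus> y) = \<phi> x + \<phi> y"
    and coord_smult: "x \<in> carrier E \<Longrightarrow> \<phi> (S \<odot> x) = (\<lambda>i. S * \<phi> x i)"
begin

lemma eqI: "x \<in> carrier E \<Longrightarrow> y \<in> carrier E \<Longrightarrow> \<phi> x = \<phi> y \<Longrightarrow> x = y"
  using inj by (auto dest: inj_onD)

lemma abelian_group: "abelian_group E"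
proof (rule abelian_groupI)
  fix x assume x: "x \<in> carrier E"
  show "\<exists>y\<in>carrier E. y \<oplus> x = \<zero>"
    by (rule bexI[of _ "(-1) \<odot> x"], rule eqI)
      (auto simp: x zero_mem add_mem smult_mem coord_zero coord_add coord_smult fun_eq_iff)
qed (auto intro!: eqI simp: zero_mem add_mem coord_zero coord_add add_ac)

lemma module: "module Cb E"
  by (rule moduleI[OF cring_Cb abelian_group])
    (auto intro!: eqI simp: Cb_def zero_mem add_mem smult_mem coord_zero coord_add
      coord_smult algebra_simps fun_eq_iff)

sublocale module Cb E by (rule module)

lemma coord_uminus: "x \<in> carrier E \<Longrightarrow> \<phi> (\<ominus> x) = - \<phi> x"
proof -
  assume x: "x \<in> carrier E"
  hence "\<phi> (x \<oplus> \<ominus> x) = \<phi> x + \<phi> (\<ominus> x)" by (intro coord_add) auto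
  also have "x \<oplus> \<ominus> x = \<zero>" using x by (rule r_neg)
  finally have "\<phi> x i + \<phi> (\<ominus> x) i = 0" for i
    by (metis coord_zero plus_fun_apply zero_fun_apply)
  thus ?thesis by (intro ext) (metis add_eq_0_iff fun_Compl_def)
qed

lemma coord_minus: "x \<in> carrier E \<Longrightarrow> y \<in> carrier E \<Longrightarrow> \<phi> (x \<ominus> y) = \<phi> x - \<phi> y"
  by (simp add: a_minus_def coord_add coord_uminus)

lemma coord_finsum:
  assumes "\<And>i. i \<in> A \<Longrightarrow> f i \<in> carrier E"
  shows "\<phi> (\<Oplus>i\<in>A. f i) = (\<Sum>i\<in>A. \<phi> (f i))"
proof (cases "finite A")
  case True
  thus ?thesis using assms
    by (induction A rule: finite_induct) (auto simp: coord_zero coord_add finsum_closed Pi_def)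
next
  case False
  thus ?thesis by (simp add: finsum_infinite coord_zero)
qed

lemma bop_closed: "x \<in> carrier E \<Longrightarrow> bop E x \<in> carrier E"
  by (simp add: bop_def smult_mem)

lemma bop_pow_closed: "x \<in> carrier E \<Longrightarrow> (bop E ^^ n) x \<in> carrier E"
  by (induction n) (auto simp: bop_closed)

lemma coord_bop: "x \<in> carrier E \<Longrightarrow> \<phi> (bop E x) = (\<lambda>i. fps_X * \<phi> x i)"
  by (simp add: bop_def coord_smult)

lemma coord_bop_pow: "x \<in> carrier E \<Longrightarrow> \<phi> ((bop E ^^ n) x) = (\<lambda>i. fps_X ^ n * \<phi> x i)"
  by (induction n) (auto simp: coord_bop bop_pow_closed mult_ac)

lemma fps_submodule_image: "fps_submodule (\<phi> ` carrier E)"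
  unfolding fps_submodule_def
proof (intro conjI ballI allI)
  show "0 \<in> \<phi> ` carrier E"
    using zero_mem coord_zero by (metis imageI)
next
  fix x y assume "x \<in> \<phi> ` carrier E" "y \<in> \<phi> ` carrier E"
  thus "x + y \<in> \<phi> ` carrier E"
    by (elim imageE) (simp add: coord_add[symmetric] add_mem)
next
  fix S x assume "x \<in> \<phi> ` carrier E"
  thus "(\<lambda>i. S * x i) \<in> \<phi> ` carrier E"
    by (elim imageE) (simp add: coord_smult[symmetric] smult_mem)
qed

lemma coord_lin:
  assumes "\<And>i. i < n \<Longrightarrow> u i \<in> carrier E"
  shows "\<phi> (\<Oplus>i\<in>{..<n}. c i \<odot> u i) = (\<lambda>k. \<Sum>i<n. c i * \<phi> (u i) k)"
  using assms by (subst coord_finsum) (auto simp: smult_mem coord_smult sum_fun_apply fun_eq_iff)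

lemma lin_closed:
  assumes "\<And>i. i < n \<Longrightarrow> u i \<in> carrier E"
  shows "(\<Oplus>i\<in>{..<n}. c i \<odot> u i) \<in> carrier E"
  using assms by (intro finsum_closed) (auto simp: smult_mem)

lemma has_rank_imp:
  assumes "has_rank E n"
  shows "\<exists>u. (\<forall>i<n. u i \<in> carrier E) \<and> (\<forall>x\<in>carrier E. \<exists>c. \<phi> x = (\<lambda>k. \<Sum>i<n. c i * \<phi> (u i) k)) \<and>
    (\<forall>c. (\<forall>k. (\<Sum>i<n. c i * \<phi> (u i) k) = 0) \<longrightarrow> (\<forall>i<n. c i = 0))"
proof -
  obtain u where u: "u \<in> {..<n} \<rightarrow> carrier E"
    and ex1: "\<And>x. x \<in> carrier E \<Longrightarrow>
      \<exists>!c. c \<in> extensional {..<n} \<and> x = (\<Oplus>i\<in>{..<n}. c i \<odot> u i)"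
    using assms unfolding has_rank_def by (elim bexE) (rule that, assumption, erule bspec)
  have uc: "\<And>i. i < n \<Longrightarrow> u i \<in> carrier E" using u by auto
  show ?thesis
  proof (rule exI[of _ u], intro conjI ballI allI impI)
    fix i assume "i < n" thus "u i \<in> carrier E" by (rule uc)
  next
    fix x assume "x \<in> carrier E"
    then obtain c where "x = (\<Oplus>i\<in>{..<n}. c i \<odot> u i)" using ex1 by blast
    thus "\<exists>c. \<phi> x = (\<lambda>k. \<Sum>i<n. c i * \<phi> (u i) k)"
      by (intro exI[of _ c]) (simp only: coord_lin[OF uc])
  next
    fix c :: "nat \<Rightarrow> complex fps" and i
    assume c: "\<forall>k. (\<Sum>i<n. c i * \<phi> (u i) k) = 0" and i: "i < n"
    \<comment> \<open>Uniqueness in \<open>has_rank\<close> ranges over \<open>extensional\<close>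
      families, hence both c and the zero family are restricted to the index set.\<close>
    define c' where "c' = (\<lambda>i\<in>{..<n}. c i)"
    define z where "z = (\<lambda>i\<in>{..<n}. 0 :: complex fps)"
    have "\<phi> (\<Oplus>i\<in>{..<n}. c' i \<odot> u i) = 0" "\<phi> (\<Oplus>i\<in>{..<n}. z i \<odot> u i) = 0"
      by (auto simp: coord_lin[OF uc] c'_def z_def c fun_eq_iff)
    hence "\<zero> = (\<Oplus>i\<in>{..<n}. c' i \<odot> u i)" "\<zero> = (\<Oplus>i\<in>{..<n}. z i \<odot> u i)"
      by (auto intro!: eqI lin_closed uc simp: coord_zero zero_mem)
    moreover have "c' \<in> extensional {..<n}" "z \<in> extensional {..<n}"
      by (auto simp: c'_def z_def)
    ultimately have "c' = z" using ex1[OF zero_mem] by (metis (no_types, lifting))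
    thus "c i = 0" using i by (metis c'_def z_def lessThan_iff restrict_apply)
  qed
qed

text \<open>More than n vectors, expressed through n generators, have a coefficient matrix with more
  rows than columns, and a relation between its rows is a relation between the vectors.\<close>

lemma rank_ge_independent:
  assumes rank: "has_rank E n"
    and v: "\<And>i. i < m \<Longrightarrow> v i \<in> carrier E"
      "\<forall>c. (\<forall>k. (\<Sum>i<m. c i * \<phi> (v i) k) = 0) \<longrightarrow> (\<forall>i<m. c i = 0)"
  shows "m \<le> n"
proof (rule ccontr)
  assume mn: "\<not> m \<le> n"
  obtain u where u: "\<forall>i<n. u i \<in> carrier E"
    "\<forall>x\<in>carrier E. \<exists>c. \<phi> x = (\<lambda>k. \<Sum>i<n. c i * \<phi> (u i) k)"
    using has_rank_imp[OF rank] by (elim exE conjE) (rule that; assumption)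
  have "\<forall>i\<in>{..<m}. \<exists>c. \<phi> (v i) = (\<lambda>k. \<Sum>j<n. c j * \<phi> (u j) k)"
    using u(2) v(1) by auto
  then obtain A where A: "\<And>i. i < m \<Longrightarrow> \<phi> (v i) = (\<lambda>k. \<Sum>j<n. A i j * \<phi> (u j) k)"
    using bchoice[of "{..<m}" "\<lambda>i c. \<phi> (v i) = (\<lambda>k. \<Sum>j<n. c j * \<phi> (u j) k)"] by auto
  obtain c where c: "\<exists>i\<in>{..<m}. c i \<noteq> 0" "\<forall>j\<in>{..<n}. (\<Sum>i\<in>{..<m}. c i * A i j) = 0"
    using more_vectors_than_coordinates_dependent[of "{..<n}" "{..<m}" A] mn by auto
  have "(\<Sum>i<m. c i * \<phi> (v i) k) = 0" for k
  proof -
    have "(\<Sum>i<m. c i * \<phi> (v i) k) = (\<Sum>i<m. \<Sum>j<n. c i * A i j * \<phi> (u j) k)"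
      using A by (simp add: sum_distrib_left mult_ac)
    also have "\<dots> = (\<Sum>j<n. (\<Sum>i<m. c i * A i j) * \<phi> (u j) k)"
      by (subst sum.swap) (simp add: sum_distrib_right)
    also have "\<dots> = 0" using c(2) by simp
    finally show ?thesis .
  qed
  hence "\<forall>i<m. c i = 0" by (intro v(2)[THEN spec, THEN mp] allI)
  thus False using c(1) by auto
qed

lemma has_rank_unique:
  assumes "has_rank E n" "has_rank E m"
  shows "m \<le> n"
proof -
  obtain u where u: "\<forall>i<m. u i \<in> carrier E"
    "\<forall>c. (\<forall>k. (\<Sum>i<m. c i * \<phi> (u i) k) = 0) \<longrightarrow> (\<forall>i<m. c i = 0)"
    using has_rank_imp[OF assms(2)] by (elim exE conjE) (rule that; assumption)
  show ?thesis
    using u(1) by (intro rank_ge_independent[OF assms(1) _ u(2)]) blast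
qed

lemma ab_rank_eq: "has_rank E n \<Longrightarrow> ab_rank E = n"
  unfolding ab_rank_def using has_rank_unique by (intro the_equality) (auto intro: antisym)

end

locale fin_coords = coords +
  fixes I :: "'b set"
  assumes finite_I: "finite I"
    and supp: "x \<in> carrier E \<Longrightarrow> i \<notin> I \<Longrightarrow> \<phi> x i = 0"
begin

lemma supp_image: "\<forall>x\<in>\<phi> ` carrier E. \<forall>i. i \<notin> I \<longrightarrow> x i = 0"
  using supp by auto

lemma ex_has_rank: "\<exists>n. has_rank E n"
proof -
  obtain r :: nat and w where w: "\<forall>i<r. w i \<in> \<phi> ` carrier E"
    and gen: "\<forall>x\<in>\<phi> ` carrier E. \<exists>c. x = (\<lambda>k. \<Sum>i<r. c i * w i k)"
    and indep: "\<forall>c. (\<forall>k. (\<Sum>i<r. c i * w i k) = 0) \<longrightarrow> (\<forall>i<r. c i = 0)"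
    using fps_submodule_basis[OF finite_I fps_submodule_image supp_image]
    by (elim exE conjE) (rule that; assumption)
  define u where "u = (\<lambda>i. the_inv_into (carrier E) \<phi> (w i))"
  have u: "u i \<in> carrier E" "\<phi> (u i) = w i" if "i < r" for i
    using the_inv_into_into[OF inj, of "w i"] f_the_inv_into_f[OF inj, of "w i"] w that
    by (auto simp: u_def)
  have lin: "\<phi> (\<Oplus>i\<in>{..<r}. c i \<odot> u i) = (\<lambda>k. \<Sum>i<r. c i * w i k)" for c
    using u by (subst coord_lin) (auto intro!: ext sum.cong)
  have "\<exists>!c. c \<in> extensional {..<r} \<and> x = (\<Oplus>i\<in>{..<r}. c i \<odot> u i)" if x: "x \<in> carrier E" for x
  proof -
    obtain c where c: "\<phi> x = (\<lambda>k. \<Sum>i<r. c i * w i k)" using gen x by blast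
    define c' where "c' = (\<lambda>i\<in>{..<r}. c i)"
    have "\<phi> x = (\<lambda>k. \<Sum>i<r. c' i * w i k)"
      unfolding c by (auto simp: c'_def)
    hence "x = (\<Oplus>i\<in>{..<r}. c' i \<odot> u i)"
      by (intro eqI x lin_closed) (simp_all add: lin u)
    moreover have "d = c'" if d: "d \<in> extensional {..<r}" "x = (\<Oplus>i\<in>{..<r}. d i \<odot> u i)" for d
    proof -
      have "\<phi> x k = (\<Sum>i<r. d i * w i k)" "\<phi> x k = (\<Sum>i<r. c' i * w i k)" for k
        using arg_cong[OF d(2), of "\<lambda>y. \<phi> y k"] \<open>\<phi> x = (\<lambda>k. \<Sum>i<r. c' i * w i k)\<close>
        by (simp_all add: lin)
      hence "(\<Sum>i<r. (d i - c' i) * w i k) = 0" for k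
        by (simp add: left_diff_distrib sum_subtractf)
      hence "\<forall>i<r. d i - c' i = 0" using indep[rule_format, of "\<lambda>i. d i - c' i"] by blast
      thus "d = c'"
        using d(1) by (intro extensionalityI[of _ "{..<r}"]) (auto simp: c'_def)
    qed
    moreover have "c' \<in> extensional {..<r}" by (simp add: c'_def)
    ultimately show ?thesis by (intro ex1I[of _ c']) auto
  qed
  thus ?thesis unfolding has_rank_def using u by (intro exI[of _ r] bexI[of _ u]) auto
qed

lemma rank_le_card:
  assumes "has_rank E n" shows "n \<le> card I"
proof (rule ccontr)
  assume n: "\<not> n \<le> card I"
  obtain u where u: "\<forall>i<n. u i \<in> carrier E"
    "\<forall>c. (\<forall>k. (\<Sum>i<n. c i * \<phi> (u i) k) = 0) \<longrightarrow> (\<forall>i<n. c i = 0)"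
    using has_rank_imp[OF assms] by (elim exE conjE) (rule that; assumption)
  obtain c where c: "\<exists>i\<in>{..<n}. c i \<noteq> 0" "\<forall>k\<in>I. (\<Sum>i\<in>{..<n}. c i * \<phi> (u i) k) = 0"
    using more_vectors_than_coordinates_dependent[of I "{..<n}" "\<lambda>i. \<phi> (u i)"] finite_I n by auto
  have "(\<Sum>i<n. c i * \<phi> (u i) k) = 0" for k
    using c(2) supp u(1) by (cases "k \<in> I") auto
  hence "\<forall>i<n. c i = 0" by (intro u(2)[THEN spec, THEN mp] allI)
  thus False using c(1) by auto
qed

lemma artin_rees:
  "\<exists>C. \<forall>L. \<forall>x\<in>carrier E. (\<forall>i. fps_X ^ (C + L) dvd \<phi> x i) \<longrightarrow>
     (\<exists>y\<in>carrier E. \<phi> x = (\<lambda>i. fps_X ^ L * \<phi> y i))"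
  using fps_submodule_artin_rees[OF finite_I fps_submodule_image supp_image]
  by (simp only: ball_simps bex_simps)

end

text \<open>In coordinates \<open>b\<close> is multiplication by \<open>X\<close>, and \<open>twist l t s\<close> is the operator
  \<open>b\<^sup>-\<^sup>1 a\<close>: it has weights \<open>l\<close> and a nilpotent part \<open>shift_part t s\<close>, the logarithm of the monodromy.\<close>

definition shift_part :: "('i \<Rightarrow> complex) \<Rightarrow> ('i \<Rightarrow> 'i) \<Rightarrow> ('i \<Rightarrow> complex fps) \<Rightarrow> 'i \<Rightarrow> complex fps" where
  "shift_part t s z = (\<lambda>i. fps_const (t i) * z (s i))"

definition twist :: "('i \<Rightarrow> complex) \<Rightarrow> ('i \<Rightarrow> complex) \<Rightarrow> ('i \<Rightarrow> 'i) \<Rightarrow>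
    ('i \<Rightarrow> complex fps) \<Rightarrow> 'i \<Rightarrow> complex fps" where
  "twist l t s z = (\<lambda>i. fps_const (l i) * z i + fps_X * fps_deriv (z i) + shift_part t s z i)"

lemma twist_add: "twist l t s (y + z) = twist l t s y + twist l t s z"
  by (simp add: twist_def shift_part_def fun_eq_iff algebra_simps)

lemma twist_const: "twist l t s (\<lambda>i. fps_const c * z i) = (\<lambda>i. fps_const c * twist l t s z i)"
  by (simp add: twist_def shift_part_def fun_eq_iff algebra_simps)

lemma twist_smult:
  "twist l t s (\<lambda>i. S * z i) = (\<lambda>i. S * twist l t s z i + fps_X * fps_deriv S * z i)"
  by (simp add: twist_def shift_part_def fun_eq_iff algebra_simps)

lemma X_deriv_X_power: "fps_X * fps_deriv (fps_X ^ n) = of_nat n * (fps_X :: complex fps) ^ n"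
proof (induction n)
  case (Suc n)
  have "fps_X * fps_deriv ((fps_X :: complex fps) ^ Suc n)
      = fps_X * (fps_X * fps_deriv (fps_X ^ n)) + fps_X ^ Suc n"
    by (simp add: algebra_simps del: fps_deriv_power)
  thus ?case
    by (subst (asm) Suc.IH) (simp add: algebra_simps)
qed simp

lemma twist_X_power:
  "twist l t s (\<lambda>i. fps_X ^ n * z i) = (\<lambda>i. fps_X ^ n * (twist l t s z i + of_nat n * z i))"
  unfolding twist_smult X_deriv_X_power by (simp add: fun_eq_iff algebra_simps)

lemma twist_nth:
  "fps_nth (twist l t s z i) n = (l i + of_nat n) * fps_nth (z i) n + t i * fps_nth (z (s i)) n"
  by (cases n) (simp_all add: twist_def shift_part_def algebra_simps)

locale realized = fin_coords E \<phi> I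
  for E :: "'m abm" (structure) and \<phi> :: "'m \<Rightarrow> 'i \<Rightarrow> complex fps" and I +
  fixes l t :: "'i \<Rightarrow> complex" and s :: "'i \<Rightarrow> 'i"
  assumes aop_mem: "x \<in> carrier E \<Longrightarrow> aop E x \<in> carrier E"
    and coord_aop: "x \<in> carrier E \<Longrightarrow> \<phi> (aop E x) = (\<lambda>i. fps_X * twist l t s (\<phi> x) i)"
begin

lemma ab_module: "ab_module E"
  unfolding ab_module_def
proof (intro conjI ballI allI module ex_has_rank)
  show "aop E \<in> carrier E \<rightarrow> carrier E" by (simp add: aop_mem)
next
  fix x y assume "x \<in> carrier E" "y \<in> carrier E"
  thus "aop E (x \<oplus> y) = aop E x \<oplus> aop E y"
    by (intro eqI) (auto simp: aop_mem add_mem coord_aop coord_add twist_add algebra_simps)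
next
  fix c x assume "x \<in> carrier E"
  thus "aop E (fps_const c \<odot> x) = fps_const c \<odot> aop E x"
    by (intro eqI) (auto simp: aop_mem smult_mem coord_aop coord_smult twist_const algebra_simps)
next
  fix x assume x: "x \<in> carrier E"
  show "aop E (bop E x) \<ominus> bop E (aop E x) = bop E (bop E x)"
  proof (rule eqI)
    show "\<phi> (aop E (bop E x) \<ominus> bop E (aop E x)) = \<phi> (bop E (bop E x))"
      using x by (simp add: aop_mem bop_closed coord_aop coord_bop coord_minus twist_smult
          algebra_simps fun_eq_iff)
  qed (use x in \<open>auto simp: aop_mem bop_closed\<close>)
qed

lemma realized_sub:
  assumes "ab_submodule M E"
  shows "realized (sub E M) \<phi> I l t s"
proof -
  interpret S: submodule M Cb E using assms by (simp add: ab_submodule_def)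
  have sub: "x \<in> carrier E" if "x \<in> M" for x using S.subset that by auto
  have cl: "\<zero> \<in> M" "\<And>x y. x \<in> M \<Longrightarrow> y \<in> M \<Longrightarrow> x \<oplus> y \<in> M" "\<And>S x. x \<in> M \<Longrightarrow> S \<odot> x \<in> M"
    "\<And>x. x \<in> M \<Longrightarrow> aop E x \<in> M"
    using S.one_closed S.m_closed S.smult_closed assms by (auto simp: ab_submodule_def Cb_def)
  show ?thesis
    by unfold_locales
      (use sub cl in \<open>auto simp: sub_def coord_zero coord_add coord_smult coord_aop
          finite_I supp intro: inj_on_subset[OF inj]\<close>)
qed

lemma ab_submoduleI:
  assumes "M \<subseteq> carrier E" "\<zero> \<in> M" "\<And>x y. x \<in> M \<Longrightarrow> y \<in> M \<Longrightarrow> x \<oplus> y \<in> M"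
    "\<And>S x. x \<in> M \<Longrightarrow> S \<odot> x \<in> M" "\<And>x. x \<in> M \<Longrightarrow> aop E x \<in> M"
  shows "ab_submodule M E"
  unfolding ab_submodule_def
proof (intro conjI ballI)
  show "submodule M Cb E"
  proof (rule submoduleI)
    fix x assume x: "x \<in> M"
    hence "\<ominus> x = (-1) \<odot> x"
      using subsetD[OF assms(1) x]
      by (intro eqI) (auto simp: coord_uminus coord_smult smult_mem fun_eq_iff)
    thus "\<ominus> x \<in> M" using assms(4)[OF x] by simp
  qed (use assms in auto)
qed (use assms in auto)

end

text \<open>A map that preserves coordinates is automatically an injective homomorphism: the weights
  on both sides agree, and both coordinate maps are injective.\<close>

lemma realized_imp_embeds:
  assumes "realized E \<phi> I l t s" "realized G \<psi> J l t s"
    and f: "\<And>x. x \<in> carrier E \<Longrightarrow> f x \<in> carrier G" "\<And>x. x \<in> carrier E \<Longrightarrow> \<psi> (f x) = \<phi> x"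
  shows "embeds E G"
proof -
  interpret E: realized E \<phi> I l t s by fact
  interpret G: realized G \<psi> J l t s by fact
  have "f \<in> ab_hom E G"
    unfolding ab_hom_def
    by (auto intro!: G.eqI simp: f E.add_mem E.smult_mem E.aop_mem G.add_mem G.smult_mem G.aop_mem
        E.coord_add E.coord_smult E.coord_aop G.coord_add G.coord_smult G.coord_aop)
  moreover have "inj_on f (carrier E)"
    by (rule inj_onI, rule E.eqI) (auto simp: f(2)[symmetric])
  ultimately show ?thesis unfolding embeds_def by blast
qed

text \<open>Coordinates are pulled back along the embedding. This is how abstract semi-simplicity
  becomes the existence of a second, diagonal realization.\<close>

lemma embeds_imp_realized:
  assumes "module Cb E" "\<And>x. x \<in> carrier E \<Longrightarrow> aop E x \<in> carrier E"
    "embeds E G" "realized G \<psi> J l t s"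
  obtains f where "realized E (\<lambda>x. \<psi> (f x)) J l t s"
proof -
  interpret E: module Cb E by fact
  interpret G: realized G \<psi> J l t s by fact
  obtain f where f: "f \<in> ab_hom E G" "inj_on f (carrier E)"
    using assms(3) unfolding embeds_def by blast
  have fG: "f x \<in> carrier G" if "x \<in> carrier E" for x using f(1) that by (auto simp: ab_hom_def)
  have h: "f (x \<oplus>\<^bsub>E\<^esub> y) = f x \<oplus>\<^bsub>G\<^esub> f y" "f (S \<odot>\<^bsub>E\<^esub> x) = S \<odot>\<^bsub>G\<^esub> f x" "f (aop E x) = aop G (f x)"
    if "x \<in> carrier E" "y \<in> carrier E" for x y S
    using f(1) that by (auto simp: ab_hom_def)
  have "\<psi> (f \<zero>\<^bsub>E\<^esub>) = \<psi> (f (\<zero>\<^bsub>E\<^esub> \<oplus>\<^bsub>E\<^esub> \<zero>\<^bsub>E\<^esub>))" by simp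
  also have "\<dots> = \<psi> (f \<zero>\<^bsub>E\<^esub>) + \<psi> (f \<zero>\<^bsub>E\<^esub>)"
    by (subst h) (auto simp: G.coord_add fG)
  finally have z: "\<psi> (f \<zero>\<^bsub>E\<^esub>) = 0" by (metis add_cancel_right_right)
  have "realized E (\<lambda>x. \<psi> (f x)) J l t s"
  proof unfold_locales
    show "inj_on (\<lambda>x. \<psi> (f x)) (carrier E)"
      using f(2) fG by (auto intro!: inj_onI dest: inj_onD inj_onD[OF G.inj])
  qed (use assms(2) in \<open>auto simp: Cb_def z h fG G.coord_add G.coord_smult G.coord_aop G.finite_I G.supp
        intro: E.smult_closed[unfolded Cb_def, simplified]\<close>)
  thus thesis by (rule that)
qed

section \<open>Quotients by kernels\<close>

text \<open>The cosets of the kernel of \<open>f\<close> are the fibres of \<open>f\<close>.\<close>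

definition fibre_value :: "('m \<Rightarrow> 'z) \<Rightarrow> 'm set \<Rightarrow> 'z" where
  "fibre_value f C = f (SOME x. x \<in> C)"

locale kernel_quot = abelian_group E
  for E :: "'m abm" (structure) and f :: "'m \<Rightarrow> 'z::ab_group_add" and M +
  assumes f_add: "x \<in> carrier E \<Longrightarrow> y \<in> carrier E \<Longrightarrow> f (x \<oplus> y) = f x + f y"
    and kernel: "M = {x \<in> carrier E. f x = 0}"
begin

lemma f_minus: "x \<in> carrier E \<Longrightarrow> y \<in> carrier E \<Longrightarrow> f (x \<ominus> y) = f x - f y"
  using f_add[of "x \<ominus> y" y] by (simp add: a_minus_def a_assoc l_neg algebra_simps)

lemma coset_eq: "x \<in> carrier E \<Longrightarrow> M +> x = {y \<in> carrier E. f y = f x}"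
proof (intro equalityI subsetI)
  fix y assume "x \<in> carrier E" "y \<in> {y \<in> carrier E. f y = f x}"
  hence "y \<ominus> x \<in> M" "y = (y \<ominus> x) \<oplus> x" "y \<in> carrier E"
    using f_minus[of y x] by (auto simp: kernel a_minus_def a_assoc l_neg)
  thus "y \<in> M +> x" unfolding a_r_coset_def' by blast
qed (auto simp: a_r_coset_def' kernel f_add)

lemma mem_coset: "x \<in> carrier E \<Longrightarrow> x \<in> M +> x"
  by (simp add: coset_eq)

lemma coset_eq_iff: "x \<in> carrier E \<Longrightarrow> y \<in> carrier E \<Longrightarrow> M +> x = M +> y \<longleftrightarrow> f x = f y"
  using coset_eq mem_coset by auto

lemma carrier_quot: "carrier (quot E M) = (\<lambda>x. M +> x) ` carrier E"
  by (auto simp: quot_def A_RCOSETS_def')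

lemma quotE:
  assumes "C \<in> carrier (quot E M)"
  obtains x where "x \<in> carrier E" "C = M +> x"
  using assms by (auto simp: carrier_quot)

lemma zero_quot: "\<zero>\<^bsub>quot E M\<^esub> = M +> \<zero>"
  using f_minus[of \<zero> \<zero>] by (simp add: quot_def coset_eq kernel a_minus_def)

lemma add_quot:
  assumes "x \<in> carrier E" "y \<in> carrier E"
  shows "(M +> x) \<oplus>\<^bsub>quot E M\<^esub> (M +> y) = M +> (x \<oplus> y)"
proof -
  have "(M +> x) \<oplus>\<^bsub>quot E M\<^esub> (M +> y) = (\<Union>h\<in>M +> x. \<Union>k\<in>M +> y. {h \<oplus> k})"
    by (simp add: quot_def set_add_def')
  also have "\<dots> = M +> (x \<oplus> y)"
  proof (intro equalityI subsetI)
    fix z assume "z \<in> M +> (x \<oplus> y)"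
    hence z: "z \<in> carrier E" "f z = f x + f y" using assms by (auto simp: coset_eq f_add)
    have "z \<ominus> x \<in> M +> y" "z = x \<oplus> (z \<ominus> x)"
      using assms z f_minus[of z x]
      by (simp_all add: coset_eq a_minus_def a_lcomm[of x z "\<ominus> x"] r_neg)
    thus "z \<in> (\<Union>h\<in>M +> x. \<Union>k\<in>M +> y. {h \<oplus> k})"
      using mem_coset[OF assms(1)] by blast
  qed (use assms in \<open>auto simp: coset_eq f_add\<close>)
  finally show ?thesis .
qed

lemma coset_map_eq:
  assumes "x \<in> carrier E" "\<And>y. y \<in> carrier E \<Longrightarrow> g y \<in> carrier E"
    "\<And>y. y \<in> carrier E \<Longrightarrow> f y = f x \<Longrightarrow> f (g y) = f (g x)"
  shows "coset_map E M g (M +> x) = M +> g x"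
proof -
  have "M +> g y = M +> g x" if "y \<in> M +> x" for y
  proof -
    have "y \<in> carrier E" "f y = f x" using that assms(1) by (simp_all add: coset_eq)
    thus ?thesis using assms(3)[of y] by (simp only: coset_eq_iff assms(1,2))
  qed
  thus ?thesis unfolding coset_map_def using mem_coset[OF assms(1)] by blast
qed

lemma fibre_value_coset: "x \<in> carrier E \<Longrightarrow> fibre_value f (M +> x) = f x"
  unfolding fibre_value_def using someI[of "\<lambda>y. y \<in> M +> x", OF mem_coset] by (auto simp: coset_eq)

lemma fibre_value_inj: "inj_on (fibre_value f) (carrier (quot E M))"
  by (rule inj_onI, elim quotE, simp only: fibre_value_coset coset_eq_iff)

end

locale realized_quot = kernel_quot E f M
  for E :: "'m abm" (structure) and f :: "'m \<Rightarrow> 'i \<Rightarrow> complex fps" and M +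
  fixes I :: "'i set" and l t :: "'i \<Rightarrow> complex" and s :: "'i \<Rightarrow> 'i"
  assumes finite_index: "finite I"
    and f_supp: "x \<in> carrier E \<Longrightarrow> i \<notin> I \<Longrightarrow> f x i = 0"
    and scale_mem: "x \<in> carrier E \<Longrightarrow> S \<odot> x \<in> carrier E"
    and f_smult: "x \<in> carrier E \<Longrightarrow> f (S \<odot> x) = (\<lambda>i. S * f x i)"
    and a_mem: "x \<in> carrier E \<Longrightarrow> aop E x \<in> carrier E"
    and f_aop: "x \<in> carrier E \<Longrightarrow> f (aop E x) = (\<lambda>i. fps_X * twist l t s (f x) i)"
begin

lemma smult_quot: "x \<in> carrier E \<Longrightarrow> S \<odot>\<^bsub>quot E M\<^esub> (M +> x) = M +> (S \<odot> x)"
  by (simp add: quot_def) (rule coset_map_eq, auto simp: scale_mem f_smult)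

lemma aop_quot: "x \<in> carrier E \<Longrightarrow> aop (quot E M) (M +> x) = M +> aop E x"
  by (simp add: quot_def) (rule coset_map_eq, auto simp: a_mem f_aop)

lemma realized: "realized (quot E M) (fibre_value f) I l t s"
proof unfold_locales
  show "inj_on (fibre_value f) (carrier (quot E M))" by (rule fibre_value_inj)
  show "\<zero>\<^bsub>quot E M\<^esub> \<in> carrier (quot E M)" by (auto simp: zero_quot carrier_quot)
  show "fibre_value f \<zero>\<^bsub>quot E M\<^esub> = 0"
    using f_add[of \<zero> \<zero>] by (simp add: zero_quot fibre_value_coset)
qed (auto elim!: quotE simp: add_quot smult_quot aop_quot carrier_quot fibre_value_coset scale_mem
      a_mem f_add f_smult f_aop f_supp finite_index)

end

section \<open>The modules \<open>\<E>\<^sub>\<lambda>\<close> and semi-simplicity\<close>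

definition b_series :: "complex fps \<Rightarrow> complex poly fps" where
  "b_series S = Abs_fps (\<lambda>n. [:fps_nth S n:])"

lemma b_series_nth [simp]: "fps_nth (b_series S) n = [:fps_nth S n:]"
  by (simp add: b_series_def)

lemma b_series_add: "b_series (S + T) = b_series S + b_series T"
  by (simp add: fps_eq_iff)

lemma b_series_diff: "b_series (S - T) = b_series S - b_series T"
  by (simp add: fps_eq_iff)

lemma pCons_sum: "[:sum f A:] = (\<Sum>x\<in>A. [:f x:])"
proof (induction A rule: infinite_finite_induct)
  case (insert x F)
  have "[:f x + sum f F:] = [:f x:] + [:sum f F:]" by simp
  thus ?case using insert by (simp del: add_pCons)
qed auto

lemma b_series_mult: "b_series (S * T) = b_series S * b_series T"
  by (auto simp: fps_eq_iff fps_mult_nth pCons_sum mult_ac intro!: sum.cong)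

lemma atilde_mult_b_series: "atilde_mult P (b_series T) = P * b_series T"
proof (rule fps_ext)
  fix n
  have "fps_nth (atilde_mult P (b_series T)) n = (\<Sum>\<mu>\<le>n. fps_nth P (n - \<mu>) * [:fps_nth T \<mu>:])"
    by (auto simp: atilde_mult_def rmult_poly_def intro!: sum.cong)
  also have "\<dots> = (\<Sum>\<mu>\<le>n. fps_nth P \<mu> * [:fps_nth T (n - \<mu>):])"
    by (rule sum.reindex_bij_witness[of _ "\<lambda>i. n - i" "\<lambda>i. n - i"]) auto
  finally show "fps_nth (atilde_mult P (b_series T)) n = fps_nth (P * b_series T) n"
    by (simp add: fps_mult_nth atMost_atLeast0)
qed

lemma atilde_mult_a: "atilde_mult P atilde_a = rmult_a P"
  using atilde_mult_rmult_a[of P 1] by (simp add: atilde_mult_one_right rmult_a_def atilde_a_def)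

definition a_minus_b :: "complex \<Rightarrow> complex poly fps" where
  "a_minus_b c = atilde_a - fps_const [:c:] * fps_X"

lemma atilde_mult_zero_left: "atilde_mult 0 f = 0"
  using atilde_mult_add_left[of 0 0 f] by simp

lemma atilde_mult_a_minus_b:
  "atilde_mult P (a_minus_b c) = rmult_a P - fps_const [:c:] * (P * fps_X)"
proof -
  have neg: "fps_const [:-c:] = - fps_const [:c:]" by simp
  have "atilde_mult P (a_minus_b c) = atilde_mult P (atilde_a + fps_const [:-c:] * (1 * fps_X))"
    by (simp only: neg a_minus_b_def mult_1 mult_minus_left diff_conv_add_uminus)
  also have "\<dots> = rmult_a P + fps_const [:-c:] * (P * fps_X)"
    unfolding atilde_mult_add_right atilde_mult_const_right atilde_mult_X
    by (simp only: atilde_mult_a atilde_mult_one_right)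
  also have "\<dots> = rmult_a P - fps_const [:c:] * (P * fps_X)"
    by (simp only: neg mult_minus_left diff_conv_add_uminus)
  finally show ?thesis .
qed

lemma atilde_mult_a_minus_b_nth:
  "fps_nth (atilde_mult P (a_minus_b c)) 0 = pCons 0 (fps_nth P 0)"
  "fps_nth (atilde_mult P (a_minus_b c)) (Suc n)
     = pCons 0 (fps_nth P (Suc n)) - Polynomial.smult (of_nat n + c) (fps_nth P n)"
  unfolding atilde_mult_a_minus_b
  by (simp_all add: rmult_a_nth of_nat_poly smult_add_left)

text \<open>Compare the coefficients of \<open>b^n\<close> from n = 0 upwards: once the previous
  coefficient of P is 0, the constant \<open>S_n\<close> equals \<open>a P_n\<close>, and both
  vanish. So C[[b]] meets the left ideal of \<open>a - c b\<close> only in 0.\<close>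

lemma b_series_in_ideal:
  assumes "b_series S = atilde_mult P (a_minus_b c)"
  shows "S = 0"
proof -
  have "fps_nth P n = 0 \<and> fps_nth S n = 0" for n
  proof (induction n)
    case 0
    show ?case using arg_cong[OF assms, of "\<lambda>f. fps_nth f 0"]
      by (simp add: atilde_mult_a_minus_b_nth)
  next
    case (Suc n)
    thus ?case using arg_cong[OF assms, of "\<lambda>f. fps_nth f (Suc n)"]
      by (simp add: atilde_mult_a_minus_b_nth)
  qed
  thus ?thesis by (simp add: fps_eq_iff)
qed

lemma pCons_poly_shift: "pCons (poly.coeff p 0) (poly_shift 1 p) = p"
  by (auto simp: poly_eq_iff coeff_pCons coeff_poly_shift split: nat.splits)

lemma ex_normal_form:
  "\<exists>S Q. P = b_series S + atilde_mult Q (a_minus_b c)"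
proof -
  \<comment> \<open>Division by a, one power of b at a time: the constant term of the current
    coefficient goes into S, the quotient by a into \<open>q\<close>, and the product
    \<open>(m + c) q m\<close> is carried over to the coefficient of \<open>b^(m+1)\<close>.\<close>
  define q where "q = rec_nat (poly_shift 1 (fps_nth P 0))
    (\<lambda>m r. poly_shift 1 (fps_nth P (Suc m) + Polynomial.smult (of_nat m + c) r))"
  have q: "q 0 = poly_shift 1 (fps_nth P 0)"
    "q (Suc m) = poly_shift 1 (fps_nth P (Suc m) + Polynomial.smult (of_nat m + c) (q m))" for m
    by (simp_all add: q_def)
  define S where "S = Abs_fps (\<lambda>n. case n of 0 \<Rightarrow> poly.coeff (fps_nth P 0) 0
    | Suc m \<Rightarrow> poly.coeff (fps_nth P (Suc m) + Polynomial.smult (of_nat m + c) (q m)) 0)"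
  have "fps_nth P n = fps_nth (b_series S
      + atilde_mult (Abs_fps q) (a_minus_b c)) n" for n
  proof (cases n)
    case 0
    thus ?thesis using pCons_poly_shift[of "fps_nth P 0"]
      by (simp add: atilde_mult_a_minus_b_nth q S_def)
  next
    case (Suc m)
    thus ?thesis using pCons_poly_shift[of "fps_nth P (Suc m) + Polynomial.smult (of_nat m + c) (q m)"]
      by (simp add: atilde_mult_a_minus_b_nth q S_def algebra_simps)
  qed
  thus ?thesis by (metis fps_ext)
qed

definition normal_form :: "complex \<Rightarrow> complex poly fps \<Rightarrow> complex fps" where
  "normal_form c P =
     (SOME S. \<exists>Q. P = b_series S + atilde_mult Q (a_minus_b c))"

lemma atilde_mult_diff_left: "atilde_mult (f - g) h = atilde_mult f h - atilde_mult g h"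
  using atilde_mult_add_left[of "f - g" g h] by simp

lemma normal_formI:
  assumes "P = b_series S + atilde_mult Q (a_minus_b c)"
  shows "normal_form c P = S"
proof -
  obtain Q' where "P = b_series (normal_form c P) + atilde_mult Q' (a_minus_b c)"
    unfolding normal_form_def using someI_ex[OF ex_normal_form[of P c]] by blast
  hence "b_series (normal_form c P - S) = atilde_mult (Q - Q') (a_minus_b c)"
    using assms by (simp add: b_series_diff atilde_mult_diff_left algebra_simps)
  thus ?thesis using b_series_in_ideal by force
qed

lemma normal_form_b_series: "normal_form c (b_series S) = S"
  by (rule normal_formI[of _ _ 0]) (simp add: atilde_mult_zero_left)

lemma normal_formE:
  obtains Q where "P = b_series (normal_form c P) + atilde_mult Q (a_minus_b c)"
  using ex_normal_form[of P c] normal_formI by metis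

lemma normal_form_add: "normal_form c (P + P') = normal_form c P + normal_form c P'"
proof -
  obtain Q where "P = b_series (normal_form c P) + atilde_mult Q (a_minus_b c)"
    by (rule normal_formE)
  moreover obtain Q' where "P' = b_series (normal_form c P') + atilde_mult Q' (a_minus_b c)"
    by (rule normal_formE)
  ultimately show ?thesis
    by (intro normal_formI[of _ _ "Q + Q'"]) (metis (no_types, lifting) add.assoc add.left_commute atilde_mult_add_left b_series_add)
qed

text \<open>The multiples of \<open>a - c b\<close> form a left ideal, so the right factor can be
  reduced before multiplying.\<close>

lemma normal_form_mult_left:
  "normal_form c (atilde_mult R P) = normal_form c (atilde_mult R (b_series (normal_form c P)))"
proof -
  obtain Q where P: "P = b_series (normal_form c P) + atilde_mult Q (a_minus_b c)"
    by (rule normal_formE)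
  define S where "S = normal_form c P"
  obtain Q' where Q': "atilde_mult R (b_series S) = b_series (normal_form c (atilde_mult R (b_series S)))
      + atilde_mult Q' (a_minus_b c)"
    by (rule normal_formE)
  have "atilde_mult R P = atilde_mult R (b_series S)
      + atilde_mult (atilde_mult R Q) (a_minus_b c)"
    by (subst P) (simp add: atilde_mult_add_right atilde_mult_assoc S_def)
  also have "\<dots> = b_series (normal_form c (atilde_mult R (b_series S)))
      + atilde_mult (Q' + atilde_mult R Q) (a_minus_b c)"
    by (subst Q') (simp add: atilde_mult_add_left)
  finally show ?thesis unfolding S_def by (rule normal_formI)
qed

lemma normal_form_smult: "normal_form c (atilde_mult (b_series R) P) = R * normal_form c P"
  by (subst normal_form_mult_left)
    (simp only: atilde_mult_b_series b_series_mult[symmetric] normal_form_b_series)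

text \<open>In \<open>Atilde\<close> one has \<open>a S(b) = S(b) a + b^2 S'(b)\<close>, and a final
  factor a may be replaced by \<open>c b\<close>. This yields the diagonal form of
  \<open>b^-1 a\<close> on \<open>E_mod\<close>.\<close>

lemma normal_form_a:
  "normal_form c (atilde_mult atilde_a P) = fps_X * (fps_const c * normal_form c P
     + fps_X * fps_deriv (normal_form c P))"
proof -
  define S where "S = normal_form c P"
  have "fps_nth (fps_const [:0, 1:] * b_series S) n
      = fps_nth (b_series (fps_X * (fps_const c * S + fps_X * fps_deriv S))
        + atilde_mult (b_series S) (a_minus_b c)) n" for n
  proof (cases n)
    case 0
    thus ?thesis by (simp add: atilde_mult_a_minus_b_nth)
  next
    case (Suc m)
    have "fps_nth (fps_X * fps_deriv S) m = of_nat m * fps_nth S m"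
      by (cases m) simp_all
    thus ?thesis by (simp add: Suc atilde_mult_a_minus_b_nth algebra_simps)
  qed
  hence "atilde_mult atilde_a (b_series S) = b_series (fps_X * (fps_const c * S + fps_X * fps_deriv S))
        + atilde_mult (b_series S) (a_minus_b c)"
    unfolding atilde_mult_b_series by (intro fps_ext) (simp only: atilde_a_def)
  thus ?thesis by (subst normal_form_mult_left) (auto intro: normal_formI simp: S_def)
qed

definition E_mod_coord :: "rat \<Rightarrow> complex poly fps set \<Rightarrow> unit \<Rightarrow> complex fps" where
  "E_mod_coord l = fibre_value (\<lambda>P _. normal_form (of_rat l) P)"

lemma Atilde_simps: "carrier Atilde = UNIV" "add Atilde = (+)" "zero Atilde = 0"
  "smult Atilde S = atilde_mult (b_series S)" "aop Atilde = atilde_mult atilde_a"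
  by (simp_all add: Atilde_def b_series_def)

lemma E_mod_quot: "realized_quot Atilde (\<lambda>P (_ :: unit). normal_form (of_rat l) P)
   {atilde_mult P (a_minus_b (of_rat l)) | P. True} UNIV (\<lambda>_. of_rat l) (\<lambda>_. 0) id"
proof -
  interpret ring Atilde by (rule ring_Atilde)
  have ker: "(\<exists>Q. P = atilde_mult Q (a_minus_b c)) \<longleftrightarrow> normal_form c P = 0" for P c
  proof
    assume "\<exists>Q. P = atilde_mult Q (a_minus_b c)"
    then obtain Q where "P = b_series 0 + atilde_mult Q (a_minus_b c)"
      by (auto simp: fps_eq_iff)
    thus "normal_form c P = 0" by (rule normal_formI)
  next
    assume "normal_form c P = 0"
    moreover obtain Q where
      "P = b_series (normal_form c P) + atilde_mult Q (a_minus_b c)"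
      by (rule normal_formE)
    moreover have "b_series 0 = 0" by (simp add: fps_eq_iff)
    ultimately show "\<exists>Q. P = atilde_mult Q (a_minus_b c)"
      by (intro exI[of _ Q]) simp
  qed
  show ?thesis
    by unfold_locales
      (auto simp: Atilde_simps normal_form_add normal_form_smult normal_form_a ker twist_def
        shift_part_def fun_eq_iff)
qed

lemma E_mod_realized: "realized (E_mod l) (E_mod_coord l) UNIV (\<lambda>_. of_rat l) (\<lambda>_. 0) id"
  unfolding E_mod_def E_mod_coord_def a_minus_b_def[symmetric] by (rule realized_quot.realized[OF E_mod_quot])

lemma E_mod_coord_surj: "\<exists>C\<in>carrier (E_mod l). E_mod_coord l C = (\<lambda>_. S)"
proof -
  interpret realized_quot Atilde "\<lambda>P (_ :: unit). normal_form (of_rat l) P"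
    "{atilde_mult P (a_minus_b (of_rat l)) | P. True}" UNIV "\<lambda>_. of_rat l" "\<lambda>_. 0" id
    by (rule E_mod_quot)
  show ?thesis
    unfolding E_mod_def E_mod_coord_def a_minus_b_def[symmetric] carrier_quot
    by (intro bexI[OF _ imageI[of "b_series S"]])
      (simp_all only: fibre_value_coset Atilde_simps normal_form_b_series UNIV_I)
qed

section \<open>Finite sums of the modules \<open>E_mod\<close> and semi-simplicity in
  coordinates\<close>

definition E_sum_coord :: "nat \<Rightarrow> (nat \<Rightarrow> rat) \<Rightarrow> (nat \<Rightarrow> complex poly fps set) \<Rightarrow> nat \<Rightarrow> complex fps" where
  "E_sum_coord n l x = (\<lambda>i. if i < n then E_mod_coord (l i) (x i) () else 0)"

lemma E_sum_realized:
  "realized (dsum n (\<lambda>i. E_mod (l i))) (E_sum_coord n l) {..<n} (\<lambda>i. of_rat (l i)) (\<lambda>_. 0) id"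
proof -
  interpret M: realized "E_mod r" "E_mod_coord r" UNIV "\<lambda>_. of_rat r" "\<lambda>_. 0" id for r
    by (rule E_mod_realized)
  have tw: "twist (\<lambda>_. of_rat (l i)) (\<lambda>_. 0) id (E_mod_coord (l i) C) ()
      = twist (\<lambda>i. of_rat (l i)) (\<lambda>_. 0) id (\<lambda>j. if j < n then E_mod_coord (l j) (x j) () else 0) i"
    if "x i = C" "i < n" for x i C
    using that by (simp add: twist_def shift_part_def)
  have tw_outside: "twist (\<lambda>i. of_rat (l i)) (\<lambda>_. 0) id (\<lambda>j. if j < n then z j else 0) i = 0"
    if "\<not> i < n" for z i
    using that by (simp add: twist_def shift_part_def)
  show ?thesis
  proof unfold_locales
    show "inj_on (E_sum_coord n l) (carrier (dsum n (\<lambda>i. E_mod (l i))))"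
    proof (rule inj_onI)
      fix x y assume xy: "x \<in> carrier (dsum n (\<lambda>i. E_mod (l i)))"
        "y \<in> carrier (dsum n (\<lambda>i. E_mod (l i)))" "E_sum_coord n l x = E_sum_coord n l y"
      show "x = y"
      proof (rule extensionalityI[of _ "{..<n}"])
        fix i assume i: "i \<in> {..<n}"
        have "E_mod_coord (l i) (x i) u = E_mod_coord (l i) (y i) u" for u
          using fun_cong[OF xy(3), of i] i by (cases u) (simp add: E_sum_coord_def)
        thus "x i = y i" using xy(1,2) i by (intro M.eqI) (auto simp: dsum_def PiE_def Pi_def)
      qed (use xy in \<open>auto simp: dsum_def PiE_def\<close>)
    qed
  qed (auto simp: dsum_def E_sum_coord_def M.zero_mem M.add_mem M.smult_mem M.aop_mem M.coord_zero
      M.coord_add M.coord_smult M.coord_aop PiE_def Pi_def fun_eq_iff tw tw_outside)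
qed

lemma E_sum_coord_surj:
  assumes "\<And>i. i \<ge> n \<Longrightarrow> z i = 0"
  shows "\<exists>x\<in>carrier (dsum n (\<lambda>i. E_mod (l i))). E_sum_coord n l x = z"
proof -
  have "\<exists>C. C \<in> carrier (E_mod (l i)) \<and> E_mod_coord (l i) C = (\<lambda>_. z i)" for i
    using E_mod_coord_surj[of "l i" "z i"] by auto
  then obtain C where C: "\<And>i. C i \<in> carrier (E_mod (l i))" "\<And>i. E_mod_coord (l i) (C i) = (\<lambda>_. z i)"
    by metis
  show ?thesis
    by (intro bexI[of _ "\<lambda>i\<in>{..<n}. C i"])
      (auto simp: dsum_def E_sum_coord_def C assms fun_eq_iff)
qed

lemma semi_simple_imp_realized:
  assumes "semi_simple E"
  obtains n :: nat and l :: "nat \<Rightarrow> rat" and \<psi> where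
    "realized E \<psi> {..<n} (\<lambda>i. of_rat (l i)) (\<lambda>_. 0) id"
proof -
  obtain n l where "ab_module E" "embeds E (dsum n (\<lambda>i. E_mod (l i)))"
    using assms by (auto simp: semi_simple_def)
  moreover from this have "module Cb E" "\<And>x. x \<in> carrier E \<Longrightarrow> aop E x \<in> carrier E"
    by (auto simp: ab_module_def)
  ultimately show thesis
    using embeds_imp_realized[OF _ _ _ E_sum_realized] that by metis
qed

text \<open>Every finite family of power series occurs as the coordinates of an element in a power
  of \<open>E_mod \<alpha>\<close>. Once the index set is numbered, an injective \<phi> without
  nilpotent part is therefore an embedding.\<close>

lemma realized_diag_imp_semi_simple:
  assumes "realized E \<phi> I (\<lambda>_. of_rat \<alpha>) (\<lambda>_. 0) s" "0 < \<alpha>"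
  shows "semi_simple E"
proof -
  interpret realized E \<phi> I "\<lambda>_. of_rat \<alpha>" "\<lambda>_. 0" s by fact
  define n where "n = card I"
  obtain h where h: "bij_betw h {..<n} I"
    using ex_bij_betw_nat_finite[OF finite_I] by (auto simp: n_def atLeast0LessThan)
  define \<psi> where "\<psi> = (\<lambda>x i. if i < n then \<phi> x (h i) else 0)"
  have inj': "inj_on \<psi> (carrier E)"
  proof (rule inj_onI, rule eqI)
    fix x y assume xy: "x \<in> carrier E" "y \<in> carrier E" "\<psi> x = \<psi> y"
    show "\<phi> x = \<phi> y"
    proof
      fix i show "\<phi> x i = \<phi> y i"
      proof (cases "i \<in> I")
        case True
        then obtain j where "j < n" "i = h j"
          using bij_betw_imp_surj_on[OF h] by auto
        thus ?thesis using fun_cong[OF xy(3), of j] by (simp add: \<psi>_def)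
      qed (use xy supp in auto)
    qed
  qed auto
  have "realized E \<psi> {..<n} (\<lambda>_. of_rat \<alpha>) (\<lambda>_. 0) id"
    by unfold_locales
      (use inj' in \<open>auto simp: \<psi>_def zero_mem add_mem smult_mem aop_mem coord_zero coord_add
        coord_smult coord_aop fun_eq_iff twist_def shift_part_def\<close>)
  moreover have "\<exists>y\<in>carrier (dsum n (\<lambda>_. E_mod \<alpha>)). E_sum_coord n (\<lambda>_. \<alpha>) y = \<psi> x" for x
    by (rule E_sum_coord_surj) (simp add: \<psi>_def)
  then obtain f where "\<And>x. f x \<in> carrier (dsum n (\<lambda>_. E_mod \<alpha>))"
    "\<And>x. E_sum_coord n (\<lambda>_. \<alpha>) (f x) = \<psi> x" by metis
  ultimately have "embeds E (dsum n (\<lambda>_. E_mod \<alpha>))"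
    by (intro realized_imp_embeds[OF _ E_sum_realized])
  thus ?thesis unfolding semi_simple_def using ab_module assms(2)
    by (intro conjI exI[of _ n] exI[of _ "\<lambda>_. \<alpha>"]) auto
qed

section \<open>The semi-simple filtration\<close>

text \<open>\<open>weight_shift t s c\<close> is \<open>twist - \<mu>\<close> on the coefficients of \<open>X\<^sup>n\<close>, for \<open>c = \<lambda> + n - \<mu>\<close>.\<close>

definition weight_shift :: "('i \<Rightarrow> complex) \<Rightarrow> ('i \<Rightarrow> 'i) \<Rightarrow> complex \<Rightarrow> ('i \<Rightarrow> complex) \<Rightarrow> 'i \<Rightarrow> complex" where
  "weight_shift t s c u = (\<lambda>i. c * u i + t i * u (s i))"

lemma weight_shift_commute:
  "weight_shift t s c (weight_shift t s d u) = weight_shift t s d (weight_shift t s c u)"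
  by (simp add: weight_shift_def fun_eq_iff algebra_simps)

lemma weight_shift_zero: "weight_shift t s c (\<lambda>_. 0) = (\<lambda>_. 0)"
  by (simp add: weight_shift_def fun_eq_iff)

text \<open>A nonzero scalar plus a nilpotent map is injective: where \<open>u i \<noteq> 0\<close>,
  the equation forces \<open>u (s i) \<noteq> 0\<close>, and following s leads out of the
  support.\<close>

lemma weight_shift_inj:
  assumes I: "\<And>i. i \<notin> I \<Longrightarrow> u i = 0" and nilp: "\<And>i. (s ^^ N) i \<notin> I"
    and c: "c \<noteq> 0" "weight_shift t s c u = 0"
  shows "u = 0"
proof (rule ccontr)
  assume "u \<noteq> 0"
  then obtain i where i: "u i \<noteq> 0" by (auto simp: fun_eq_iff)
  have step: "u (s j) \<noteq> 0" if "u j \<noteq> 0" for j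
    using fun_cong[OF c(2), of j] that c(1) by (auto simp: weight_shift_def)
  have "u ((s ^^ n) i) \<noteq> 0" for n
    by (induction n) (auto simp: i step)
  thus False using I nilp by blast
qed

lemma weight_shift_supp:
  assumes "\<And>i. i \<notin> I \<Longrightarrow> u i = 0" "\<And>i. i \<notin> I \<Longrightarrow> s i \<notin> I" "i \<notin> I"
  shows "weight_shift t s c u i = 0"
  using assms by (simp add: weight_shift_def)

definition weight_prod :: "('i \<Rightarrow> complex) \<Rightarrow> ('i \<Rightarrow> 'i) \<Rightarrow> complex \<Rightarrow> complex list \<Rightarrow>
    ('i \<Rightarrow> complex) \<Rightarrow> 'i \<Rightarrow> complex" where
  "weight_prod t s \<beta> = foldr (\<lambda>\<mu>. weight_shift t s (\<beta> - \<mu>))"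

lemma weight_prod_simps [simp]:
  "weight_prod t s \<beta> [] u = u"
  "weight_prod t s \<beta> (\<mu> # \<mu>s) u = weight_shift t s (\<beta> - \<mu>) (weight_prod t s \<beta> \<mu>s u)"
  by (simp_all add: weight_prod_def)

lemma weight_prod_supp:
  assumes "\<And>i. i \<notin> I \<Longrightarrow> u i = 0" "\<And>i. i \<notin> I \<Longrightarrow> s i \<notin> I" "i \<notin> I"
  shows "weight_prod t s \<beta> \<mu>s u i = 0"
  using assms(3)
proof (induction \<mu>s arbitrary: i)
  case (Cons \<mu> \<mu>s)
  show ?case using weight_shift_supp[OF Cons.IH assms(2) Cons.prems] by simp
qed (simp add: assms)

lemma weight_prod_commute:
  "weight_shift t s c (weight_prod t s \<beta> \<mu>s u)
     = weight_prod t s \<beta> \<mu>s (weight_shift t s c u)"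
proof (induction \<mu>s)
  case (Cons \<mu> \<mu>s)
  thus ?case using weight_shift_commute[of t s c "\<beta> - \<mu>"] by simp
qed simp

text \<open>A product of pairwise distinct factors contains a factor of weight \<open>0\<close> at most once.\<close>

lemma weight_prod_zero:
  assumes I: "\<And>i. i \<notin> I \<Longrightarrow> s i \<notin> I" and nilp: "\<And>i. (s ^^ N) i \<notin> I"
    and "distinct \<mu>s" "\<And>i. i \<notin> I \<Longrightarrow> u i = 0" "weight_prod t s \<beta> \<mu>s u = 0"
  shows "weight_shift t s 0 u = 0 \<and> (\<beta> \<notin> set \<mu>s \<longrightarrow> u = 0)"
  using assms(3-)
proof (induction \<mu>s arbitrary: u)
  case Nil
  thus ?case by (simp add: weight_shift_zero zero_fun_def)
next
  case (Cons \<mu> \<mu>s)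
  let ?v = "weight_prod t s \<beta> \<mu>s u"
  show ?case
  proof (cases "\<beta> = \<mu>")
    case False
    have "?v = 0"
    proof (rule weight_shift_inj[of I _ N s "\<beta> - \<mu>" t])
      show "?v i = 0" if "i \<notin> I" for i
        using that by (intro weight_prod_supp[of I]) (use Cons.prems I in auto)
    qed (use nilp False Cons.prems in auto)
    thus ?thesis using Cons.IH[of u] Cons.prems False by auto
  next
    case True
    \<comment> \<open>The factor of weight 0 is the nilpotent map itself. Commuted inwards, it
      leaves \<open>weight_shift t s 0 u\<close> under factors of nonzero weight, since \<beta> does
      not occur in \<open>\<mu>s\<close> again.\<close>
    hence "weight_prod t s \<beta> \<mu>s (weight_shift t s 0 u) = 0"
      using Cons.prems(3) by (simp add: weight_prod_commute zero_fun_def)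
    moreover have "weight_shift t s 0 u i = 0" if "i \<notin> I" for i
      using that by (intro weight_shift_supp[of I]) (use Cons.prems I in auto)
    ultimately have "weight_shift t s 0 u = 0"
      using Cons.IH[of "weight_shift t s 0 u"] Cons.prems(1) True by auto
    thus ?thesis using True by (simp add: zero_fun_def)
  qed
qed

definition twist_prod :: "('i \<Rightarrow> complex) \<Rightarrow> ('i \<Rightarrow> complex) \<Rightarrow> ('i \<Rightarrow> 'i) \<Rightarrow> complex list \<Rightarrow>
    ('i \<Rightarrow> complex fps) \<Rightarrow> 'i \<Rightarrow> complex fps" where
  "twist_prod l t s = foldr (\<lambda>\<mu> z i. twist l t s z i - fps_const \<mu> * z i)"

lemma twist_prod_nth:
  "(\<lambda>i. fps_nth (twist_prod (\<lambda>_. c) t s \<mu>s z i) n)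
     = weight_prod t s (c + of_nat n) \<mu>s (\<lambda>i. fps_nth (z i) n)"
proof (induction \<mu>s)
  case (Cons \<mu> \<mu>s)
  have "fps_nth (twist_prod (\<lambda>_. c) t s (\<mu> # \<mu>s) z i) n = weight_shift t s (c + of_nat n - \<mu>)
      (\<lambda>i. fps_nth (twist_prod (\<lambda>_. c) t s \<mu>s z i) n) i" for i
    by (simp add: twist_prod_def twist_nth weight_shift_def algebra_simps)
  thus ?case using Cons by auto
qed (simp add: twist_prod_def)

lemma twist_prod_diag_nth:
  "fps_nth (twist_prod l (\<lambda>_. 0) s \<mu>s z i) n
     = (\<Prod>\<mu>\<leftarrow>\<mu>s. l i + of_nat n - \<mu>) * fps_nth (z i) n"
  by (induction \<mu>s) (simp_all add: twist_prod_def twist_nth algebra_simps)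

text \<open>\<open>a - (d + \<mu>) b\<close> maps \<open>b\<^sup>d z\<close> to \<open>b\<^bsup>d+1\<^esup> (b\<^sup>-\<^sup>1 a - \<mu>) z\<close>.\<close>

primrec a_prod :: "'m abm \<Rightarrow> complex list \<Rightarrow> 'm \<Rightarrow> 'm" where
  "a_prod E [] x = x"
| "a_prod E (\<mu> # \<mu>s) x = aop E (a_prod E \<mu>s x)
     \<oplus>\<^bsub>E\<^esub> (fps_const (- (\<mu> + of_nat (length \<mu>s))) * fps_X) \<odot>\<^bsub>E\<^esub> a_prod E \<mu>s x"

context realized
begin

lemma a_prod_mem: "x \<in> carrier E \<Longrightarrow> a_prod E \<mu>s x \<in> carrier E"
  by (induction \<mu>s) (auto simp: aop_mem add_mem smult_mem)

lemma coord_a_prod: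
  assumes "x \<in> carrier E"
  shows "\<phi> (a_prod E \<mu>s x) = (\<lambda>i. fps_X ^ length \<mu>s * twist_prod l t s \<mu>s (\<phi> x) i)"
proof (induction \<mu>s)
  case (Cons \<mu> \<mu>s)
  define z where "z = twist_prod l t s \<mu>s (\<phi> x)"
  define d where "d = length \<mu>s"
  define K where "K = fps_const (- (\<mu> + of_nat d))"
  define M where "M = fps_const \<mu>"
  have K: "K = - (M + of_nat d)"
    by (simp add: K_def M_def fps_of_nat[symmetric] del: fps_of_nat)
  have "a_prod E (\<mu> # \<mu>s) x = aop E (a_prod E \<mu>s x) \<oplus> (K * fps_X) \<odot> a_prod E \<mu>s x"
    by (simp add: K_def d_def)
  hence "\<phi> (a_prod E (\<mu> # \<mu>s) x) i
      = fps_X * (fps_X ^ d * (twist l t s z i + of_nat d * z i)) + K * fps_X * (fps_X ^ d * z i)" for i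
    using assms
    by (simp add: coord_add coord_aop coord_smult aop_mem smult_mem a_prod_mem Cons
        z_def[symmetric] d_def[symmetric] twist_X_power)
  also have "fps_X * (fps_X ^ d * (twist l t s z i + of_nat d * z i)) + K * fps_X * (fps_X ^ d * z i)
      = fps_X ^ length (\<mu> # \<mu>s) * (twist l t s z i - M * z i)" for i
    by (simp add: K d_def[symmetric] algebra_simps)
  finally have "\<phi> (a_prod E (\<mu> # \<mu>s) x)
      = (\<lambda>i. fps_X ^ length (\<mu> # \<mu>s) * (twist l t s z i - M * z i))" ..
  thus ?case by (simp add: twist_prod_def z_def M_def)
qed (simp add: twist_prod_def)

end

text \<open>Two realizations of one module are played against each other. The diagonal one, \<psi>,
  tells which product of factors produces high divisibility; \<phi>, which contains the nilpotent
  part, tells what this divisibility forces. The product depends on the coefficient n under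
  consideration.\<close>

lemma diag_realized_imp_shift_part_zero:
  assumes "realized E \<phi> I (\<lambda>_. c) t s" "realized E \<psi> J l (\<lambda>_. 0) r"
    and I: "\<And>i. i \<notin> I \<Longrightarrow> s i \<notin> I" and nilp: "\<And>i. (s ^^ N) i \<notin> I"
    and x: "x \<in> carrier E"
  shows "shift_part t s (\<phi> x) = 0"
proof -
  interpret P: realized E \<phi> I "\<lambda>_. c" t s by fact
  interpret D: realized E \<psi> J l "\<lambda>_. 0" r by fact
  obtain C where C: "\<forall>L. \<forall>x\<in>carrier E. (\<forall>i. fps_X ^ (C + L) dvd \<psi> x i) \<longrightarrow>
     (\<exists>y\<in>carrier E. \<psi> x = (\<lambda>i. fps_X ^ L * \<psi> y i))"
    using D.artin_rees by (elim exE) (rule that)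
  have "weight_shift t s 0 (\<lambda>i. fps_nth (\<phi> x i) n) = 0" for n
  proof -
    \<comment> \<open>Artin-Rees loses C orders, and \<open>Suc n\<close> orders must survive in
      order to reach the coefficient of \<open>X^n\<close>.\<close>
    define L where "L = C + Suc n"
    \<comment> \<open>These are the eigenvalues of \<open>b^-1 a\<close> on the coefficients of
      order below L in the diagonal realization. Each is listed once, as
      \<open>weight_prod_zero\<close> requires distinct factors.\<close>
    have "finite ((\<lambda>(i, m). l i + of_nat m) ` (J \<times> {..<L}))"
      using D.finite_I by simp
    then obtain \<mu>s where \<mu>s: "set \<mu>s = (\<lambda>(i, m). l i + of_nat m) ` (J \<times> {..<L})" "distinct \<mu>s"
      using finite_distinct_list by metis
    define d where "d = length \<mu>s"
    define y where "y = a_prod E \<mu>s x"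
    have y: "y \<in> carrier E" unfolding y_def by (rule P.a_prod_mem[OF x])
    have dvd: "fps_X ^ (C + (d + Suc n)) dvd \<psi> y i" for i
    proof -
      have "fps_nth (twist_prod l (\<lambda>_. 0) r \<mu>s (\<psi> x) i) m = 0" if m: "m < L" for m
      proof (cases "i \<in> J")
        case True
        hence "l i + of_nat m \<in> set \<mu>s" using m unfolding \<mu>s by force
        hence "(\<Prod>\<mu>\<leftarrow>\<mu>s. l i + of_nat m - \<mu>) = 0" by (auto simp: prod_list_zero_iff)
        thus ?thesis by (simp add: twist_prod_diag_nth)
      qed (simp add: twist_prod_diag_nth D.supp x)
      hence "fps_X ^ L dvd twist_prod l (\<lambda>_. 0) r \<mu>s (\<psi> x) i"
        by (simp add: X_power_dvd_iff)
      hence "fps_X ^ d * fps_X ^ L dvd \<psi> y i"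
        unfolding y_def D.coord_a_prod[OF x] d_def by (intro mult_dvd_mono) auto
      thus ?thesis by (simp add: L_def power_add mult_ac)
    qed
    have "\<exists>y'\<in>carrier E. \<psi> y = (\<lambda>i. fps_X ^ (d + Suc n) * \<psi> y' i)"
      by (intro C[THEN spec, THEN bspec, THEN mp] y allI dvd)
    then obtain y' where y': "y' \<in> carrier E" "\<psi> y = (\<lambda>i. fps_X ^ (d + Suc n) * \<psi> y' i)"
      by (elim bexE)
    \<comment> \<open>Divisibility has become a relation between elements of E, so it passes from
      \<psi> to \<phi>.\<close>
    have "y = (fps_X ^ (d + Suc n)) \<odot>\<^bsub>E\<^esub> y'"
      by (rule D.eqI) (simp_all add: y y' D.smult_mem D.coord_smult)
    hence "\<phi> y = (\<lambda>i. fps_X ^ (d + Suc n) * \<phi> y' i)"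
      by (simp add: P.coord_smult y')
    hence "fps_X ^ d * twist_prod (\<lambda>_. c) t s \<mu>s (\<phi> x) i = fps_X ^ d * (fps_X ^ Suc n * \<phi> y' i)" for i
      using P.coord_a_prod[OF x, of \<mu>s] unfolding y_def d_def
      by (metis (no_types, lifting) mult.assoc power_add)
    hence eq: "twist_prod (\<lambda>_. c) t s \<mu>s (\<phi> x) i = fps_X ^ Suc n * \<phi> y' i" for i
      by (metis fps_X_neq_zero mult_cancel_left power_not_zero)
    hence "(\<lambda>i. fps_nth (twist_prod (\<lambda>_. c) t s \<mu>s (\<phi> x) i) n) = 0"
      by (simp add: fps_X_power_mult_nth fun_eq_iff del: power_Suc)
    hence "weight_prod t s (c + of_nat n) \<mu>s (\<lambda>i. fps_nth (\<phi> x i) n) = 0"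
      by (simp only: twist_prod_nth)
    moreover have "fps_nth (\<phi> x i) n = 0" if "i \<notin> I" for i
      using P.supp[OF x that] by simp
    ultimately show ?thesis
      using weight_prod_zero[of I s N \<mu>s "\<lambda>i. fps_nth (\<phi> x i) n" t "c + of_nat n"] I nilp \<mu>s(2)
      by blast
  qed
  hence "fps_nth (shift_part t s (\<phi> x) i) n = 0" for i n
    by (simp add: shift_part_def weight_shift_def fun_eq_iff)
  thus ?thesis by (auto simp: fps_eq_iff)
qed

lemma shift_part_add: "shift_part t s (y + z) = shift_part t s y + shift_part t s z"
  by (simp add: shift_part_def fun_eq_iff algebra_simps)

lemma shift_part_smult: "shift_part t s (\<lambda>i. S * z i) = (\<lambda>i. S * shift_part t s z i)"
  by (simp add: shift_part_def fun_eq_iff algebra_simps)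

lemma shift_part_zero: "shift_part t s 0 = 0"
  by (simp add: shift_part_def fun_eq_iff)

lemma twist_zero: "twist l t s 0 = 0"
  by (simp add: shift_part_def twist_def fun_eq_iff)

lemma shift_part_twist:
  "shift_part t s (twist (\<lambda>_. c) t s z) = twist (\<lambda>_. c) t s (shift_part t s z)"
  by (simp add: shift_part_def twist_def fun_eq_iff algebra_simps)

lemma shift_part_pow_add:
  "(shift_part t s ^^ j) (y + z) = (shift_part t s ^^ j) y + (shift_part t s ^^ j) z"
  by (induction j) (simp_all only: funpow.simps comp_apply id_apply shift_part_add)

lemma shift_part_pow_smult:
  "(shift_part t s ^^ j) (\<lambda>i. S * z i) = (\<lambda>i. S * (shift_part t s ^^ j) z i)"
  by (induction j) (simp_all add: shift_part_smult)

lemma shift_part_pow_twist: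
  "(shift_part t s ^^ j) (twist (\<lambda>_. c) t s z) = twist (\<lambda>_. c) t s ((shift_part t s ^^ j) z)"
  by (induction j) (simp_all add: shift_part_twist)

section \<open>Kernels of powers of the nilpotent part\<close>

locale log_realized = realized E \<phi> I "\<lambda>_. of_rat \<alpha>" t s
  for E :: "'m abm" (structure) and \<phi> :: "'m \<Rightarrow> 'i \<Rightarrow> complex fps" and I and \<alpha> :: rat and t s +
  fixes N :: nat
  assumes \<alpha>_pos: "0 < \<alpha>"
    and outside: "i \<notin> I \<Longrightarrow> s i \<notin> I"
    and nilpotent: "(s ^^ N) i \<notin> I"
begin

text \<open>On the kernel of the nilpotent part the action is diagonal, which makes the kernel
  semi-simple. Conversely, a semi-simple submodule has a diagonal realization and is killed by the
  nilpotent part. So the greatest element exists.\<close>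

lemma ss_part_eq: "ss_part E = {x \<in> carrier E. shift_part t s (\<phi> x) = 0}" (is "_ = ?M")
  unfolding ss_part_def
proof (rule Greatest_equality)
  have sub: "ab_submodule ?M E"
    by (rule ab_submoduleI)
      (auto simp: zero_mem add_mem smult_mem aop_mem coord_zero coord_add coord_smult coord_aop
        shift_part_zero shift_part_add shift_part_smult shift_part_twist twist_zero zero_fun_def[symmetric])
  interpret S: realized "sub E ?M" \<phi> I "\<lambda>_. of_rat \<alpha>" t s
    by (rule realized_sub[OF sub])
  have tw: "twist (\<lambda>_. of_rat \<alpha>) t s (\<phi> x) = twist (\<lambda>_. of_rat \<alpha>) (\<lambda>_. 0) s (\<phi> x)"
    if "shift_part t s (\<phi> x) = 0" for x
    using that by (simp add: twist_def shift_part_def fun_eq_iff)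
  have "realized (sub E ?M) \<phi> I (\<lambda>_. of_rat \<alpha>) (\<lambda>_. 0) s"
  proof unfold_locales
    fix x assume x: "x \<in> carrier (sub E ?M)"
    show "aop (sub E ?M) x \<in> carrier (sub E ?M)" by (rule S.aop_mem[OF x])
    show "\<phi> (aop (sub E ?M) x) = (\<lambda>i. fps_X * twist (\<lambda>_. of_rat \<alpha>) (\<lambda>_. 0) s (\<phi> x) i)"
      using x unfolding S.coord_aop[OF x] by (subst tw) (simp_all add: sub_def)
  qed
  thus "ab_submodule ?M E \<and> semi_simple (sub E ?M)"
    using sub realized_diag_imp_semi_simple \<alpha>_pos by blast
next
  fix M assume M: "ab_submodule M E \<and> semi_simple (sub E M)"
  obtain n :: nat and l \<psi> where D: "realized (sub E M) \<psi> {..<n} (\<lambda>i. of_rat (l i)) (\<lambda>_. 0) id"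
    using semi_simple_imp_realized M by blast
  have P: "realized (sub E M) \<phi> I (\<lambda>_. of_rat \<alpha>) t s"
    using M by (intro realized_sub) simp
  have "shift_part t s (\<phi> x) = 0" if "x \<in> M" for x
  proof (rule diag_realized_imp_shift_part_zero[OF P D])
    show "x \<in> carrier (sub E M)" using that by (simp add: sub_def)
  qed (use outside nilpotent in auto)
  moreover have "M \<subseteq> carrier E"
  proof -
    interpret S: submodule M Cb E using M by (simp add: ab_submodule_def)
    show ?thesis using S.subset by simp
  qed
  ultimately show "M \<subseteq> ?M" by auto
qed

definition filt :: "nat \<Rightarrow> 'm set" where
  "filt j = {x \<in> carrier E. (shift_part t s ^^ j) (\<phi> x) = 0}"

lemma shift_part_pow_supp:
  assumes "x \<in> carrier E" "i \<notin> I"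
  shows "(shift_part t s ^^ j) (\<phi> x) i = 0"
  using assms(2)
proof (induction j arbitrary: i)
  case (Suc j)
  thus ?case using outside[OF Suc.prems] by (simp add: shift_part_def)
qed (simp add: supp assms(1))

text \<open>The j-th power of \<open>shift_part\<close> supplies coordinates on the quotient by its
  kernel. As the weight is constant, it commutes with \<open>twist\<close>, so the quotient has the
  same weights and nilpotent part and \<open>ss_part_eq\<close> applies to it again.\<close>

lemma filt_quot: "realized_quot E (\<lambda>x. (shift_part t s ^^ j) (\<phi> x)) (filt j) I (\<lambda>_. of_rat \<alpha>) t s"
  by unfold_locales
    (auto simp: filt_def coord_add coord_smult coord_aop shift_part_pow_add shift_part_pow_smult
      shift_part_pow_twist shift_part_pow_supp finite_I smult_mem aop_mem)

lemma filt_quot_realized: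
  "log_realized (quot E (filt j)) (fibre_value (\<lambda>x. (shift_part t s ^^ j) (\<phi> x))) I \<alpha> t s N"
  using realized_quot.realized[OF filt_quot] outside nilpotent \<alpha>_pos
  by (simp add: log_realized_def log_realized_axioms_def)

lemma ss_filt_eq: "ss_filt E j = filt j"
proof (induction j)
  case 0
  have "x = \<zero>" if "x \<in> carrier E" "\<phi> x = 0" for x
    using that by (intro eqI) (auto simp: zero_mem coord_zero)
  thus ?case by (auto simp: filt_def zero_mem coord_zero)
next
  case (Suc j)
  interpret Q: realized_quot E "\<lambda>x. (shift_part t s ^^ j) (\<phi> x)" "filt j" I "\<lambda>_. of_rat \<alpha>" t s
    by (rule filt_quot)
  have "filt j +> x \<in> ss_part (quot E (filt j)) \<longleftrightarrow> (shift_part t s ^^ Suc j) (\<phi> x) = 0"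
    if "x \<in> carrier E" for x
    using that by (simp add: log_realized.ss_part_eq[OF filt_quot_realized] Q.fibre_value_coset Q.carrier_quot)
  thus ?case by (auto simp: Suc filt_def)
qed

end

section \<open>Minimal polynomials of diagonal operators\<close>

lemma prod_linear_dvd_iff:
  fixes q :: "complex poly"
  assumes "finite A"
  shows "(\<Prod>a\<in>A. [:-a, 1:]) dvd q \<longleftrightarrow> (\<forall>a\<in>A. poly q a = 0)"
  using assms
proof (induction A arbitrary: q rule: finite_induct)
  case (insert a A)
  show ?case
  proof
    assume "\<forall>b\<in>insert a A. poly q b = 0"
    then obtain r where r: "q = [:-a, 1:] * r" "\<forall>b\<in>A. poly q b = 0"
      by (metis dvdE insertI1 insertI2 poly_eq_0_iff_dvd)
    have "\<forall>b\<in>A. poly r b = 0" using r insert.hyps(2) by auto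
    hence "(\<Prod>b\<in>A. [:-b, 1:]) dvd r" by (simp only: insert.IH)
    thus "(\<Prod>b\<in>insert a A. [:-b, 1:]) dvd q"
      unfolding r(1) prod.insert[OF insert.hyps] by (rule mult_dvd_mono[OF dvd_refl])
  next
    assume dvd: "(\<Prod>b\<in>insert a A. [:-b, 1:]) dvd q"
    have "[:-b, 1:] dvd q" if "b \<in> insert a A" for b
      using dvd_trans[OF dvd_prodI[of "insert a A" b "\<lambda>b. [:-b, 1:]"] dvd] that insert.hyps by simp
    thus "\<forall>b\<in>insert a A. poly q b = 0" by (simp add: poly_eq_0_iff_dvd)
  qed
qed simp

lemma monic_dvd_antisym:
  fixes p q :: "complex poly"
  assumes "p dvd q" "q dvd p" "lead_coeff p = 1" "lead_coeff q = 1"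
  shows "p = q"
proof -
  obtain r where r: "q = p * r" using assms(1) by (rule dvdE)
  have "p \<noteq> 0" "q \<noteq> 0" using assms(3,4) by auto
  hence "degree q \<le> degree p" "r \<noteq> 0" using dvd_imp_degree_le[OF assms(2)] r by auto
  hence "degree r = 0" using r \<open>p \<noteq> 0\<close> by (simp add: degree_mult_eq)
  then obtain c where c: "r = [:c:]" by (rule degree_eq_zeroE)
  have "lead_coeff q = lead_coeff p * lead_coeff r" by (simp add: r lead_coeff_mult)
  hence "c = 1" using assms(3,4) c by simp
  thus ?thesis using r c by simp
qed

text \<open>\<open>q(f)\<close> multiplies the coordinate j by \<open>q(\<mu> j)\<close>. Each
  coordinate in J is nonzero on some element, so q annihilates everything iff it vanishes at all
  eigenvalues; no basis of Q has to be exhibited.\<close>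

lemma min_poly_diagonal:
  fixes Q :: "'m abm" (structure) and \<eta> :: "'m \<Rightarrow> 'i \<Rightarrow> complex"
  assumes Q: "abelian_monoid Q" and inj: "inj_on \<eta> (carrier Q)"
    and zero: "\<eta> \<zero> = (\<lambda>_. 0)"
    and add: "\<And>x y. x \<in> carrier Q \<Longrightarrow> y \<in> carrier Q \<Longrightarrow> \<eta> (x \<oplus> y) = (\<lambda>i. \<eta> x i + \<eta> y i)"
    and scale_mem: "\<And>a x. x \<in> carrier Q \<Longrightarrow> fps_const a \<odot> x \<in> carrier Q"
    and scale: "\<And>a x. x \<in> carrier Q \<Longrightarrow> \<eta> (fps_const a \<odot> x) = (\<lambda>i. a * \<eta> x i)"
    and f_mem: "\<And>x. x \<in> carrier Q \<Longrightarrow> f x \<in> carrier Q"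
    and f: "\<And>x. x \<in> carrier Q \<Longrightarrow> \<eta> (f x) = (\<lambda>i. \<mu> i * \<eta> x i)"
    and supp: "\<And>x i. x \<in> carrier Q \<Longrightarrow> i \<notin> J \<Longrightarrow> \<eta> x i = 0"
    and J: "finite J" "inj_on \<mu> J" "\<And>j. j \<in> J \<Longrightarrow> \<exists>x\<in>carrier Q. \<eta> x j \<noteq> 0"
  shows "min_poly Q f = (\<Prod>j\<in>J. [:- \<mu> j, 1:])"
proof -
  interpret abelian_monoid Q by fact
  have pow_mem: "(f ^^ i) x \<in> carrier Q" if "x \<in> carrier Q" for x i
    using that by (induction i) (auto simp: f_mem)
  have pow: "\<eta> ((f ^^ i) x) = (\<lambda>j. \<mu> j ^ i * \<eta> x j)" if "x \<in> carrier Q" for x i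
    using that by (induction i) (auto simp: f pow_mem)
  have fsum: "\<eta> (\<Oplus>i\<in>{..n}. h i) = (\<lambda>j. \<Sum>i\<le>n. \<eta> (h i) j) \<and> (\<Oplus>i\<in>{..n}. h i) \<in> carrier Q"
    if "\<And>i. h i \<in> carrier Q" for h and n :: nat
    using that by (induction n) (auto simp: Pi_def add finsum_0 finsum_Suc add.commute)
  have act_mem: "poly_act Q f q x \<in> carrier Q"
    and act: "\<eta> (poly_act Q f q x) = (\<lambda>j. poly q (\<mu> j) * \<eta> x j)" if "x \<in> carrier Q" for q x
    using fsum[of "\<lambda>i. fps_const (poly.coeff q i) \<odot> (f ^^ i) x" "degree q"] that
    by (auto simp: poly_act_def scale scale_mem pow_mem pow poly_altdef sum_distrib_left
        sum_distrib_right mult_ac)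
  have annih: "(\<forall>x\<in>carrier Q. poly_act Q f q x = \<zero>) \<longleftrightarrow> (\<Prod>j\<in>J. [:- \<mu> j, 1:]) dvd q" for q
  proof -
    have "(\<Prod>j\<in>J. [:- \<mu> j, 1:]) = (\<Prod>a\<in>\<mu> ` J. [:-a, 1:])"
      by (simp add: prod.reindex J)
    hence "(\<Prod>j\<in>J. [:- \<mu> j, 1:]) dvd q \<longleftrightarrow> (\<forall>j\<in>J. poly q (\<mu> j) = 0)"
      using J(1) by (simp add: prod_linear_dvd_iff)
    also have "\<dots> \<longleftrightarrow> (\<forall>x\<in>carrier Q. poly_act Q f q x = \<zero>)"
    proof (intro iffI ballI)
      fix x assume q: "\<forall>j\<in>J. poly q (\<mu> j) = 0" and x: "x \<in> carrier Q"
      have "poly q (\<mu> j) * \<eta> x j = 0" for j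
        using q supp[OF x, of j] by (cases "j \<in> J") auto
      hence "\<eta> (poly_act Q f q x) = \<eta> \<zero>" unfolding act[OF x] zero by (intro ext)
      thus "poly_act Q f q x = \<zero>" using inj act_mem[OF x] by (auto dest: inj_onD)
    next
      fix j assume q: "\<forall>x\<in>carrier Q. poly_act Q f q x = \<zero>" and j: "j \<in> J"
      obtain x where x: "x \<in> carrier Q" "\<eta> x j \<noteq> 0" using J(3)[OF j] by blast
      have "poly q (\<mu> j) * \<eta> x j = \<eta> \<zero> j"
        using fun_cong[OF act[OF x(1), of q], of j] bspec[OF q x(1)] by simp
      hence "poly q (\<mu> j) * \<eta> x j = 0" by (simp add: zero)
      thus "poly q (\<mu> j) = 0" using x by simp
    qed
    finally show ?thesis by blast
  qed
  have monic: "lead_coeff (\<Prod>j\<in>J. [:- \<mu> j, 1:]) = 1"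
    by (simp add: lead_coeff_prod)
  show ?thesis
    unfolding min_poly_def
  proof (rule the_equality)
    fix p assume "lead_coeff p = 1 \<and> (\<forall>q. (\<forall>x\<in>carrier Q. poly_act Q f q x = \<zero>) = (p dvd q))"
    hence "p dvd (\<Prod>j\<in>J. [:- \<mu> j, 1:])" "(\<Prod>j\<in>J. [:- \<mu> j, 1:]) dvd p" "lead_coeff p = 1"
      unfolding annih by (metis dvd_refl)+
    thus "p = (\<Prod>j\<in>J. [:- \<mu> j, 1:])"
      using monic by (intro monic_dvd_antisym)
  qed (use monic annih in blast)
qed

lemma (in kernel_quot) abelian_monoid_quot: "abelian_monoid (quot E M)"
  by (rule abelian_monoidI)
    (auto elim!: quotE simp: zero_quot add_quot carrier_quot a_ac)

section \<open>The localisation\<close>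

context realized
begin

lemma loc_rel_iff: "((x, n), (y, m)) \<in> loc_rel E \<longleftrightarrow>
    x \<in> carrier E \<and> y \<in> carrier E \<and> (\<forall>i. fps_X ^ m * \<phi> x i = fps_X ^ n * \<phi> y i)"
proof (cases "x \<in> carrier E \<and> y \<in> carrier E")
  case True
  hence "(bop E ^^ m) x = (bop E ^^ n) y \<longleftrightarrow> \<phi> ((bop E ^^ m) x) = \<phi> ((bop E ^^ n) y)"
    by (intro iffI eqI) (auto simp: bop_pow_closed)
  thus ?thesis using True by (simp add: loc_rel_def coord_bop_pow fun_eq_iff)
qed (auto simp: loc_rel_def)

lemma equiv_loc_rel: "equiv (carrier E \<times> UNIV) (loc_rel E)"
proof (rule equivI)
  show "trans (loc_rel E)"
  proof (rule transI, clarify)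
    fix x n y m z k
    assume 1: "((x, n), (y, m)) \<in> loc_rel E" and 2: "((y, m), (z, k)) \<in> loc_rel E"
    have "fps_X ^ m * (fps_X ^ k * \<phi> x i) = fps_X ^ m * (fps_X ^ n * \<phi> z i)" for i
      using 1 2 unfolding loc_rel_iff by (metis mult.left_commute)
    thus "((x, n), (z, k)) \<in> loc_rel E" using 1 2 by (simp add: loc_rel_iff)
  qed
qed (auto simp: refl_on_def sym_def loc_rel_iff)

lemma loc_frac_eq_iff:
  assumes "x \<in> carrier E" "y \<in> carrier E"
  shows "loc_frac E x n = loc_frac E y m \<longleftrightarrow> (\<forall>i. fps_X ^ m * \<phi> x i = fps_X ^ n * \<phi> y i)"
  unfolding loc_frac_def
  using eq_equiv_class_iff[OF equiv_loc_rel, of "(x, n)" "(y, m)"] assms by (simp add: loc_rel_iff)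

lemma loc_carrier: "carrier (loc E) = {loc_frac E x n | x n. x \<in> carrier E}"
  by (auto simp: loc_def loc_frac_def quotient_def)

text \<open>The operations on fractions are unions over all representatives. Such a union collapses
  when the value is independent of the representative, since a class is not empty.\<close>

lemma UN_loc_frac:
  assumes "x \<in> carrier E" "\<And>y m. y \<in> carrier E \<Longrightarrow> \<forall>i. fps_X ^ m * \<phi> x i = fps_X ^ n * \<phi> y i \<Longrightarrow> f y m = f x n"
  shows "(\<Union>(y, m)\<in>loc_frac E x n. f y m) = f x n"
proof -
  have "f y m = f x n" if "(y, m) \<in> loc_frac E x n" for y m
    using that by (intro assms(2)) (auto simp: loc_frac_def loc_rel_iff)
  moreover have "(x, n) \<in> loc_frac E x n" using assms(1) by (simp add: loc_frac_def loc_rel_iff)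
  moreover have "(\<Union>(y, m)\<in>loc_frac E x n. f y m) = (\<Union>p\<in>loc_frac E x n. f x n)"
    by (rule SUP_cong) (use calculation(1) in auto)
  ultimately show ?thesis by (metis UN_constant empty_iff)
qed

lemma loc_smult:
  assumes "x \<in> carrier E"
  shows "S \<odot>\<^bsub>loc E\<^esub> loc_frac E x n = loc_frac E (S \<odot> x) n"
  unfolding loc_def module.select_convs using assms
  by (intro UN_loc_frac) (auto simp: loc_frac_eq_iff smult_mem coord_smult mult.left_commute[of _ S])

lemma loc_add:
  assumes x: "x \<in> carrier E" and y: "y \<in> carrier E"
  shows "loc_frac E x n \<oplus>\<^bsub>loc E\<^esub> loc_frac E y m
    = loc_frac E ((bop E ^^ m) x \<oplus> (bop E ^^ n) y) (n + m)"
proof -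
  let ?f = "\<lambda>x n y m. loc_frac E ((bop E ^^ m) x \<oplus> (bop E ^^ n) y) (n + m)"
  have eq: "?f x' n' y' m' = ?f x n y m"
    if "x' \<in> carrier E" "y' \<in> carrier E" "\<forall>i. fps_X ^ n' * \<phi> x i = fps_X ^ n * \<phi> x' i"
      "\<forall>i. fps_X ^ m' * \<phi> y i = fps_X ^ m * \<phi> y' i" for x' n' y' m'
  proof -
    have "fps_X ^ (n + m) * (fps_X ^ m' * \<phi> x' i + fps_X ^ n' * \<phi> y' i)
      = fps_X ^ (n' + m') * (fps_X ^ m * \<phi> x i + fps_X ^ n * \<phi> y i)" for i
    proof -
      have "fps_X ^ (n + m) * (fps_X ^ m' * \<phi> x' i + fps_X ^ n' * \<phi> y' i)
        = fps_X ^ m * fps_X ^ m' * (fps_X ^ n * \<phi> x' i) + fps_X ^ n * fps_X ^ n' * (fps_X ^ m * \<phi> y' i)"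
        by (simp add: power_add algebra_simps)
      also have "\<dots> = fps_X ^ m * fps_X ^ m' * (fps_X ^ n' * \<phi> x i) + fps_X ^ n * fps_X ^ n' * (fps_X ^ m' * \<phi> y i)"
        by (simp only: that(3)[rule_format] that(4)[rule_format])
      finally show ?thesis by (simp add: power_add algebra_simps)
    qed
    thus ?thesis using that x y
      by (subst loc_frac_eq_iff) (auto simp: add_mem bop_pow_closed coord_add coord_bop_pow)
  qed
  have inner: "(\<Union>(y', m')\<in>loc_frac E y m. ?f x' n' y' m') = ?f x n y m"
    if x': "x' \<in> carrier E" "\<forall>i. fps_X ^ n' * \<phi> x i = fps_X ^ n * \<phi> x' i" for x' n'
  proof -
    have "(\<Union>(y', m')\<in>loc_frac E y m. ?f x' n' y' m') = ?f x' n' y m"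
    proof (rule UN_loc_frac[OF y])
      fix y' m' assume y': "y' \<in> carrier E" "\<forall>i. fps_X ^ m' * \<phi> y i = fps_X ^ m * \<phi> y' i"
      show "?f x' n' y' m' = ?f x' n' y m"
        using eq[OF x'(1) y'(1) x'(2) y'(2)] eq[OF x'(1) y x'(2)] by simp
    qed
    also have "\<dots> = ?f x n y m" by (rule eq[OF x'(1) y x'(2)]) simp
    finally show ?thesis .
  qed
  have "loc_frac E x n \<oplus>\<^bsub>loc E\<^esub> loc_frac E y m
      = (\<Union>(x', n')\<in>loc_frac E x n. \<Union>(y', m')\<in>loc_frac E y m. ?f x' n' y' m')"
    by (simp add: loc_def)
  also have "\<dots> = (\<Union>(y', m')\<in>loc_frac E y m. ?f x n y' m')"
  proof (rule UN_loc_frac[OF x])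
    fix x' n' assume x': "x' \<in> carrier E" "\<forall>i. fps_X ^ n' * \<phi> x i = fps_X ^ n * \<phi> x' i"
    show "(\<Union>(y', m')\<in>loc_frac E y m. ?f x' n' y' m') = (\<Union>(y', m')\<in>loc_frac E y m. ?f x n y' m')"
      unfolding inner[OF x'] using inner[OF x] by simp
  qed
  also have "\<dots> = ?f x n y m" using x by (rule inner) simp
  finally show ?thesis .
qed

lemma loc_zero: "\<zero>\<^bsub>loc E\<^esub> = loc_frac E \<zero> 0"
  by (simp add: loc_def)

lemma loc_frac_mem: "x \<in> carrier E \<Longrightarrow> loc_frac E x n \<in> carrier (loc E)"
  by (auto simp: loc_carrier)

lemma loc_abelian_group: "abelian_group (loc E)"
proof (rule abelian_groupI)
  fix C D K assume "C \<in> carrier (loc E)" "D \<in> carrier (loc E)" "K \<in> carrier (loc E)"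
  then obtain x n y m z k where xyz: "x \<in> carrier E" "y \<in> carrier E" "z \<in> carrier E"
    "C = loc_frac E x n" "D = loc_frac E y m" "K = loc_frac E z k" by (auto simp: loc_carrier)
  show "C \<oplus>\<^bsub>loc E\<^esub> D \<oplus>\<^bsub>loc E\<^esub> K = C \<oplus>\<^bsub>loc E\<^esub> (D \<oplus>\<^bsub>loc E\<^esub> K)"
    using xyz by (simp add: loc_add add_mem bop_pow_closed loc_frac_eq_iff coord_add coord_bop_pow
        power_add algebra_simps)
next
  fix C D assume "C \<in> carrier (loc E)" "D \<in> carrier (loc E)"
  then obtain x n y m where xy: "x \<in> carrier E" "y \<in> carrier E"
    "C = loc_frac E x n" "D = loc_frac E y m" by (auto simp: loc_carrier)
  show "C \<oplus>\<^bsub>loc E\<^esub> D \<in> carrier (loc E)"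
    using xy by (simp add: loc_add add_mem bop_pow_closed loc_frac_mem)
  show "C \<oplus>\<^bsub>loc E\<^esub> D = D \<oplus>\<^bsub>loc E\<^esub> C"
    using xy by (simp add: loc_add add_mem bop_pow_closed loc_frac_eq_iff coord_add coord_bop_pow
        power_add algebra_simps)
next
  fix C assume "C \<in> carrier (loc E)"
  then obtain x n where x: "x \<in> carrier E" "C = loc_frac E x n" by (auto simp: loc_carrier)
  show "\<zero>\<^bsub>loc E\<^esub> \<oplus>\<^bsub>loc E\<^esub> C = C"
    using x by (simp add: loc_zero loc_add add_mem zero_mem bop_pow_closed loc_frac_eq_iff coord_add
        coord_zero coord_bop_pow)
  show "\<exists>D\<in>carrier (loc E). D \<oplus>\<^bsub>loc E\<^esub> C = \<zero>\<^bsub>loc E\<^esub>"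
    using x by (intro bexI[of _ "loc_frac E (\<ominus> x) n"])
      (simp_all add: loc_zero loc_add add_mem zero_mem bop_pow_closed loc_frac_eq_iff coord_add
        coord_zero coord_bop_pow coord_uminus loc_frac_mem algebra_simps)
qed (simp add: loc_zero loc_frac_mem zero_mem)

lemma loc_aop:
  assumes x: "x \<in> carrier E"
  shows "aop (loc E) (loc_frac E x n) = loc_frac E (aop E x \<ominus> of_nat n \<odot> bop E x) n"
proof -
  have "aop (loc E) (loc_frac E x n)
      = (\<Union>(x, n)\<in>loc_frac E x n. loc_frac E (aop E x \<ominus> of_nat n \<odot> bop E x) n)"
    by (simp add: loc_def)
  also have "\<dots> = loc_frac E (aop E x \<ominus> of_nat n \<odot> bop E x) n"
  proof (rule UN_loc_frac[OF x])
    fix y m assume y: "y \<in> carrier E" and eq: "\<forall>i. fps_X ^ m * \<phi> x i = fps_X ^ n * \<phi> y i"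
    \<comment> \<open>Applying \<open>twist\<close> to the equality of the two fractions produces,
      by the Leibniz rule, the terms in m and n that the action of a on fractions carries.\<close>
    have "twist l t s (\<lambda>i. fps_X ^ m * \<phi> x i) = twist l t s (\<lambda>i. fps_X ^ n * \<phi> y i)"
      using eq by simp
    hence tw: "fps_X ^ m * (twist l t s (\<phi> x) i + of_nat m * \<phi> x i)
        = fps_X ^ n * (twist l t s (\<phi> y) i + of_nat n * \<phi> y i)" for i
      unfolding twist_X_power by (rule fun_cong)
    have "fps_X ^ n * (fps_X * twist l t s (\<phi> y) i - of_nat m * (fps_X * \<phi> y i))
        = fps_X ^ m * (fps_X * twist l t s (\<phi> x) i - of_nat n * (fps_X * \<phi> x i))" for i
    proof -
      have "fps_X ^ m * (fps_X * twist l t s (\<phi> x) i - of_nat n * (fps_X * \<phi> x i))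
        = fps_X * (fps_X ^ m * (twist l t s (\<phi> x) i + of_nat m * \<phi> x i))
          - (of_nat m + of_nat n) * fps_X * (fps_X ^ m * \<phi> x i)"
        by (simp add: algebra_simps)
      also have "\<dots> = fps_X * (fps_X ^ n * (twist l t s (\<phi> y) i + of_nat n * \<phi> y i))
          - (of_nat m + of_nat n) * fps_X * (fps_X ^ n * \<phi> y i)"
        by (simp only: tw eq[rule_format])
      finally show ?thesis by (simp add: algebra_simps)
    qed
    thus "loc_frac E (aop E y \<ominus> of_nat m \<odot> bop E y) m = loc_frac E (aop E x \<ominus> of_nat n \<odot> bop E x) n"
      using x y by (subst loc_frac_eq_iff)
        (auto simp: aop_mem smult_mem bop_closed coord_minus coord_aop coord_smult coord_bop)
  qed
  finally show ?thesis .
qed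

lemma loc_binv_a:
  assumes x: "x \<in> carrier E"
  shows "binv_a E (loc_frac E x n) = loc_frac E (aop E x \<ominus> of_nat n \<odot> bop E x) (Suc n)"
proof -
  define y where "y = aop E x \<ominus> of_nat n \<odot> bop E x"
  have y: "y \<in> carrier E" using x by (auto simp: y_def aop_mem smult_mem bop_closed)
  have "(\<Union>(z, k)\<in>loc_frac E y n. loc_frac E z (Suc k)) = loc_frac E y (Suc n)"
    by (rule UN_loc_frac[OF y]) (auto simp: loc_frac_eq_iff y)
  thus ?thesis by (simp add: binv_a_def loc_aop x y_def)
qed

text \<open>\<open>represents C z\<close>: the element \<open>C\<close> of \<open>E[b\<^sup>-\<^sup>1]\<close> has coordinates \<open>z\<close> without a denominator.\<close>

definition represents :: "('m \<times> nat) set \<Rightarrow> ('i \<Rightarrow> complex fps) \<Rightarrow> bool" where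
  "represents C z \<longleftrightarrow> (\<exists>x n. x \<in> carrier E \<and> C = loc_frac E x n \<and> \<phi> x = (\<lambda>i. fps_X ^ n * z i))"

lemma representsE:
  assumes "represents C z"
  obtains x n where "x \<in> carrier E" "C = loc_frac E x n" "\<phi> x = (\<lambda>i. fps_X ^ n * z i)"
  using assms by (auto simp: represents_def)

lemma represents_mem: "represents C z \<Longrightarrow> C \<in> carrier (loc E)"
  by (auto simp: represents_def loc_frac_mem)

lemma represents_unique:
  assumes "represents C z" "represents C z'" shows "z = z'"
proof -
  obtain x n where x: "x \<in> carrier E" "C = loc_frac E x n" "\<phi> x = (\<lambda>i. fps_X ^ n * z i)"
    using assms(1) by (rule representsE)
  obtain y m where y: "y \<in> carrier E" "C = loc_frac E y m" "\<phi> y = (\<lambda>i. fps_X ^ m * z' i)"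
    using assms(2) by (rule representsE)
  have "\<forall>i. fps_X ^ m * \<phi> x i = fps_X ^ n * \<phi> y i"
    using x y loc_frac_eq_iff by metis
  hence "fps_X ^ (m + n) * z i = fps_X ^ (m + n) * z' i" for i
    by (simp add: x(3) y(3) power_add mult_ac)
  thus ?thesis by (intro ext) (metis fps_X_neq_zero mult_cancel_left power_not_zero)
qed

lemma represents_inj:
  assumes "represents C z" "represents D z" shows "C = D"
proof -
  obtain x n where x: "x \<in> carrier E" "C = loc_frac E x n" "\<phi> x = (\<lambda>i. fps_X ^ n * z i)"
    using assms(1) by (rule representsE)
  obtain y m where y: "y \<in> carrier E" "D = loc_frac E y m" "\<phi> y = (\<lambda>i. fps_X ^ m * z i)"
    using assms(2) by (rule representsE)
  show ?thesis using x y by (simp add: loc_frac_eq_iff mult_ac)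
qed

lemma represents_frac: "x \<in> carrier E \<Longrightarrow> represents (loc_frac E x 0) (\<phi> x)"
  unfolding represents_def by (intro exI[of _ x] exI[of _ 0]) simp

lemma represents_zero: "represents \<zero>\<^bsub>loc E\<^esub> (\<lambda>_. 0)"
  unfolding loc_zero represents_def
  by (intro exI[of _ \<zero>] exI[of _ 0]) (simp add: zero_mem coord_zero zero_fun_def)

lemma represents_add:
  assumes "represents C z" "represents D w"
  shows "represents (C \<oplus>\<^bsub>loc E\<^esub> D) (\<lambda>i. z i + w i)"
proof -
  obtain x n where x: "x \<in> carrier E" "C = loc_frac E x n" "\<phi> x = (\<lambda>i. fps_X ^ n * z i)"
    using assms(1) by (rule representsE)
  obtain y m where y: "y \<in> carrier E" "D = loc_frac E y m" "\<phi> y = (\<lambda>i. fps_X ^ m * w i)"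
    using assms(2) by (rule representsE)
  show ?thesis
    unfolding represents_def
    by (intro exI[of _ "(bop E ^^ m) x \<oplus> (bop E ^^ n) y"] exI[of _ "n + m"] conjI)
      (simp_all add: x y loc_add add_mem bop_pow_closed coord_add coord_bop_pow fun_eq_iff
        power_add algebra_simps)
qed

lemma represents_smult:
  assumes "represents C z" shows "represents (S \<odot>\<^bsub>loc E\<^esub> C) (\<lambda>i. S * z i)"
proof -
  obtain x n where x: "x \<in> carrier E" "C = loc_frac E x n" "\<phi> x = (\<lambda>i. fps_X ^ n * z i)"
    using assms(1) by (rule representsE)
  show ?thesis
    unfolding represents_def
    by (intro exI[of _ "S \<odot> x"] exI[of _ n] conjI)
      (simp_all add: x loc_smult smult_mem coord_smult fun_eq_iff mult_ac)
qed

lemma represents_uminus: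
  assumes "represents C z" shows "represents (\<ominus>\<^bsub>loc E\<^esub> C) (\<lambda>i. - z i)"
proof -
  interpret L: abelian_group "loc E" by (rule loc_abelian_group)
  have m: "represents ((-1) \<odot>\<^bsub>loc E\<^esub> C) (\<lambda>i. - z i)"
    using represents_smult[OF assms, of "-1"] by simp
  have "(-1) \<odot>\<^bsub>loc E\<^esub> C \<oplus>\<^bsub>loc E\<^esub> C = \<zero>\<^bsub>loc E\<^esub>"
    using represents_add[OF m assms] represents_zero by (intro represents_inj) auto
  hence "\<ominus>\<^bsub>loc E\<^esub> C = (-1) \<odot>\<^bsub>loc E\<^esub> C"
    by (intro L.minus_equality represents_mem[OF m] represents_mem[OF assms])
  thus ?thesis using m by simp
qed

lemma represents_binv_a:
  assumes "represents C z" shows "represents (binv_a E C) (twist l t s z)"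
proof -
  obtain x n where x: "x \<in> carrier E" "C = loc_frac E x n" "\<phi> x = (\<lambda>i. fps_X ^ n * z i)"
    using assms(1) by (rule representsE)
  have "\<phi> (aop E x \<ominus> of_nat n \<odot> bop E x)
      = (\<lambda>i. fps_X * twist l t s (\<phi> x) i - of_nat n * (fps_X * \<phi> x i))"
    using x(1) by (auto simp: coord_minus aop_mem smult_mem bop_closed coord_aop coord_smult coord_bop)
  also have "\<dots> = (\<lambda>i. fps_X ^ Suc n * twist l t s z i)"
    unfolding x(3) twist_X_power by (simp add: fun_eq_iff algebra_simps)
  finally have "\<phi> (aop E x \<ominus> of_nat n \<odot> bop E x) = (\<lambda>i. fps_X ^ Suc n * twist l t s z i)" .
  thus ?thesis unfolding represents_def
    using x by (intro exI[of _ "aop E x \<ominus> of_nat n \<odot> bop E x"] exI[of _ "Suc n"] conjI)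
      (simp_all add: loc_binv_a aop_mem smult_mem bop_closed)
qed

lemma represents_binv_a_pow:
  "represents C z \<Longrightarrow> represents ((binv_a E ^^ j) C) ((twist l t s ^^ j) z)"
  by (induction j) (simp_all add: represents_binv_a)

lemma represents_finsum:
  assumes "\<And>j. represents (C j) (z j)"
  shows "represents (\<Oplus>\<^bsub>loc E\<^esub> j\<in>{..n}. C j) (\<lambda>i. \<Sum>j\<le>(n::nat). z j i)"
proof -
  interpret L: abelian_group "loc E" by (rule loc_abelian_group)
  have "C \<in> UNIV \<rightarrow> carrier (loc E)" using represents_mem[OF assms] by auto
  thus ?thesis
  proof (induction n)
    case 0
    thus ?case using assms[of 0] by (simp add: L.finsum_0 Pi_def)
  next
    case (Suc n)
    thus ?case using represents_add[OF assms[of "Suc n"] Suc.IH[OF Suc.prems]]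
      by (simp add: L.finsum_Suc Pi_def add.commute)
  qed
qed

end

section \<open>Bernstein polynomials in coordinates\<close>

text \<open>Here \<open>g\<close> is a generator whose coordinates have pairwise distinct orders \<open>m j\<close>. The operator
  \<open>b\<^sup>-\<^sup>1 a\<close> separates the leading terms of \<open>g\<close>, hence \<open>E\<^sup>\<sharp>\<close> is the whole of \<open>lattice\<close>.\<close>

locale distinct_orders = realized E \<phi> J "\<lambda>_. c" "\<lambda>_. 0" s
  for E :: "'m abm" (structure) and \<phi> :: "'m \<Rightarrow> 'i \<Rightarrow> complex fps" and J and c s +
  fixes m :: "'i \<Rightarrow> nat" and g :: 'm
  assumes order_ge: "x \<in> carrier E \<Longrightarrow> j \<in> J \<Longrightarrow> n < m j \<Longrightarrow> fps_nth (\<phi> x j) n = 0"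
    and g_mem: "g \<in> carrier E"
    and g_lead: "j \<in> J \<Longrightarrow> fps_nth (\<phi> g j) (m j) \<noteq> 0"
    and m_inj: "inj_on m J"
begin

section \<open>The saturation under \<open>b^-1 a\<close> and the lattice of lower bounds on
  orders\<close>

abbreviation \<theta> :: "('i \<Rightarrow> complex fps) \<Rightarrow> 'i \<Rightarrow> complex fps" where
  "\<theta> \<equiv> twist (\<lambda>_. c) (\<lambda>_. 0) s"

abbreviation \<theta>_prod :: "complex list \<Rightarrow> ('i \<Rightarrow> complex fps) \<Rightarrow> 'i \<Rightarrow> complex fps" where
  "\<theta>_prod \<equiv> twist_prod (\<lambda>_. c) (\<lambda>_. 0) s"

lemma \<theta>_nth: "fps_nth (\<theta> z i) n = (c + of_nat n) * fps_nth (z i) n"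
  by (simp add: twist_nth)

definition lattice :: "('i \<Rightarrow> complex fps) set" where
  "lattice = {z. (\<forall>i. i \<notin> J \<longrightarrow> z i = 0) \<and> (\<forall>j\<in>J. \<forall>n<m j. fps_nth (z j) n = 0)}"

lemma lattice_coord: "x \<in> carrier E \<Longrightarrow> \<phi> x \<in> lattice"
  by (simp add: lattice_def supp order_ge)

lemma lattice_add: "z \<in> lattice \<Longrightarrow> w \<in> lattice \<Longrightarrow> (\<lambda>i. z i + w i) \<in> lattice"
  by (simp add: lattice_def)

lemma lattice_smult: "z \<in> lattice \<Longrightarrow> (\<lambda>i. S * z i) \<in> lattice"
  by (auto simp: lattice_def fps_mult_nth intro!: sum.neutral)

lemma lattice_\<theta>: "z \<in> lattice \<Longrightarrow> \<theta> z \<in> lattice"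
  by (auto simp: lattice_def \<theta>_nth fps_eq_iff)

lemma lattice_\<theta>_pow: "z \<in> lattice \<Longrightarrow> (\<theta> ^^ j) z \<in> lattice"
  by (induction j) (simp_all add: lattice_\<theta>)

lemma lattice_sum: "(\<And>j. z j \<in> lattice) \<Longrightarrow> (\<lambda>i. \<Sum>j\<le>(n::nat). z j i) \<in> lattice"
  by (induction n) (simp_all add: lattice_add)

text \<open>The sum of the images of E under the powers of \<theta> up to n, in Horner form, which
  suits induction; \<open>saturation_sum\<close> returns to the form used in
  \<open>sharp\<close>.\<close>

primrec saturation :: "nat \<Rightarrow> ('i \<Rightarrow> complex fps) set" where
  "saturation 0 = \<phi> ` carrier E"
| "saturation (Suc n) = {\<lambda>i. \<phi> x i + \<theta> w i | x w. x \<in> carrier E \<and> w \<in> saturation n}"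

lemma saturation_coord: "x \<in> carrier E \<Longrightarrow> \<phi> x \<in> saturation n"
proof (induction n arbitrary: x)
  case (Suc n)
  have "\<phi> \<zero> \<in> saturation n" by (rule Suc.IH[OF zero_mem])
  moreover have "\<phi> x = (\<lambda>i. \<phi> x i + \<theta> (\<phi> \<zero>) i)" by (simp add: coord_zero twist_zero)
  ultimately show ?case using Suc.prems by auto
qed simp

lemma saturation_add:
  "z \<in> saturation n \<Longrightarrow> w \<in> saturation n \<Longrightarrow> (\<lambda>i. z i + w i) \<in> saturation n"
proof (induction n arbitrary: z w)
  case 0
  then obtain x y where xy: "x \<in> carrier E" "y \<in> carrier E" "z = \<phi> x" "w = \<phi> y" by auto
  hence "(\<lambda>i. z i + w i) = \<phi> (x \<oplus> y)" by (simp add: coord_add plus_fun_def)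
  thus ?case using xy add_mem by simp
next
  case (Suc n)
  then obtain x z' y w' where h: "x \<in> carrier E" "z' \<in> saturation n" "z = (\<lambda>i. \<phi> x i + \<theta> z' i)"
    "y \<in> carrier E" "w' \<in> saturation n" "w = (\<lambda>i. \<phi> y i + \<theta> w' i)" by auto
  have "(\<lambda>i. z i + w i) = (\<lambda>i. \<phi> (x \<oplus> y) i + \<theta> (\<lambda>i. z' i + w' i) i)"
    using h twist_add[of "\<lambda>_. c" "\<lambda>_. 0" s z' w'] by (simp add: coord_add plus_fun_def algebra_simps)
  thus ?case using h Suc.IH[OF h(2,5)] add_mem by auto
qed

lemma saturation_mono: "z \<in> saturation n \<Longrightarrow> z \<in> saturation (Suc n)"
proof (induction n arbitrary: z)
  case 0
  thus ?case using saturation_coord[of _ "Suc 0"] by auto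
next
  case (Suc n)
  then obtain x w where "x \<in> carrier E" "w \<in> saturation n" "z = (\<lambda>i. \<phi> x i + \<theta> w i)" by auto
  thus ?case using Suc.IH[of w] by (subst saturation.simps(2)) blast
qed

lemma saturation_mono': "z \<in> saturation n \<Longrightarrow> n \<le> k \<Longrightarrow> z \<in> saturation k"
  by (induction k) (auto simp del: saturation.simps simp: le_Suc_eq intro: saturation_mono)

text \<open>By Leibniz, \<open>S \<theta> w = \<theta> (S w) - X S' w\<close>. The correction
  already lies in the preceding stage.\<close>

lemma saturation_smult: "z \<in> saturation n \<Longrightarrow> (\<lambda>i. S * z i) \<in> saturation n"
proof (induction n arbitrary: z S)
  case 0
  then obtain x where x: "x \<in> carrier E" "z = \<phi> x" by auto
  hence "(\<lambda>i. S * z i) = \<phi> (S \<odot> x)" by (simp add: coord_smult)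
  thus ?case using x smult_mem by simp
next
  case (Suc n)
  then obtain x w where h: "x \<in> carrier E" "w \<in> saturation n" "z = (\<lambda>i. \<phi> x i + \<theta> w i)" by auto
  define w' where "w' = (\<lambda>i. (- (fps_X * fps_deriv S)) * w i)"
  have "(\<lambda>i. \<phi> (S \<odot> x) i + \<theta> (\<lambda>i. S * w i) i) \<in> saturation (Suc n)"
    using h Suc.IH[OF h(2), of S] smult_mem by auto
  moreover have "w' \<in> saturation (Suc n)"
    unfolding w'_def by (rule saturation_mono[OF Suc.IH[OF h(2)]])
  ultimately have "(\<lambda>i. (\<phi> (S \<odot> x) i + \<theta> (\<lambda>i. S * w i) i) + w' i) \<in> saturation (Suc n)"
    by (rule saturation_add)
  also have "(\<lambda>i. (\<phi> (S \<odot> x) i + \<theta> (\<lambda>i. S * w i) i) + w' i) = (\<lambda>i. S * z i)"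
    by (simp add: h twist_smult coord_smult w'_def algebra_simps)
  finally show ?case .
qed

lemma saturation_\<theta>: "z \<in> saturation n \<Longrightarrow> \<theta> z \<in> saturation (Suc n)"
  using zero_mem coord_zero by (force simp: intro!: exI[of _ \<zero>])

lemma saturation_lattice: "z \<in> saturation n \<Longrightarrow> z \<in> lattice"
  by (induction n arbitrary: z) (auto intro: lattice_coord lattice_add lattice_\<theta>)

lemma saturation_sum:
  "z \<in> saturation n \<Longrightarrow> \<exists>x. (\<forall>j. x j \<in> carrier E) \<and> z = (\<lambda>i. \<Sum>j\<le>n. (\<theta> ^^ j) (\<phi> (x j)) i)"
proof (induction n arbitrary: z)
  case 0
  then obtain x where "x \<in> carrier E" "z = \<phi> x" by auto
  thus ?case by (intro exI[of _ "\<lambda>_. x"]) simp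
next
  case (Suc n)
  then obtain y w where h: "y \<in> carrier E" "w \<in> saturation n" "z = (\<lambda>i. \<phi> y i + \<theta> w i)" by auto
  obtain x where x: "\<And>j. x j \<in> carrier E" "w = (\<lambda>i. \<Sum>j\<le>n. (\<theta> ^^ j) (\<phi> (x j)) i)"
    using Suc.IH[OF h(2)] by auto
  have "\<theta> (\<lambda>i. \<Sum>j\<le>n. u j i) = (\<lambda>i. \<Sum>j\<le>n. \<theta> (u j) i)" for u and n :: nat
    by (auto simp: fps_eq_iff \<theta>_nth fps_sum_nth sum_distrib_left)
  hence "\<theta> w = (\<lambda>i. \<Sum>j\<le>n. (\<theta> ^^ Suc j) (\<phi> (x j)) i)"
    by (simp add: x(2))
  hence "z = (\<lambda>i. \<Sum>j\<le>Suc n. (\<theta> ^^ j) (\<phi> (case_nat y x j)) i)"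
    by (simp add: h(3) sum.atMost_Suc_shift del: sum.atMost_Suc)
  thus ?case using h(1) x(1) by (intro exI[of _ "case_nat y x"]) (auto split: nat.split)
qed

definition full_saturation :: "('i \<Rightarrow> complex fps) set" where
  "full_saturation = (\<Union>n. saturation n)"

lemma full_saturation_coord: "x \<in> carrier E \<Longrightarrow> \<phi> x \<in> full_saturation"
  unfolding full_saturation_def using saturation_coord by blast

lemma full_saturation_submodule: "fps_submodule full_saturation"
  unfolding fps_submodule_def
proof (intro conjI ballI allI)
  show "0 \<in> full_saturation"
    using full_saturation_coord[OF zero_mem] by (simp add: coord_zero)
next
  fix x y assume "x \<in> full_saturation" "y \<in> full_saturation"
  then obtain n k where "x \<in> saturation n" "y \<in> saturation k" by (auto simp: full_saturation_def)
  hence "x \<in> saturation (max n k)" "y \<in> saturation (max n k)" by (auto intro: saturation_mono')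
  thus "x + y \<in> full_saturation"
    using saturation_add[of x "max n k" y] by (auto simp: full_saturation_def plus_fun_def)
qed (auto simp: full_saturation_def intro: saturation_smult)

lemma twist_prod_full_saturation:
  "z \<in> full_saturation \<Longrightarrow> \<theta>_prod \<mu>s z \<in> full_saturation"
proof (induction \<mu>s)
  case (Cons \<mu> \<mu>s)
  define w where "w = \<theta>_prod \<mu>s z"
  have "w \<in> full_saturation" using Cons by (simp add: w_def)
  hence "\<theta> w \<in> full_saturation" unfolding full_saturation_def using saturation_\<theta> by blast
  hence "(\<lambda>i. \<theta> w i - fps_const \<mu> * w i) \<in> full_saturation"
    using fps_submodule_sub_smult[OF full_saturation_submodule] \<open>w \<in> full_saturation\<close> by blast
  thus ?case by (simp add: twist_prod_def w_def)
qed (simp add: twist_prod_def)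

text \<open>The eigenvalues of the other leading terms. The length is fixed along with the set, so
  that the products for all \<open>i\<close> in \<open>J\<close> carry the same power of X when they
  are realized by \<open>a_prod\<close>.\<close>

definition others :: "'i \<Rightarrow> complex list" where
  "others i = (SOME \<mu>s. set \<mu>s = (\<lambda>j. c + of_nat (m j)) ` (J - {i}) \<and> length \<mu>s = card (J - {i}))"

lemma others: "set (others i) = (\<lambda>j. c + of_nat (m j)) ` (J - {i})"
  "length (others i) = card (J - {i})"
proof -
  have "inj_on (\<lambda>j. c + of_nat (m j)) (J - {i})"
    using m_inj by (auto simp: inj_on_def)
  hence "\<exists>\<mu>s. set \<mu>s = (\<lambda>j. c + of_nat (m j)) ` (J - {i}) \<and> length \<mu>s = card (J - {i})"
    using finite_distinct_list[of "(\<lambda>j. c + of_nat (m j)) ` (J - {i})"] finite_I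
    by (metis card_image distinct_card finite_Diff finite_imageI)
  thus "set (others i) = (\<lambda>j. c + of_nat (m j)) ` (J - {i})" "length (others i) = card (J - {i})"
    unfolding others_def by (rule someI2_ex, simp)+
qed

definition isolated :: "'i \<Rightarrow> 'i \<Rightarrow> complex fps" where
  "isolated i = \<theta>_prod (others i) (\<phi> g)"

lemma isolated_full_saturation: "isolated i \<in> full_saturation"
  unfolding isolated_def by (intro twist_prod_full_saturation full_saturation_coord g_mem)

text \<open>As in Lagrange interpolation: the leading coefficient in coordinate j is multiplied by
  the product of the \<open>m j - m k\<close> over k \<noteq> i, which is nonzero only for j =
  i.\<close>

lemma isolated_lead:
  assumes "i \<in> J" "j \<in> J"
  shows "fps_nth (isolated i j) (m j) = 0 \<longleftrightarrow> j \<noteq> i"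
proof -
  have "c + of_nat (m j) \<in> set (others i) \<longleftrightarrow> j \<noteq> i"
    unfolding others using assms m_inj by (auto simp: inj_on_def)
  moreover have "(\<Prod>\<mu>\<leftarrow>others i. c + of_nat (m j) - \<mu>) = 0 \<longleftrightarrow> c + of_nat (m j) \<in> set (others i)"
    by (auto simp: prod_list_zero_iff)
  ultimately show ?thesis
    using g_lead[OF assms(2)] by (simp add: isolated_def twist_prod_diag_nth)
qed

lemma isolated_order:
  assumes "j \<in> J" "n < m j" shows "fps_nth (isolated i j) n = 0"
  using order_ge[OF g_mem assms] by (simp add: isolated_def twist_prod_diag_nth)

text \<open>Modulo \<open>X lattice\<close> only the leading coefficients count, and on the isolated
  vectors these form an invertible diagonal matrix. So the saturation fills the lattice modulo X,
  the input for Nakayama.\<close>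

lemma lattice_step:
  assumes z: "z \<in> lattice"
  shows "\<exists>y\<in>full_saturation. \<exists>w\<in>lattice. z = (\<lambda>k. y k + fps_X * w k)"
proof -
  define d where "d = (\<lambda>i. fps_const (fps_nth (z i) (m i) / fps_nth (isolated i i) (m i)))"
  define y where "y = (\<lambda>k. \<Sum>i\<in>J. d i * isolated i k)"
  have y_closed: "(\<lambda>k. \<Sum>i\<in>A. d i * isolated i k) \<in> full_saturation" if "finite A" for A
    using that
  proof (induction A rule: finite_induct)
    case empty
    thus ?case using fps_submodule_zero[OF full_saturation_submodule] by (simp add: zero_fun_def)
  next
    case (insert i A)
    have "(\<lambda>k. d i * isolated i k) + (\<lambda>k. \<Sum>i\<in>A. d i * isolated i k) \<in> full_saturation"
      by (intro fps_submodule_add fps_submodule_smult full_saturation_submodule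
          isolated_full_saturation insert)
    thus ?case using insert.hyps by (simp add: plus_fun_def)
  qed
  hence y: "y \<in> full_saturation" using finite_I by (simp add: y_def)
  hence yl: "y \<in> lattice" by (auto simp: full_saturation_def saturation_lattice)
  have lead: "fps_nth (y j) (m j) = fps_nth (z j) (m j)" if j: "j \<in> J" for j
  proof -
    have "fps_nth (y j) (m j) = (\<Sum>i\<in>J. if i = j then fps_nth (z j) (m j) else 0)"
      unfolding y_def fps_sum_nth d_def fps_mult_left_const_nth
      using isolated_lead j by (intro sum.cong) auto
    thus ?thesis using finite_I j by simp
  qed
  define w where "w = (\<lambda>k. fps_shift 1 (z k - y k))"
  have low: "fps_nth (z k - y k) n = 0" if "k \<in> J" "n \<le> m k" for k n
    using that z yl lead by (cases "n = m k") (auto simp: lattice_def)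
  have out: "z k - y k = 0" if "k \<notin> J" for k using that z yl by (simp add: lattice_def)
  have zero: "fps_nth (z k - y k) 0 = 0" for k using low[of k 0] out[of k] by (cases "k \<in> J") auto
  have "z k = y k + fps_X * w k" for k
  proof -
    have "fps_nth (z k - y k) n = fps_nth (fps_X * w k) n" for n
      using zero[of k] by (cases n) (auto simp: w_def)
    hence "z k - y k = fps_X * w k" by (rule fps_ext)
    thus ?thesis by (simp add: algebra_simps)
  qed
  moreover have "w \<in> lattice"
    using low out by (auto simp: lattice_def w_def)
  ultimately show ?thesis using y by blast
qed

text \<open>Nakayama's lemma, using that submodules are closed.\<close>

lemma lattice_eq: "full_saturation = lattice"
proof (intro equalityI subsetI)
  fix z assume z: "z \<in> lattice"
  have approx: "\<exists>y\<in>full_saturation. \<exists>w\<in>lattice. z = (\<lambda>k. y k + fps_X ^ L * w k)" for L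
  proof (induction L)
    case 0
    have "z = (\<lambda>k. 0 k + fps_X ^ 0 * z k)" by simp
    thus ?case using z fps_submodule_zero[OF full_saturation_submodule] by blast
  next
    case (Suc L)
    then obtain y w where yw: "y \<in> full_saturation" "w \<in> lattice" "z = (\<lambda>k. y k + fps_X ^ L * w k)"
      by blast
    obtain y' w' where yw': "y' \<in> full_saturation" "w' \<in> lattice" "w = (\<lambda>k. y' k + fps_X * w' k)"
      using lattice_step[OF yw(2)] by blast
    have "y + (\<lambda>k. fps_X ^ L * y' k) \<in> full_saturation"
      by (intro fps_submodule_add fps_submodule_smult full_saturation_submodule yw(1) yw'(1))
    moreover have "z = (\<lambda>k. (y + (\<lambda>k. fps_X ^ L * y' k)) k + fps_X ^ Suc L * w' k)"
      unfolding yw(3) yw'(3) by (simp add: fun_eq_iff algebra_simps)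
    ultimately show ?case using yw'(2) by blast
  qed
  show "z \<in> full_saturation"
  proof (rule fps_submodule_closed[OF finite_I full_saturation_submodule])
    show "\<forall>x\<in>full_saturation. \<forall>i. i \<notin> J \<longrightarrow> x i = 0"
      using saturation_lattice by (auto simp: full_saturation_def lattice_def)
    fix L
    obtain y w where yw: "y \<in> full_saturation" "z = (\<lambda>k. y k + fps_X ^ L * w k)"
      using approx[of L] by blast
    have "\<forall>i. fps_X ^ L dvd z i - y i" by (simp add: yw(2))
    thus "\<exists>y\<in>full_saturation. \<forall>i. fps_X ^ L dvd z i - y i" using yw(1) by blast
  qed
qed (auto simp: full_saturation_def saturation_lattice)

text \<open>The leading coefficients form a diagonal matrix. By induction on n, the coefficient of
  order \<open>n + m (h i)\<close> in coordinate \<open>h i\<close> sees only the n-th coefficient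
  of \<open>d i\<close>.\<close>

lemma isolated_independent:
  assumes h: "inj_on h {..<p}" "h ` {..<p} \<subseteq> J"
    and zero: "\<And>k. (\<Sum>i<(p::nat). d i * isolated (h i) k) = 0"
  shows "\<forall>i<p. d i = 0"
proof -
  have "\<forall>i<p. fps_nth (d i) n = 0" for n
  proof (induction n rule: less_induct)
    case (less n)
    show ?case
    proof (intro allI impI)
      fix i assume i: "i < p"
      have hi: "h i \<in> J" using h(2) i by auto
      have product_nth: "fps_nth (d j * isolated (h j) (h i)) (n + m (h i))
          = fps_nth (d j) n * fps_nth (isolated (h j) (h i)) (m (h i))" if j: "j < p" for j
      proof -
        have "fps_nth (d j * isolated (h j) (h i)) (n + m (h i))
          = (\<Sum>l\<in>{0..n + m (h i)}. if l = n then fps_nth (d j) n * fps_nth (isolated (h j) (h i)) (m (h i)) else 0)"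
          unfolding fps_mult_nth
        proof (intro sum.cong refl)
          fix l assume l: "l \<in> {0..n + m (h i)}"
          consider "l < n" | "l = n" | "l > n" by linarith
          thus "fps_nth (d j) l * fps_nth (isolated (h j) (h i)) (n + m (h i) - l)
            = (if l = n then fps_nth (d j) n * fps_nth (isolated (h j) (h i)) (m (h i)) else 0)"
          proof cases
            case 1
            thus ?thesis using less j by simp
          next
            case 3
            hence "n + m (h i) - l < m (h i)" using l by auto
            thus ?thesis using 3 isolated_order[OF hi] by simp
          qed simp
        qed
        thus ?thesis by simp
      qed
      have "0 = (\<Sum>j<p. fps_nth (d j * isolated (h j) (h i)) (n + m (h i)))"
        using arg_cong[OF zero[of "h i"], of "\<lambda>f. fps_nth f (n + m (h i))"] by (simp add: fps_sum_nth)
      also have "\<dots> = (\<Sum>j<p. if j = i then fps_nth (d i) n * fps_nth (isolated (h i) (h i)) (m (h i)) else 0)"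
      proof (intro sum.cong refl)
        fix j assume "j \<in> {..<p}"
        hence j: "j < p" "h j \<in> J" using h(2) by auto
        show "fps_nth (d j * isolated (h j) (h i)) (n + m (h i))
          = (if j = i then fps_nth (d i) n * fps_nth (isolated (h i) (h i)) (m (h i)) else 0)"
          using product_nth[OF j(1)] isolated_lead[OF j(2) hi] h(1) i j(1) by (auto simp: inj_on_def)
      qed
      also have "\<dots> = fps_nth (d i) n * fps_nth (isolated (h i) (h i)) (m (h i))" using i by simp
      finally show "fps_nth (d i) n = 0" using isolated_lead[OF hi hi] by simp
    qed
  qed
  thus ?thesis by (simp add: fps_eq_iff)
qed

text \<open>The isolated vectors lie in the saturation, but their multiples by
  \<open>X^(card J - 1)\<close>, which are given by \<open>a_prod\<close>, come from E and remain
  independent. The number of coordinates bounds the rank from above.\<close>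

lemma has_rank_card: "has_rank E (card J)"
proof -
  obtain n where n: "has_rank E n" using ex_has_rank by blast
  obtain h where h: "bij_betw h {..<card J} J"
    using ex_bij_betw_nat_finite[OF finite_I] by (auto simp: atLeast0LessThan)
  have hJ: "h i \<in> J" if "i < card J" for i using h that by (auto simp: bij_betw_def)
  have "card J \<le> n"
  proof (rule rank_ge_independent[OF n])
    show "a_prod E (others (h i)) g \<in> carrier E" if "i < card J" for i by (rule a_prod_mem[OF g_mem])
    show "\<forall>d. (\<forall>k. (\<Sum>i<card J. d i * \<phi> (a_prod E (others (h i)) g) k) = 0) \<longrightarrow> (\<forall>i<card J. d i = 0)"
    proof (intro allI impI)
      fix d i assume zero: "\<forall>k. (\<Sum>i<card J. d i * \<phi> (a_prod E (others (h i)) g) k) = 0" and i: "i < card J"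
      have "(\<Sum>i<card J. d i * isolated (h i) k) = 0" for k
      proof -
        have "fps_X ^ (card J - 1) * (\<Sum>i<card J. d i * isolated (h i) k)
            = (\<Sum>i<card J. d i * \<phi> (a_prod E (others (h i)) g) k)"
          using hJ by (auto simp: sum_distrib_left coord_a_prod[OF g_mem] isolated_def others(2) mult_ac
              finite_I intro!: sum.cong)
        thus ?thesis using zero by (metis fps_X_neq_zero mult_eq_0_iff power_not_zero)
      qed
      thus "d i = 0"
        using isolated_independent[of h "card J" d] h i by (auto simp: bij_betw_def)
    qed
  qed
  moreover have "n \<le> card J" by (rule rank_le_card[OF n])
  ultimately show ?thesis using n by simp
qed

section \<open>The saturated module and its reduction modulo b\<close>

lemma sharp_eq: "sharp E = {C. \<exists>z\<in>lattice. represents C z}"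
proof (intro equalityI subsetI)
  fix C assume "C \<in> sharp E"
  then obtain n :: nat and x where x: "\<And>j. x j \<in> carrier E"
    "C = (\<Oplus>\<^bsub>loc E\<^esub> j\<in>{..n}. (binv_a E ^^ j) (loc_frac E (x j) 0))"
    by (auto simp: sharp_def)
  have "represents C (\<lambda>i. \<Sum>j\<le>n. (\<theta> ^^ j) (\<phi> (x j)) i)"
    unfolding x(2) by (intro represents_finsum represents_binv_a_pow represents_frac x(1))
  thus "C \<in> {C. \<exists>z\<in>lattice. represents C z}"
    using lattice_sum[of "\<lambda>j. (\<theta> ^^ j) (\<phi> (x j))" n] lattice_\<theta>_pow lattice_coord x(1) by auto
next
  fix C assume "C \<in> {C. \<exists>z\<in>lattice. represents C z}"
  then obtain z where z: "z \<in> lattice" "represents C z" by blast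
  then obtain n where "z \<in> saturation n" using lattice_eq by (auto simp: full_saturation_def)
  then obtain x where x: "\<And>j. x j \<in> carrier E" "z = (\<lambda>i. \<Sum>j\<le>n. (\<theta> ^^ j) (\<phi> (x j)) i)"
    using saturation_sum by blast
  have "represents (\<Oplus>\<^bsub>loc E\<^esub> j\<in>{..n}. (binv_a E ^^ j) (loc_frac E (x j) 0)) z"
    unfolding x(2) by (intro represents_finsum represents_binv_a_pow represents_frac x(1))
  hence "C = (\<Oplus>\<^bsub>loc E\<^esub> j\<in>{..n}. (binv_a E ^^ j) (loc_frac E (x j) 0))"
    using z(2) represents_inj by blast
  thus "C \<in> sharp E" using x(1) by (auto simp: sharp_def)
qed

definition sharp_coord :: "('m \<times> nat) set \<Rightarrow> 'i \<Rightarrow> complex fps" where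
  "sharp_coord C = (THE z. represents C z)"

lemma sharp_coord: "represents C z \<Longrightarrow> sharp_coord C = z"
  unfolding sharp_coord_def using represents_unique by blast

lemma sharp_lattice: "C \<in> sharp E \<Longrightarrow> sharp_coord C \<in> lattice"
  and represents_sharp: "C \<in> sharp E \<Longrightarrow> represents C (sharp_coord C)"
  using sharp_coord by (auto simp: sharp_eq)

lemma sharpI: "represents C z \<Longrightarrow> z \<in> lattice \<Longrightarrow> C \<in> sharp E"
  by (auto simp: sharp_eq)

lemma lattice_zero: "(\<lambda>_. 0) \<in> lattice"
  by (simp add: lattice_def)

abbreviation sharp_module :: "('m \<times> nat) set abm" where
  "sharp_module \<equiv> sub (loc E) (sharp E)"

abbreviation b_sharp :: "('m \<times> nat) set set" where
  "b_sharp \<equiv> bop (loc E) ` sharp E"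

lemma sharp_module_simps:
  "carrier sharp_module = sharp E" "zero sharp_module = zero (loc E)" "add sharp_module = add (loc E)"
  "smult sharp_module = smult (loc E)"
  by (simp_all add: sub_def)

lemma sharp_coords: "coords sharp_module sharp_coord"
proof
  show "inj_on sharp_coord (carrier sharp_module)"
    by (rule inj_onI) (metis represents_sharp sharp_module_simps(1) represents_inj)
  show "\<zero>\<^bsub>sharp_module\<^esub> \<in> carrier sharp_module"
    unfolding sharp_module_simps by (rule sharpI[OF represents_zero lattice_zero])
  show "sharp_coord \<zero>\<^bsub>sharp_module\<^esub> = 0"
    unfolding sharp_module_simps sharp_coord[OF represents_zero] by (simp add: zero_fun_def)
next
  fix C D assume "C \<in> carrier sharp_module" "D \<in> carrier sharp_module"
  hence CD: "sharp_coord C \<in> lattice" "represents C (sharp_coord C)"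
    "sharp_coord D \<in> lattice" "represents D (sharp_coord D)"
    by (auto simp: sharp_module_simps sharp_lattice represents_sharp)
  note r = represents_add[OF CD(2,4)]
  show "C \<oplus>\<^bsub>sharp_module\<^esub> D \<in> carrier sharp_module"
    unfolding sharp_module_simps by (rule sharpI[OF r lattice_add[OF CD(1,3)]])
  show "sharp_coord (C \<oplus>\<^bsub>sharp_module\<^esub> D) = sharp_coord C + sharp_coord D"
    unfolding sharp_module_simps sharp_coord[OF r] by (simp add: plus_fun_def)
next
  fix C S assume "C \<in> carrier sharp_module"
  hence C: "sharp_coord C \<in> lattice" "represents C (sharp_coord C)"
    by (auto simp: sharp_module_simps sharp_lattice represents_sharp)
  note r = represents_smult[OF C(2), of S]
  show "S \<odot>\<^bsub>sharp_module\<^esub> C \<in> carrier sharp_module"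
    unfolding sharp_module_simps by (rule sharpI[OF r lattice_smult[OF C(1)]])
  show "sharp_coord (S \<odot>\<^bsub>sharp_module\<^esub> C) = (\<lambda>i. S * sharp_coord C i)"
    unfolding sharp_module_simps by (rule sharp_coord[OF r])
qed

definition leading :: "('m \<times> nat) set \<Rightarrow> 'i \<Rightarrow> complex" where
  "leading C = (\<lambda>j. if j \<in> J then fps_nth (sharp_coord C j) (m j) else 0)"

text \<open>If the leading coefficients vanish, division by X stays within \<open>lattice\<close>.
  As the saturation is the whole lattice, the quotient is again represented in
  \<open>sharp E\<close>.\<close>

lemma leading_kernel: "b_sharp = {C \<in> carrier sharp_module. leading C = 0}"
proof (intro equalityI subsetI)
  fix D assume "D \<in> b_sharp"
  then obtain C where C: "C \<in> sharp E" "D = fps_X \<odot>\<^bsub>loc E\<^esub> C" unfolding bop_def by blast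
  have D: "represents D (\<lambda>i. fps_X * sharp_coord C i)" "sharp_coord C \<in> lattice"
    unfolding C(2) by (rule represents_smult[OF represents_sharp[OF C(1)]], rule sharp_lattice[OF C(1)])
  have "fps_nth (fps_X * sharp_coord C j) (m j) = 0" if "j \<in> J" for j
    using D(2) that by (cases "m j") (auto simp: lattice_def)
  hence "leading D = 0" by (auto simp: leading_def sharp_coord[OF D(1)])
  thus "D \<in> {C \<in> carrier sharp_module. leading C = 0}"
    using sharpI[OF D(1) lattice_smult[OF D(2)]] by (simp add: sharp_module_simps)
next
  fix D assume "D \<in> {C \<in> carrier sharp_module. leading C = 0}"
  hence "D \<in> sharp E" "leading D = 0" by (simp_all add: sharp_module_simps)
  note z = sharp_lattice[OF \<open>D \<in> sharp E\<close>] represents_sharp[OF \<open>D \<in> sharp E\<close>]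
  define z where "z = sharp_coord D"
  define w where "w = (\<lambda>k. fps_shift 1 (z k))"
  have low: "fps_nth (z k) n = 0" if "k \<in> J" "n \<le> m k" for k n
    using that z fun_cong[OF \<open>leading D = 0\<close>, of k]
    by (cases "n = m k") (auto simp: lattice_def leading_def z_def)
  have out: "z k = 0" if "k \<notin> J" for k using that z by (simp add: lattice_def z_def)
  have "fps_nth (z k) n = fps_nth (fps_X * w k) n" for k n
    using low[of k 0] out[of k] by (cases n; cases "k \<in> J") (auto simp: w_def)
  hence zw: "z = (\<lambda>i. fps_X * w i)" by (intro ext fps_ext)
  have w: "w \<in> lattice" using low out by (auto simp: lattice_def w_def)
  then obtain n where "w \<in> saturation n" using lattice_eq by (auto simp: full_saturation_def)
  then obtain x where x: "\<And>j. x j \<in> carrier E" "w = (\<lambda>i. \<Sum>j\<le>n. (\<theta> ^^ j) (\<phi> (x j)) i)"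
    using saturation_sum by blast
  define C where "C = (\<Oplus>\<^bsub>loc E\<^esub> j\<in>{..n}. (binv_a E ^^ j) (loc_frac E (x j) 0))"
  have C: "represents C w"
    unfolding x(2) C_def by (intro represents_finsum represents_binv_a_pow represents_frac x(1))
  have "represents (bop (loc E) C) z"
    unfolding zw bop_def by (rule represents_smult[OF C])
  hence "D = bop (loc E) C" using z(2) represents_inj unfolding z_def by blast
  thus "D \<in> b_sharp" using sharpI[OF C w] by blast
qed

lemma bernstein_eq: "bernstein E = (\<Prod>j\<in>J. [:c + of_nat (m j), 1:])"
proof -
  interpret S: coords sharp_module sharp_coord by (rule sharp_coords)
  interpret K: kernel_quot sharp_module leading b_sharp
  proof
    fix C D assume "C \<in> carrier sharp_module" "D \<in> carrier sharp_module"
    thus "leading (C \<oplus>\<^bsub>sharp_module\<^esub> D) = leading C + leading D"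
      by (auto simp: leading_def S.coord_add)
  qed (rule leading_kernel)
  define Q where "Q = quot sharp_module b_sharp"
  define f where "f = (\<lambda>C. \<ominus>\<^bsub>loc E\<^esub> binv_a E C)"
  have f_mem: "f C \<in> carrier sharp_module" and f_lead: "leading (f C) = (\<lambda>j. - (c + of_nat (m j)) * leading C j)"
    if "C \<in> carrier sharp_module" for C
  proof -
    from that have z: "sharp_coord C \<in> lattice" "represents C (sharp_coord C)"
      by (auto simp: sharp_module_simps sharp_lattice represents_sharp)
    have r: "represents (f C) (\<lambda>i. (-1) * \<theta> (sharp_coord C) i)"
      unfolding f_def using represents_uminus[OF represents_binv_a[OF z(2)]] by simp
    show "f C \<in> carrier sharp_module"
      unfolding sharp_module_simps by (rule sharpI[OF r lattice_smult[OF lattice_\<theta>[OF z(1)]]])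
    show "leading (f C) = (\<lambda>j. - (c + of_nat (m j)) * leading C j)"
      unfolding leading_def sharp_coord[OF r] by (rule ext) (simp add: \<theta>_nth algebra_simps)
  qed
  let ?g = "coset_map sharp_module b_sharp f"
  let ?c = "\<lambda>C. b_sharp +>\<^bsub>sharp_module\<^esub> C"
  have g: "?g (?c C) = ?c (f C)" if "C \<in> carrier sharp_module" for C
    using that by (intro K.coset_map_eq) (auto simp: f_mem f_lead)
  have lead_smult: "leading (fps_const a \<odot>\<^bsub>sharp_module\<^esub> C) = (\<lambda>j. a * leading C j)"
    if "C \<in> carrier sharp_module" for a C
    using that by (auto simp: leading_def S.coord_smult)
  have smult: "fps_const a \<odot>\<^bsub>Q\<^esub> ?c C = ?c (fps_const a \<odot>\<^bsub>sharp_module\<^esub> C)"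
    if "C \<in> carrier sharp_module" for a C
  proof -
    have "fps_const a \<odot>\<^bsub>Q\<^esub> ?c C = coset_map sharp_module b_sharp
      (\<lambda>x. fps_const a \<odot>\<^bsub>sharp_module\<^esub> x) (?c C)" by (simp add: Q_def quot_def)
    also have "\<dots> = ?c (fps_const a \<odot>\<^bsub>sharp_module\<^esub> C)"
      using that by (intro K.coset_map_eq) (auto simp: S.smult_mem lead_smult)
    finally show ?thesis .
  qed
  have "min_poly Q ?g = (\<Prod>j\<in>J. [:- (- (c + of_nat (m j))), 1:])"
  proof (rule min_poly_diagonal[where \<eta> = "fibre_value leading"])
    show "abelian_monoid Q" unfolding Q_def by (rule K.abelian_monoid_quot)
    show "inj_on (fibre_value leading) (carrier Q)" unfolding Q_def by (rule K.fibre_value_inj)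
    have "leading \<zero>\<^bsub>sharp_module\<^esub> = (\<lambda>_. 0)" by (auto simp: leading_def S.coord_zero)
    thus "fibre_value leading \<zero>\<^bsub>Q\<^esub> = (\<lambda>_. 0)"
      unfolding Q_def K.zero_quot using S.zero_mem by (simp add: K.fibre_value_coset)
    show "finite J" by (rule finite_I)
    show "inj_on (\<lambda>j. - (c + of_nat (m j))) J" using m_inj by (auto simp: inj_on_def)
    show "\<exists>x\<in>carrier Q. fibre_value leading x j \<noteq> 0" if j: "j \<in> J" for j
    proof -
      \<comment> \<open>The single element g has all its leading coefficients nonzero, so it detects
        every eigenvalue.\<close>
      have r: "represents (loc_frac E g 0) (\<phi> g)" by (rule represents_frac[OF g_mem])
      have G: "loc_frac E g 0 \<in> carrier sharp_module"
        unfolding sharp_module_simps by (rule sharpI[OF r lattice_coord[OF g_mem]])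
      have "fibre_value leading (?c (loc_frac E g 0)) j \<noteq> 0"
        using j g_lead[OF j] by (simp add: K.fibre_value_coset[OF G] leading_def sharp_coord[OF r])
      thus ?thesis using G unfolding Q_def K.carrier_quot by blast
    qed
  next
    fix x assume "x \<in> carrier Q"
    then obtain C where C: "C \<in> carrier sharp_module" "x = ?c C"
      unfolding Q_def by (rule K.quotE)
    show "?g x \<in> carrier Q" "fibre_value leading (?g x) = (\<lambda>j. - (c + of_nat (m j)) * fibre_value leading x j)"
      unfolding C(2) g[OF C(1)] Q_def K.carrier_quot
      using f_mem[OF C(1)] C(1) by (auto simp: K.fibre_value_coset f_lead)
    show "fibre_value leading x j = 0" if "j \<notin> J" for j
      using that C by (simp add: K.fibre_value_coset leading_def)
    show "fps_const a \<odot>\<^bsub>Q\<^esub> x \<in> carrier Q" "fibre_value leading (fps_const a \<odot>\<^bsub>Q\<^esub> x) = (\<lambda>i. a * fibre_value leading x i)" for a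
      unfolding C(2) smult[OF C(1)] unfolding Q_def K.carrier_quot
      using S.smult_mem[OF C(1)] C(1) by (auto simp: K.fibre_value_coset lead_smult)
    fix y assume "y \<in> carrier Q"
    then obtain D where D: "D \<in> carrier sharp_module" "y = ?c D"
      unfolding Q_def by (rule K.quotE)
    show "fibre_value leading (x \<oplus>\<^bsub>Q\<^esub> y) = (\<lambda>i. fibre_value leading x i + fibre_value leading y i)"
      using C D S.add_mem[OF C(1) D(1)]
      by (simp add: Q_def K.add_quot K.fibre_value_coset K.f_add plus_fun_def)
  qed
  thus ?thesis by (simp only: bernstein_def Let_def Q_def f_def group_add_class.minus_minus)
qed

end

section \<open>The modules \<open>\<Xi>\<^sub>\<alpha>\<^bsup>(k-1)\<^esup> \<otimes> V\<close>\<close>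

lemma log_int_coeff_same: "\<gamma> \<noteq> 0 \<Longrightarrow> \<gamma> * log_int_coeff \<gamma> i i = (1 :: complex)"
  by (simp add: log_int_coeff_def)

text \<open>This is the coefficient of \<open>(Log s)^i\<close>, i < j, in the derivative of the
  primitive of \<open>s^(\<gamma>-1) (Log s)^j\<close>.\<close>

lemma log_int_coeff_step:
  assumes "\<gamma> \<noteq> 0" "i < j"
  shows "\<gamma> * log_int_coeff \<gamma> j i + of_nat (Suc i) * log_int_coeff \<gamma> j (Suc i) = (0 :: complex)"
proof -
  obtain d where d: "j = Suc (i + d)" using assms(2) less_imp_Suc_add by blast
  show ?thesis using assms(1)
    by (simp add: log_int_coeff_def d divide_simps del: of_nat_Suc)
qed

locale xi_space = finite_dimensional_vector_space scale Basis
  for scale :: "complex \<Rightarrow> 'v::ab_group_add \<Rightarrow> 'v" and Basis +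
  fixes \<alpha> :: rat and k :: nat
  assumes \<alpha>_pos: "0 < \<alpha>"
begin

abbreviation \<Xi> :: "(nat \<Rightarrow> nat \<Rightarrow> 'v) abm" where
  "\<Xi> \<equiv> Xi scale UNIV \<alpha> (int k - 1)"

abbreviation integ :: "(nat \<Rightarrow> nat \<Rightarrow> 'v) \<Rightarrow> nat \<Rightarrow> nat \<Rightarrow> 'v" where
  "integ \<equiv> Xi_b scale \<alpha> (int k - 1)"

definition expo :: "nat \<Rightarrow> complex" where
  "expo n = of_rat \<alpha> + of_nat n"

lemma expo_nonzero: "expo n \<noteq> 0"
proof -
  have "expo n = of_rat (\<alpha> + of_nat n)" by (simp add: expo_def of_rat_add)
  thus ?thesis using \<alpha>_pos by (simp add: add_pos_nonneg order_less_imp_not_eq2)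
qed

lemma carrier_\<Xi>: "f \<in> carrier \<Xi> \<longleftrightarrow> (\<forall>j\<ge>k. \<forall>n. f j n = 0)"
  by (auto simp: Xi_def)

lemma \<Xi>_simps: "zero \<Xi> = (\<lambda>j n. 0)" "add \<Xi> f g = (\<lambda>j n. f j n + g j n)"
  "smult \<Xi> S f = (\<lambda>j n. \<Sum>l\<le>n. scale (fps_nth S l) ((integ ^^ l) f j n))"
  "aop \<Xi> f = (\<lambda>j n. case n of 0 \<Rightarrow> 0 | Suc n' \<Rightarrow> f j n')"
  by (simp_all add: Xi_def)

lemma integ_0: "integ f i 0 = 0"
  by (simp add: Xi_b_def)

lemma integ_Suc: "integ f i (Suc n) = (\<Sum>j\<in>{i..<k}. scale (log_int_coeff (expo n) j i) (f j n))"
proof -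
  have "{j. i \<le> j \<and> int j \<le> int k - 1} = {i..<k}" by auto
  thus ?thesis by (simp add: Xi_b_def expo_def)
qed

lemma integ_mem: "integ f \<in> carrier \<Xi>"
  unfolding carrier_\<Xi>
proof (intro allI impI)
  fix j n assume "k \<le> j"
  thus "integ f j n = 0" by (cases n) (simp_all add: integ_0 integ_Suc)
qed

text \<open>For \<open>c = \<alpha> + n\<close>, this is \<open>b\<^sup>-\<^sup>1 a = s d/ds + 1\<close> on \<open>s\<^bsup>\<alpha>+n-1\<^esup> (Log s)\<^sup>j\<close>.\<close>

definition euler :: "complex \<Rightarrow> (nat \<Rightarrow> 'v) \<Rightarrow> nat \<Rightarrow> 'v" where
  "euler c u = (\<lambda>j. scale c (u j) + scale (of_nat (Suc j)) (u (Suc j)))"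

text \<open>Differentiation undoes b: on \<open>s^(\<alpha>+n) (Log s)^j\<close> the operator d/ds
  is given by the formula of \<open>euler (expo n)\<close>, the exponent of s dropping by
  one.\<close>

lemma euler_integ:
  assumes "f \<in> carrier \<Xi>"
  shows "euler (expo n) (\<lambda>j. integ f j (Suc n)) = (\<lambda>j. f j n)"
proof
  fix i
  show "euler (expo n) (\<lambda>j. integ f j (Suc n)) i = f i n"
  proof (cases "i < k")
    case False
    thus ?thesis using assms by (simp add: euler_def integ_Suc carrier_\<Xi>)
  next
    case True
    hence "{i..<k} = insert i {Suc i..<k}" by auto
    hence "euler (expo n) (\<lambda>j. integ f j (Suc n)) i
      = scale (expo n * log_int_coeff (expo n) i i) (f i n)
        + (\<Sum>j\<in>{Suc i..<k}. scale (expo n * log_int_coeff (expo n) j i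
            + of_nat (Suc i) * log_int_coeff (expo n) j (Suc i)) (f j n))"
      unfolding euler_def integ_Suc
      by (simp add: scale_right_distrib scale_sum_right scale_left_distrib sum.distrib del: of_nat_Suc)
    also have "(\<Sum>j\<in>{Suc i..<k}. scale (expo n * log_int_coeff (expo n) j i
            + of_nat (Suc i) * log_int_coeff (expo n) j (Suc i)) (f j n)) = 0"
      by (intro sum.neutral) (simp add: log_int_coeff_step expo_nonzero del: of_nat_Suc)
    finally show ?thesis by (simp add: log_int_coeff_same expo_nonzero)
  qed
qed

lemma euler_add: "euler c (\<lambda>j. u j + v j) = (\<lambda>j. euler c u j + euler c v j)"
  by (simp add: euler_def scale_right_distrib algebra_simps del: of_nat_Suc)

lemma euler_scale: "euler c (\<lambda>j. scale a (u j)) = (\<lambda>j. scale a (euler c u j))"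
  by (simp add: euler_def scale_right_distrib mult_ac del: of_nat_Suc)

lemma euler_commute: "euler c (euler d u) = euler d (euler c u)"
  by (simp add: euler_def scale_right_distrib add_ac mult_ac del: of_nat_Suc)

lemma euler_supp: "\<forall>j\<ge>i. u j = 0 \<Longrightarrow> \<forall>j\<ge>i. euler c u j = 0"
  by (simp add: euler_def)

text \<open>The topmost nonzero \<open>u j\<close> cannot be cancelled, because the second term of
  \<open>euler\<close> comes from a higher power of Log s.\<close>

lemma euler_zero_imp:
  assumes "c \<noteq> 0" "\<forall>j\<ge>k. u j = 0" "\<forall>j\<ge>i. euler c u j = 0"
  shows "\<forall>j\<ge>i. u j = 0"
proof (intro allI impI, rule ccontr)
  fix j assume ij: "i \<le> j" and nz: "u j \<noteq> 0"
  have "u (j + n) \<noteq> 0" for n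
  proof (induction n)
    case (Suc n)
    have "euler c u (j + n) = 0" using assms(3) ij by simp
    thus ?case using Suc assms(1) by (auto simp: euler_def)
  qed (simp add: nz)
  thus False using assms(2) by (metis le_add2)
qed

text \<open>This is \<open>b^-n\<close>, that is \<open>(d/ds)^n\<close>, from the terms in
  \<open>s^(\<alpha>+n-1)\<close> to those in \<open>s^(\<alpha>-1)\<close>; the exponents met on
  the way are \<open>expo (n-1)\<close>, ..., \<open>expo 0\<close>.\<close>

primrec eulers :: "nat \<Rightarrow> (nat \<Rightarrow> 'v) \<Rightarrow> nat \<Rightarrow> 'v" where
  "eulers 0 u = u"
| "eulers (Suc n) u = eulers n (euler (expo n) u)"

lemma eulers_add: "eulers n (\<lambda>j. u j + v j) = (\<lambda>j. eulers n u j + eulers n v j)"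
  by (induction n arbitrary: u v) (simp_all add: euler_add)

lemma eulers_scale: "eulers n (\<lambda>j. scale a (u j)) = (\<lambda>j. scale a (eulers n u j))"
  by (induction n arbitrary: u) (simp_all add: euler_scale)

lemma eulers_zero: "eulers n (\<lambda>j. 0) = (\<lambda>j. 0)"
  using eulers_scale[of n 0 "\<lambda>_. 0"] by simp

lemma eulers_euler: "eulers n (euler c u) = euler c (eulers n u)"
proof (induction n arbitrary: u)
  case (Suc n)
  thus ?case using euler_commute[of "expo n" c u] by simp
qed simp

lemma eulers_supp: "\<forall>j\<ge>i. u j = 0 \<Longrightarrow> \<forall>j\<ge>i. eulers n u j = 0"
proof (induction n arbitrary: u)
  case (Suc n)
  show ?case unfolding eulers.simps by (rule Suc.IH[OF euler_supp[OF Suc.prems]])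
qed simp

lemma eulers_zero_imp:
  assumes "\<forall>j\<ge>k. u j = 0" "\<forall>j\<ge>i. eulers n u j = 0"
  shows "\<forall>j\<ge>i. u j = 0"
  using assms
proof (induction n arbitrary: u)
  case (Suc n)
  have "\<forall>j\<ge>i. euler (expo n) u j = 0"
    by (rule Suc.IH[OF euler_supp[OF Suc.prems(1)]]) (use Suc.prems(2) in simp)
  thus ?case by (rule euler_zero_imp[OF expo_nonzero Suc.prems(1)])
qed simp

text \<open>Serves the coordinates on \<Xi> and those on its top power of Log s alike: forms
  \<open>h n\<close> on the coefficients of order n that absorb one b per order turn the sum in
  \<open>smult\<close> into a Cauchy product.\<close>

lemma coefficient_map_smult:
  assumes add: "\<And>n u v. h n (\<lambda>j. u j + v j) = h n u + h n v"
    and sc: "\<And>n a u. h n (\<lambda>j. scale a (u j)) = a * h n u"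
    and b: "\<And>n f. f \<in> carrier \<Xi> \<Longrightarrow> h (Suc n) (\<lambda>j. integ f j (Suc n)) = h n (\<lambda>j. f j n)"
    and f: "f \<in> carrier \<Xi>"
  shows "Abs_fps (\<lambda>n. h n (\<lambda>j. (S \<odot>\<^bsub>\<Xi>\<^esub> f) j n)) = S * Abs_fps (\<lambda>n. h n (\<lambda>j. f j n))"
proof (rule fps_ext)
  fix n
  have zero: "h n (\<lambda>j. 0) = 0" for n using sc[of n 0 "\<lambda>_. 0"] by simp
  have hsum: "h n (\<lambda>j. \<Sum>l\<le>p. u l j) = (\<Sum>l\<le>p. h n (u l))" for n p and u :: "nat \<Rightarrow> nat \<Rightarrow> 'v"
    by (induction p) (simp_all add: add)
  have pow: "(integ ^^ l) f \<in> carrier \<Xi>" for l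
    using f integ_mem by (cases l) simp_all
  have hpow: "h n (\<lambda>j. (integ ^^ l) f j n) = h (n - l) (\<lambda>j. f j (n - l))" if "l \<le> n" for l n
    using that
  proof (induction l arbitrary: n)
    case (Suc l)
    then obtain n' where n: "n = Suc n'" by (cases n) auto
    have "h n (\<lambda>j. (integ ^^ Suc l) f j n) = h n' (\<lambda>j. (integ ^^ l) f j n')"
      unfolding n using b[OF pow[of l], of n'] by simp
    thus ?case using Suc n by simp
  qed simp
  have "h n (\<lambda>j. (S \<odot>\<^bsub>\<Xi>\<^esub> f) j n) = (\<Sum>l\<le>n. fps_nth S l * h n (\<lambda>j. (integ ^^ l) f j n))"
    by (simp add: \<Xi>_simps hsum sc)
  also have "\<dots> = (\<Sum>l\<le>n. fps_nth S l * h (n - l) (\<lambda>j. f j (n - l)))"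
    by (intro sum.cong refl) (simp add: hpow)
  finally show "fps_nth (Abs_fps (\<lambda>n. h n (\<lambda>j. (S \<odot>\<^bsub>\<Xi>\<^esub> f) j n))) n
      = fps_nth (S * Abs_fps (\<lambda>n. h n (\<lambda>j. f j n))) n"
    by (simp add: fps_mult_nth atMost_atLeast0)
qed

text \<open>The coefficients \<open>u_n\<close> in f = sum of \<open>b^n u_n\<close>. With them b
  becomes multiplication by X, whereas in the coefficients of f itself integration mixes the powers
  of Log s.\<close>

definition xi_coord :: "(nat \<Rightarrow> nat \<Rightarrow> 'v) \<Rightarrow> nat \<times> 'v \<Rightarrow> complex fps" where
  "xi_coord f = (\<lambda>(j, w). Abs_fps (\<lambda>n. representation Basis (eulers n (\<lambda>j. f j n) j) w))"

definition xi_index :: "(nat \<times> 'v) set" where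
  "xi_index = {..<k} \<times> Basis"

abbreviation xi_t :: "nat \<times> 'v \<Rightarrow> complex" where
  "xi_t \<equiv> \<lambda>(j, w). of_nat (Suc j)"

abbreviation xi_s :: "nat \<times> 'v \<Rightarrow> nat \<times> 'v" where
  "xi_s \<equiv> \<lambda>(j, w). (Suc j, w)"

lemma in_span_Basis: "v \<in> span Basis"
  by (simp add: span_Basis)

lemma rep_add: "representation Basis (v + w) b = representation Basis v b + representation Basis w b"
  by (simp add: representation_add[OF independent_Basis in_span_Basis in_span_Basis])

lemma rep_scale: "representation Basis (scale c v) b = c * representation Basis v b"
  by (simp add: representation_scale[OF independent_Basis in_span_Basis])

lemma rep_zero: "representation Basis 0 b = 0"
  by (simp add: representation_zero)

lemma rep_eq_zero_iff: "(\<forall>b. representation Basis v b = 0) \<longleftrightarrow> v = 0"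
  using sum_representation_eq[OF independent_Basis in_span_Basis finite_Basis, of v]
  by (auto simp: rep_zero)

lemma xi_coord_smult:
  assumes "f \<in> carrier \<Xi>"
  shows "xi_coord (S \<odot>\<^bsub>\<Xi>\<^esub> f) = (\<lambda>i. S * xi_coord f i)"
proof
  fix i :: "nat \<times> 'v"
  obtain j w where i: "i = (j, w)" by (cases i)
  show "xi_coord (S \<odot>\<^bsub>\<Xi>\<^esub> f) i = S * xi_coord f i"
    unfolding xi_coord_def i prod.case
    by (rule coefficient_map_smult)
      (simp_all add: eulers_add eulers_scale rep_add rep_scale euler_integ assms)
qed

text \<open>The operators \<open>eulers n\<close> are triangular and invertible, so the expansion in
  b has the same degree in Log s as f. Hence kernels of powers of the nilpotent part are given by
  bounds on this degree.\<close>

lemma xi_coord_zero_iff: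
  assumes "f \<in> carrier \<Xi>"
  shows "(\<forall>j\<ge>i. \<forall>w. xi_coord f (j, w) = 0) \<longleftrightarrow> (\<forall>j\<ge>i. \<forall>n. f j n = 0)"
proof -
  have "(\<forall>w. xi_coord f (j, w) = 0) \<longleftrightarrow> (\<forall>n. eulers n (\<lambda>j. f j n) j = 0)" for j
    unfolding xi_coord_def fps_eq_iff by (auto simp: rep_eq_zero_iff[symmetric])
  hence "(\<forall>j\<ge>i. \<forall>w. xi_coord f (j, w) = 0) \<longleftrightarrow> (\<forall>n. \<forall>j\<ge>i. eulers n (\<lambda>j. f j n) j = 0)"
    by blast
  moreover have "(\<forall>j\<ge>i. eulers n (\<lambda>j. f j n) j = 0) \<longleftrightarrow> (\<forall>j\<ge>i. f j n = 0)" for n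
  proof
    assume "\<forall>j\<ge>i. eulers n (\<lambda>j. f j n) j = 0"
    thus "\<forall>j\<ge>i. f j n = 0"
      by (intro eulers_zero_imp[of "\<lambda>j. f j n" i n]) (use assms in \<open>simp add: carrier_\<Xi>\<close>)
  qed (rule eulers_supp)
  ultimately show ?thesis by simp blast
qed

lemma xi_diff_mem: "f \<in> carrier \<Xi> \<Longrightarrow> g \<in> carrier \<Xi> \<Longrightarrow> (\<lambda>j n. f j n - g j n) \<in> carrier \<Xi>"
  by (simp add: carrier_\<Xi>)

lemma xi_coord_add: "xi_coord (\<lambda>j n. f j n + g j n) = (\<lambda>i. xi_coord f i + xi_coord g i)"
  by (auto simp: xi_coord_def eulers_add rep_add fps_eq_iff)

lemma xi_coord_inj: "inj_on xi_coord (carrier \<Xi>)"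
proof (rule inj_onI)
  fix f g assume fg: "f \<in> carrier \<Xi>" "g \<in> carrier \<Xi>" "xi_coord f = xi_coord g"
  define d where "d = (\<lambda>j n. f j n - g j n)"
  have d: "d \<in> carrier \<Xi>" unfolding d_def by (rule xi_diff_mem[OF fg(1,2)])
  have "xi_coord f i = xi_coord d i + xi_coord g i" for i
    using xi_coord_add[of d g] by (simp add: d_def)
  hence "\<forall>j\<ge>0. \<forall>w. xi_coord d (j, w) = 0" using fg(3) by simp
  hence "\<forall>j\<ge>0. \<forall>n. d j n = 0" using xi_coord_zero_iff[OF d, of 0] by blast
  thus "f = g" by (auto simp: d_def fun_eq_iff)
qed

lemma xi_coord_supp:
  assumes "f \<in> carrier \<Xi>" "i \<notin> xi_index"
  shows "xi_coord f i = 0"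
proof -
  obtain j w where i: "i = (j, w)" by (cases i)
  show ?thesis
  proof (cases "j < k")
    case True
    hence "w \<notin> Basis" using assms(2) i by (simp add: xi_index_def)
    hence "representation Basis v w = 0" for v using representation_ne_zero by blast
    thus ?thesis by (simp add: i xi_coord_def fps_eq_iff)
  next
    case False
    hence "eulers n (\<lambda>j. f j n) j = 0" for n
      using eulers_supp[of k "\<lambda>j. f j n" n] assms(1) by (simp add: carrier_\<Xi>)
    thus ?thesis by (simp add: i xi_coord_def fps_eq_iff rep_zero)
  qed
qed

lemma xi_coord_aop:
  "xi_coord (aop \<Xi> f) = (\<lambda>i. fps_X * twist (\<lambda>_. of_rat \<alpha>) xi_t xi_s (xi_coord f) i)"
proof (intro ext fps_ext)
  fix i :: "nat \<times> 'v" and n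
  obtain j w where i: "i = (j, w)" by (cases i)
  show "fps_nth (xi_coord (aop \<Xi> f) i) n
      = fps_nth (fps_X * twist (\<lambda>_. of_rat \<alpha>) xi_t xi_s (xi_coord f) i) n"
  proof (cases n)
    case 0
    thus ?thesis by (simp add: i xi_coord_def \<Xi>_simps rep_zero)
  next
    case (Suc n')
    have "fps_nth (xi_coord (aop \<Xi> f) i) n
        = representation Basis (euler (expo n') (eulers n' (\<lambda>j. f j n')) j) w"
      by (simp add: i Suc xi_coord_def \<Xi>_simps eulers_euler)
    also have "\<dots> = fps_nth (fps_X * twist (\<lambda>_. of_rat \<alpha>) xi_t xi_s (xi_coord f) i) n"
      by (simp add: i Suc twist_nth xi_coord_def euler_def rep_add rep_scale expo_def del: of_nat_Suc)
    finally show ?thesis .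
  qed
qed

lemma aop_\<Xi>_mem: "f \<in> carrier \<Xi> \<Longrightarrow> aop \<Xi> f \<in> carrier \<Xi>"
  by (auto simp: carrier_\<Xi> \<Xi>_simps split: nat.split)

lemma integ_pow_mem: "f \<in> carrier \<Xi> \<Longrightarrow> (integ ^^ l) f \<in> carrier \<Xi>"
  using integ_mem by (cases l) simp_all

lemma smult_\<Xi>_mem: "f \<in> carrier \<Xi> \<Longrightarrow> S \<odot>\<^bsub>\<Xi>\<^esub> f \<in> carrier \<Xi>"
  using integ_pow_mem by (simp add: carrier_\<Xi> \<Xi>_simps)

lemma zero_\<Xi>_mem: "\<zero>\<^bsub>\<Xi>\<^esub> \<in> carrier \<Xi>"
  and add_\<Xi>_mem: "f \<in> carrier \<Xi> \<Longrightarrow> g \<in> carrier \<Xi> \<Longrightarrow> f \<oplus>\<^bsub>\<Xi>\<^esub> g \<in> carrier \<Xi>"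
  by (simp_all add: carrier_\<Xi> \<Xi>_simps)

lemma xi_coord_zero: "xi_coord \<zero>\<^bsub>\<Xi>\<^esub> = 0"
  by (auto simp: xi_coord_def \<Xi>_simps eulers_zero rep_zero fps_eq_iff)

lemma xi_coord_plus: "xi_coord (f \<oplus>\<^bsub>\<Xi>\<^esub> g) = xi_coord f + xi_coord g"
  by (simp add: \<Xi>_simps xi_coord_add plus_fun_def)

lemma finite_xi_index: "finite xi_index"
  by (simp add: xi_index_def finite_Basis)

lemma \<Xi>_realized: "log_realized \<Xi> xi_coord xi_index \<alpha> xi_t xi_s k"
proof unfold_locales
  show "(xi_s ^^ k) i \<notin> xi_index" for i
  proof -
    obtain j w where i: "i = (j, w)" by (cases i)
    have "(xi_s ^^ n) (j, w) = (j + n, w)" for n by (induction n) simp_all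
    thus ?thesis by (simp add: i xi_index_def)
  qed
  show "xi_s i \<notin> xi_index" if "i \<notin> xi_index" for i
    using that by (cases i) (simp add: xi_index_def)
qed (simp_all add: xi_coord_inj xi_coord_supp xi_coord_aop xi_coord_smult xi_coord_plus aop_\<Xi>_mem
      smult_\<Xi>_mem add_\<Xi>_mem zero_\<Xi>_mem xi_coord_zero \<alpha>_pos finite_xi_index del: of_nat_Suc)

lemma shift_part_pow_xi: "(shift_part xi_t xi_s ^^ r) z (j, w) = 0 \<longleftrightarrow> z (j + r, w) = 0"
  by (induction r arbitrary: j) (simp_all add: shift_part_def del: of_nat_Suc)

lemma xi_filt:
  assumes "f \<in> carrier \<Xi>"
  shows "(shift_part xi_t xi_s ^^ r) (xi_coord f) = 0 \<longleftrightarrow> (\<forall>j\<ge>r. \<forall>n. f j n = 0)"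
proof -
  have "(shift_part xi_t xi_s ^^ r) (xi_coord f) = 0 \<longleftrightarrow> (\<forall>j w. xi_coord f (j + r, w) = 0)"
    by (simp only: fun_eq_iff zero_fun_apply split_paired_All shift_part_pow_xi)
  also have "\<dots> \<longleftrightarrow> (\<forall>j\<ge>r. \<forall>w. xi_coord f (j, w) = 0)"
  proof (intro iffI allI impI)
    fix j w assume "\<forall>j w. xi_coord f (j + r, w) = 0" "r \<le> j"
    thus "xi_coord f (j, w) = 0" by (metis le_add_diff_inverse2)
  qed simp
  finally show ?thesis using xi_coord_zero_iff[OF assms] by simp
qed

sublocale X: log_realized \<Xi> xi_coord xi_index \<alpha> xi_t xi_s k
  by (rule \<Xi>_realized)

lemma finsum_\<Xi>_apply:
  assumes "finite A" "\<And>i. i \<in> A \<Longrightarrow> f i \<in> carrier \<Xi>"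
  shows "(\<Oplus>\<^bsub>\<Xi>\<^esub> i\<in>A. f i) = (\<lambda>j n. \<Sum>i\<in>A. f i j n)"
  using assms
proof (induction A rule: finite_induct)
  case (insert x A)
  hence "f \<in> A \<rightarrow> carrier \<Xi>" "f x \<in> carrier \<Xi>" by auto
  thus ?case using insert by (simp add: X.finsum_insert \<Xi>_simps)
qed (simp add: \<Xi>_simps)

lemma const_smult_\<Xi>: "(fps_const c \<odot>\<^bsub>\<Xi>\<^esub> f) j n = scale c (f j n)"
proof -
  have "(fps_const c \<odot>\<^bsub>\<Xi>\<^esub> f) j n = (\<Sum>l\<le>n. if l = 0 then scale c (f j n) else 0)"
    unfolding \<Xi>_simps by (intro sum.cong) auto
  thus ?thesis by simp
qed

lemma bop_\<Xi>: "bop \<Xi> = integ"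
proof (intro ext)
  fix f j n
  have "(fps_X \<odot>\<^bsub>\<Xi>\<^esub> f) j n = (\<Sum>l\<le>n. if l = 1 then integ f j n else 0)"
    unfolding \<Xi>_simps by (intro sum.cong) (auto simp: fps_X_def)
  also have "\<dots> = integ f j n" by (cases n) (simp_all add: integ_0)
  finally show "bop \<Xi> f j n = integ f j n" by (simp add: bop_def)
qed

section \<open>Order in s and the action of \<open>Atilde\<close> on \<Xi>\<close>

definition low :: "nat \<Rightarrow> (nat \<Rightarrow> nat \<Rightarrow> 'v) \<Rightarrow> bool" where
  "low n f \<longleftrightarrow> (\<forall>j. \<forall>i<n. f j i = 0)"

lemma low_integ: "low n f \<Longrightarrow> low (Suc n) (integ f)"
  unfolding low_def
proof (intro allI impI)
  fix j i assume "\<forall>j. \<forall>i<n. f j i = 0" "i < Suc n"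
  thus "integ f j i = 0" by (cases i) (simp_all add: integ_0 integ_Suc)
qed

lemma low_bop_pow: "low n ((bop \<Xi> ^^ n) f)"
proof (induction n)
  case (Suc n)
  thus ?case using low_integ by (simp add: bop_\<Xi>)
qed (simp add: low_def)

lemma euler_diff: "euler c (\<lambda>j. u j - v j) = (\<lambda>j. euler c u j - euler c v j)"
  by (simp add: euler_def scale_right_diff_distrib algebra_simps del: of_nat_Suc)

text \<open>The preimage under b is the derivative, which loses one order in s. It follows that
  \<open>b^n \<Xi> = s^n \<Xi>\<close>, so the b-adic limits in \<open>act\<close> can be computed
  coefficientwise in s.\<close>

lemma low_imp_integ:
  assumes f: "f \<in> carrier \<Xi>" and low: "low (Suc n) f"
  shows "\<exists>z\<in>carrier \<Xi>. low n z \<and> f = integ z"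
proof -
  define z where "z = (\<lambda>j n. euler (expo n) (\<lambda>j. f j (Suc n)) j)"
  have z: "z \<in> carrier \<Xi>"
    using f by (simp add: z_def carrier_\<Xi> euler_def)
  moreover have "low n z" using low by (simp add: z_def low_def euler_def)
  moreover have "f j i = integ z j i" for j i
  proof (cases i)
    case 0
    thus ?thesis using low by (simp add: low_def integ_0)
  next
    case (Suc i')
    have "\<forall>j\<ge>k. f j (Suc i') - integ z j (Suc i') = 0"
      using f integ_mem[of z] by (simp add: carrier_\<Xi>)
    moreover have "\<forall>j\<ge>0. euler (expo i') (\<lambda>j. f j (Suc i') - integ z j (Suc i')) j = 0"
      unfolding euler_diff euler_integ[OF z] by (simp add: z_def)
    ultimately have "\<forall>j\<ge>0. f j (Suc i') - integ z j (Suc i') = 0"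
      by (rule euler_zero_imp[OF expo_nonzero])
    thus ?thesis using Suc by simp
  qed
  ultimately show ?thesis by (intro bexI[of _ z] conjI ext)
qed

lemma low_imp_bop_pow: "f \<in> carrier \<Xi> \<Longrightarrow> low n f \<Longrightarrow> \<exists>z\<in>carrier \<Xi>. f = (bop \<Xi> ^^ n) z"
proof (induction n arbitrary: f)
  case (Suc n)
  obtain z where z: "z \<in> carrier \<Xi>" "low n z" "f = integ z"
    using low_imp_integ[OF Suc.prems] by blast
  obtain w where "w \<in> carrier \<Xi>" "z = (bop \<Xi> ^^ n) w" using Suc.IH[OF z(1,2)] by blast
  thus ?case using z(3) by (intro bexI[of _ w]) (simp_all add: bop_\<Xi>)
qed auto

text \<open>Closure under a, sums and complex scalars is what the polynomials
  \<open>P_\<nu>(a)\<close> require; the powers of b are handled separately.\<close>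

definition a_stable :: "(nat \<Rightarrow> nat \<Rightarrow> 'v) set \<Rightarrow> bool" where
  "a_stable U \<longleftrightarrow> U \<subseteq> carrier \<Xi> \<and> (\<lambda>j n. 0) \<in> U \<and> (\<forall>f\<in>U. \<forall>g\<in>U. (\<lambda>j n. f j n + g j n) \<in> U) \<and>
     (\<forall>c. \<forall>f\<in>U. (\<lambda>j n. scale c (f j n)) \<in> U) \<and> (\<forall>f\<in>U. aop \<Xi> f \<in> U)"

lemma a_stableD:
  assumes "a_stable U"
  shows "U \<subseteq> carrier \<Xi>" "(\<lambda>j n. 0) \<in> U" "f \<in> U \<Longrightarrow> g \<in> U \<Longrightarrow> (\<lambda>j n. f j n + g j n) \<in> U"
    "f \<in> U \<Longrightarrow> (\<lambda>j n. scale c (f j n)) \<in> U" "f \<in> U \<Longrightarrow> aop \<Xi> f \<in> U"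
  using assms unfolding a_stable_def by blast+

lemma poly_act_stable:
  assumes U: "a_stable U" and f: "f \<in> U"
  shows "poly_act \<Xi> (aop \<Xi>) q f \<in> U"
proof -
  have pow: "(aop \<Xi> ^^ i) f \<in> U" for i
    by (induction i) (simp_all add: f a_stableD(5)[OF U])
  have const: "fps_const c \<odot>\<^bsub>\<Xi>\<^esub> g = (\<lambda>j n. scale c (g j n))" for c g
    by (intro ext) (rule const_smult_\<Xi>)
  have mem: "fps_const c \<odot>\<^bsub>\<Xi>\<^esub> (aop \<Xi> ^^ i) f \<in> U" for c i
    unfolding const by (rule a_stableD(4)[OF U pow])
  have "(\<lambda>j n. \<Sum>i\<le>(p::nat). (fps_const (poly.coeff q i) \<odot>\<^bsub>\<Xi>\<^esub> (aop \<Xi> ^^ i) f) j n) \<in> U" for p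
  proof (induction p)
    case 0
    show ?case using mem[of _ 0] by simp
  next
    case (Suc p)
    show ?case using a_stableD(3)[OF U Suc.IH mem[of "poly.coeff q (Suc p)" "Suc p"]] by simp
  qed
  moreover have "fps_const (poly.coeff q i) \<odot>\<^bsub>\<Xi>\<^esub> (aop \<Xi> ^^ i) f \<in> carrier \<Xi>" for i
    using mem a_stableD(1)[OF U] by blast
  ultimately show ?thesis unfolding poly_act_def by (subst finsum_\<Xi>_apply) auto
qed

lemma a_stable_low: "a_stable {f \<in> carrier \<Xi>. low n f}"
  by (auto simp: a_stable_def carrier_\<Xi> low_def \<Xi>_simps split: nat.split)

lemma carrier_stable: "a_stable (carrier \<Xi>)"
  by (auto simp: a_stable_def carrier_\<Xi> \<Xi>_simps split: nat.split)

definition act_term :: "complex poly fps \<Rightarrow> (nat \<Rightarrow> nat \<Rightarrow> 'v) \<Rightarrow> nat \<Rightarrow> nat \<Rightarrow> nat \<Rightarrow> 'v" where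
  "act_term P e \<nu> = poly_act \<Xi> (aop \<Xi>) (fps_nth P \<nu>) ((bop \<Xi> ^^ \<nu>) e)"

lemma act_term_mem: "e \<in> carrier \<Xi> \<Longrightarrow> act_term P e \<nu> \<in> carrier \<Xi>"
  unfolding act_term_def by (intro poly_act_stable[OF carrier_stable] X.bop_pow_closed)

lemma act_term_low: "e \<in> carrier \<Xi> \<Longrightarrow> low \<nu> (act_term P e \<nu>)"
  using poly_act_stable[OF a_stable_low[of \<nu>], of "(bop \<Xi> ^^ \<nu>) e"] low_bop_pow X.bop_pow_closed
  by (simp add: act_term_def)

text \<open>The term of index \<nu> starts at order \<nu> in s, which makes each coefficient a
  finite sum. Two candidates for the limit agree modulo every \<open>b^n \<Xi>\<close>, hence
  coincide.\<close>

lemma act_eq: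
  assumes e: "e \<in> carrier \<Xi>"
  shows "act \<Xi> P e = (\<lambda>j n. \<Sum>\<nu>\<le>n. act_term P e \<nu> j n)"
proof -
  define y where "y = (\<lambda>j n. \<Sum>\<nu>\<le>n. act_term P e \<nu> j n)"
  have partial: "(\<Oplus>\<^bsub>\<Xi>\<^esub> \<nu>\<in>{..<n}. act_term P e \<nu>) = (\<lambda>j i. \<Sum>\<nu><n. act_term P e \<nu> j i)" for n
    by (rule finsum_\<Xi>_apply) (simp_all add: act_term_mem[OF e])
  have y: "y \<in> carrier \<Xi>"
    using act_term_mem[OF e, unfolded carrier_\<Xi>] by (simp add: y_def carrier_\<Xi>)
  have ex: "\<exists>z\<in>carrier \<Xi>. y = (\<Oplus>\<^bsub>\<Xi>\<^esub> \<nu>\<in>{..<n}. act_term P e \<nu>) \<oplus>\<^bsub>\<Xi>\<^esub> (bop \<Xi> ^^ n) z" for n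
  proof -
    define d where "d = (\<lambda>j i. y j i - (\<Sum>\<nu><n. act_term P e \<nu> j i))"
    have "d \<in> carrier \<Xi>"
      using y act_term_mem[OF e, unfolded carrier_\<Xi>] by (simp add: d_def carrier_\<Xi>)
    moreover have "low n d"
      unfolding low_def
    proof (intro allI impI)
      fix j i assume i: "i < n"
      have "(\<Sum>\<nu><n. act_term P e \<nu> j i) = (\<Sum>\<nu>\<le>i. act_term P e \<nu> j i)"
        using i act_term_low[OF e, unfolded low_def]
        by (intro sum.mono_neutral_right) auto
      thus "d j i = 0" by (simp add: d_def y_def)
    qed
    ultimately obtain z where z: "z \<in> carrier \<Xi>" "d = (bop \<Xi> ^^ n) z"
      using low_imp_bop_pow by blast
    have "y = (\<Oplus>\<^bsub>\<Xi>\<^esub> \<nu>\<in>{..<n}. act_term P e \<nu>) \<oplus>\<^bsub>\<Xi>\<^esub> d"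
      by (simp add: partial \<Xi>_simps d_def)
    thus ?thesis using z by blast
  qed
  have "y' = y" if y': "\<And>n. \<exists>z\<in>carrier \<Xi>. y' = (\<Oplus>\<^bsub>\<Xi>\<^esub> \<nu>\<in>{..<n}. act_term P e \<nu>) \<oplus>\<^bsub>\<Xi>\<^esub> (bop \<Xi> ^^ n) z" for y'
  proof (intro ext)
    fix j n
    obtain z z' where z: "y' = (\<Oplus>\<^bsub>\<Xi>\<^esub> \<nu>\<in>{..<Suc n}. act_term P e \<nu>) \<oplus>\<^bsub>\<Xi>\<^esub> (bop \<Xi> ^^ Suc n) z"
      "y = (\<Oplus>\<^bsub>\<Xi>\<^esub> \<nu>\<in>{..<Suc n}. act_term P e \<nu>) \<oplus>\<^bsub>\<Xi>\<^esub> (bop \<Xi> ^^ Suc n) z'"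
      using y'[of "Suc n"] ex[of "Suc n"] by blast
    have "(bop \<Xi> ^^ Suc n) z j n = 0" "(bop \<Xi> ^^ Suc n) z' j n = 0"
      using low_bop_pow[of "Suc n"] unfolding low_def by blast+
    thus "y' j n = y j n"
      by (subst z(1), subst z(2)) (simp only: \<Xi>_simps)
  qed
  thus ?thesis
    unfolding act_def act_term_def[symmetric] y_def[symmetric]
    using y ex by (intro the_equality) blast+
qed

lemma act_one: "e \<in> carrier \<Xi> \<Longrightarrow> act \<Xi> 1 e = e"
proof (intro ext)
  fix j n assume e: "e \<in> carrier \<Xi>"
  have const: "poly_act \<Xi> (aop \<Xi>) [:c:] f j n = scale c (f j n)" if "f \<in> carrier \<Xi>" for c f
    unfolding poly_act_def by (subst finsum_\<Xi>_apply) (auto simp: const_smult_\<Xi> X.smult_mem that)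
  have "fps_nth 1 \<nu> = [:if \<nu> = 0 then 1 else 0 :: complex:]" for \<nu>
    by (simp add: one_pCons)
  hence "act_term 1 e \<nu> j n = (if \<nu> = 0 then e j n else 0)" for \<nu>
    using const[OF X.bop_pow_closed[OF e, of \<nu>]] by (simp add: act_term_def)
  thus "act \<Xi> 1 e j n = e j n" by (simp add: act_eq[OF e])
qed

lemma mem_generated: "e \<in> carrier \<Xi> \<Longrightarrow> e \<in> generated \<Xi> e"
  unfolding generated_def using act_one by (metis (mono_tags, lifting) mem_Collect_eq)

lemma generated_subset: "e \<in> carrier \<Xi> \<Longrightarrow> generated \<Xi> e \<subseteq> carrier \<Xi>"
proof
  fix y assume e: "e \<in> carrier \<Xi>" and "y \<in> generated \<Xi> e"
  then obtain P where y: "y = act \<Xi> P e" by (auto simp: generated_def)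
  show "y \<in> carrier \<Xi>"
    unfolding y act_eq[OF e] using act_term_mem[OF e, of P] by (simp add: carrier_\<Xi>)
qed

text \<open>Both a and b raise the order in s by one, and in the top power of Log s integration
  receives nothing from higher powers, so it only rescales. An increasing family of subspaces
  therefore passes from e to all that e generates.\<close>

lemma generated_coefficients:
  assumes e: "e \<in> carrier \<Xi>" and W: "\<And>n. subspace (W n)" "\<And>n. W n \<subseteq> W (Suc n)"
    and i: "Suc i \<ge> k" and coeff: "\<And>n. e i n \<in> W n" and y: "y \<in> generated \<Xi> e"
  shows "y i n \<in> W n"
proof -
  define U where "U = {f \<in> carrier \<Xi>. \<forall>n. f i n \<in> W n}"
  have U: "a_stable U"
  proof -
    have "(case n of 0 \<Rightarrow> 0 | Suc n' \<Rightarrow> f i n') \<in> W n" if "\<forall>n. f i n \<in> W n" for f n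
      using that W subspace_0 by (cases n) auto
    thus ?thesis
      using W(1) by (auto simp: a_stable_def U_def carrier_\<Xi> \<Xi>_simps subspace_0 subspace_add
          subspace_scale split: nat.split)
  qed
  have "integ f \<in> U" if f: "f \<in> U" for f
  proof -
    have "integ f i n \<in> W n" for n
    proof (cases n)
      case 0
      thus ?thesis using W(1) by (simp add: integ_0 subspace_0)
    next
      case (Suc n')
      have "f j n' \<in> W n'" if "j \<in> {i..<k}" for j
        using f that i by (cases "j = i") (auto simp: U_def)
      hence "integ f i n \<in> W n'"
        unfolding Suc integ_Suc using W(1) by (intro subspace_sum subspace_scale) auto
      thus ?thesis using W(2) Suc by blast
    qed
    thus ?thesis using integ_mem by (simp add: U_def)
  qed
  hence "(bop \<Xi> ^^ \<nu>) e \<in> U" for \<nu>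
    using e coeff by (induction \<nu>) (simp_all add: bop_\<Xi> U_def)
  hence "act_term P e \<nu> \<in> U" for P \<nu>
    unfolding act_term_def by (rule poly_act_stable[OF U])
  hence "(\<Sum>\<nu>\<le>n. act_term P e \<nu> i n) \<in> W n" for P
    using W(1) by (intro subspace_sum) (auto simp: U_def)
  thus ?thesis using y by (auto simp: generated_def act_eq[OF e])
qed

end

section \<open>Triangular expansions of the generator\<close>

declare One_nat_def [simp del]

lemma (in realized) module_sub_imp_ab_submodule:
  assumes "module Cb (sub E M)" "M \<subseteq> carrier E" "\<And>x. x \<in> M \<Longrightarrow> aop E x \<in> M"
  shows "ab_submodule M E"
proof -
  interpret S: module Cb "sub E M" by fact
  show ?thesis
    by (rule ab_submoduleI)
      (use assms(2,3) S.zero_closed S.a_closed S.smult_closed in \<open>auto simp: sub_def Cb_def\<close>)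
qed

lemma (in coords) has_rank_zero:
  assumes "\<And>x. x \<in> carrier E \<Longrightarrow> x = \<zero>"
  shows "has_rank E 0"
  unfolding has_rank_def
proof (intro bexI[of _ "\<lambda>_. \<zero>"] ballI)
  fix x assume "x \<in> carrier E"
  hence "x = \<zero>" by (rule assms)
  thus "\<exists>!c. c \<in> extensional {..<0} \<and> x = (\<Oplus>i\<in>{..<0::nat}. c i \<odot> \<zero>)"
    by (intro ex1I[of _ "\<lambda>_. undefined"]) simp_all
qed simp

section \<open>The fresco generated by e and its quotient by the last proper step\<close>

locale xi_fresco = xi_space scale Basis \<alpha> k
  for scale :: "complex \<Rightarrow> 'v::ab_group_add \<Rightarrow> 'v" and Basis \<alpha> k +
  fixes e :: "nat \<Rightarrow> nat \<Rightarrow> 'v"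
  assumes e: "e \<in> carrier \<Xi>"
    and ab_module: "ab_module (sub \<Xi> (generated \<Xi> e))"
begin

abbreviation F :: "(nat \<Rightarrow> nat \<Rightarrow> 'v) abm" where
  "F \<equiv> sub \<Xi> (generated \<Xi> e)"

abbreviation top_quot :: "(nat \<Rightarrow> nat \<Rightarrow> 'v) set abm" where
  "top_quot \<equiv> quot F (ss_filt F (k - 1))"

lemma F_simps: "carrier F = generated \<Xi> e" "zero F = zero \<Xi>" "add F = add \<Xi>" "smult F = smult \<Xi>"
    "aop F = aop \<Xi>"
  by (simp_all add: sub_def)

lemma F_subset: "y \<in> carrier F \<Longrightarrow> y \<in> carrier \<Xi>"
  using generated_subset[OF e] by (auto simp: F_simps)

lemma e_mem: "e \<in> carrier F"
  using mem_generated[OF e] by (simp add: F_simps)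

text \<open>Closure under the operations is read off from F being an (a,b)-module with the
  operations of \<Xi>, rather than from the series that generate it.\<close>

lemma F_submodule: "ab_submodule (generated \<Xi> e) \<Xi>"
proof (rule X.module_sub_imp_ab_submodule)
  show "module Cb F" using ab_module by (simp add: ab_module_def)
  show "aop \<Xi> x \<in> generated \<Xi> e" if "x \<in> generated \<Xi> e" for x
    using ab_module that by (auto simp: ab_module_def F_simps)
qed (rule generated_subset[OF e])

lemma F_realized: "log_realized F xi_coord xi_index \<alpha> xi_t xi_s k"
  using X.realized_sub[OF F_submodule] X.outside X.nilpotent \<alpha>_pos
  by (simp add: log_realized_def log_realized_axioms_def)

sublocale F: log_realized F xi_coord xi_index \<alpha> xi_t xi_s k
  by (rule F_realized)

lemma ss_filt_F: "ss_filt F r = {y \<in> carrier F. \<forall>j\<ge>r. \<forall>n. y j n = 0}"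
  unfolding F.ss_filt_eq F.filt_def using xi_filt F_subset by blast

lemma ss_filt_F_top: "ss_filt F k = carrier F"
  unfolding ss_filt_F using F_subset by (auto simp: carrier_\<Xi>)

text \<open>No power of Log s beyond k - 1 occurs, so the k-th step is all of F. This makes the
  shift of the variable in the k-th Bernstein polynomial trivial.\<close>

lemma rank_quot_top: "ab_rank (quot F (ss_filt F k)) = 0"
proof -
  interpret Q: log_realized "quot F (F.filt k)" "fibre_value (\<lambda>x. (shift_part xi_t xi_s ^^ k) (xi_coord x))"
    xi_index \<alpha> xi_t xi_s k
    by (rule F.filt_quot_realized)
  interpret K: realized_quot F "\<lambda>x. (shift_part xi_t xi_s ^^ k) (xi_coord x)" "F.filt k" xi_index
    "\<lambda>_. of_rat \<alpha>" xi_t xi_s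
    by (rule F.filt_quot)
  have top: "F.filt k = carrier F" using ss_filt_F_top F.ss_filt_eq by simp
  have "C = \<zero>\<^bsub>quot F (F.filt k)\<^esub>" if C: "C \<in> carrier (quot F (F.filt k))" for C
  proof -
    obtain x where x: "x \<in> carrier F" "C = F.filt k +>\<^bsub>F\<^esub> x" using C by (rule K.quotE)
    have "x \<in> F.filt k" "\<zero>\<^bsub>F\<^esub> \<in> F.filt k" unfolding top by (rule x(1), rule F.zero_mem)
    thus ?thesis unfolding x(2) K.zero_quot using x(1) F.zero_mem
      by (subst K.coset_eq_iff) (simp_all add: F.filt_def del: of_nat_Suc)
  qed
  hence "has_rank (quot F (F.filt k)) 0" by (rule Q.has_rank_zero)
  thus ?thesis unfolding F.ss_filt_eq by (rule Q.ab_rank_eq)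
qed

lemma bernstein_nth_F: "bernstein_nth k F = bernstein top_quot"
proof -
  have "sub F (ss_filt F k) = F" unfolding ss_filt_F_top by (simp add: sub_def)
  moreover have "[:- of_nat 0, 1:] = [:0, 1 :: complex:]" by simp
  ultimately show ?thesis
    unfolding bernstein_nth_def rank_quot_top by (simp add: pcompose_idR)
qed

end

text \<open>Records an expansion of e by coefficients: \<open>c j\<close> is the coefficient
  sequence of \<open>v j\<close>, of exact order \<open>m j\<close>. The constructed expansion and
  any given one are both instances, so rank and Bernstein polynomial are computed once for
  both.\<close>

locale echelon = xi_fresco scale Basis \<alpha> k e
  for scale :: "complex \<Rightarrow> 'v::ab_group_add \<Rightarrow> 'v" and Basis \<alpha> k e +
  fixes p :: nat and v :: "nat \<Rightarrow> 'v" and m :: "nat \<Rightarrow> nat" and c :: "nat \<Rightarrow> nat \<Rightarrow> complex"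
  assumes v_inj: "inj_on v {1..p}" and indep: "independent (v ` {1..p})"
    and m_inj: "inj_on m {1..p}"
    and expand: "e (k - 1) n = (\<Sum>j\<in>{1..p}. scale (c j n) (v j))"
    and below: "j \<in> {1..p} \<Longrightarrow> n < m j \<Longrightarrow> c j n = 0"
    and lead: "j \<in> {1..p} \<Longrightarrow> c j (m j) \<noteq> 0"
begin

text \<open>The coordinate forms dual to the \<open>v j\<close>, made total by extending the
  \<open>v j\<close> to a basis of the whole space.\<close>

definition form :: "nat \<Rightarrow> 'v \<Rightarrow> complex" where
  "form j x = representation (extend_basis (v ` {1..p})) x (v j)"

lemma form_add: "form j (x + y) = form j x + form j y"
  unfolding form_def
  by (subst representation_add) (simp_all add: independent_extend_basis[OF indep] span_extend_basis[OF indep])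

lemma form_scale: "form j (scale a x) = a * form j x"
  unfolding form_def
  by (subst representation_scale) (simp_all add: independent_extend_basis[OF indep] span_extend_basis[OF indep])

lemma form_zero: "form j 0 = 0"
  using form_scale[of j 0 0] by simp

lemma form_sum: "form j (\<Sum>x\<in>A. h x) = (\<Sum>x\<in>A. form j (h x))"
  by (induction A rule: infinite_finite_induct) (simp_all add: form_zero form_add)

lemma form_v:
  assumes "i \<in> {1..p}" "j \<in> {1..p}"
  shows "form j (v i) = (if i = j then 1 else 0)"
proof -
  have "v i \<in> extend_basis (v ` {1..p})" using extend_basis_superset[OF indep] assms(1) by blast
  moreover have "v j = v i \<longleftrightarrow> i = j" using inj_on_eq_iff[OF v_inj assms] by metis
  ultimately show ?thesis
    unfolding form_def by (simp only: representation_basis[OF independent_extend_basis[OF indep]])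
qed

text \<open>The span of the \<open>v j\<close> with \<open>m j \<le> n\<close>, given by
  coefficients so that \<open>form\<close> can read them off. This is the increasing family for
  \<open>generated_coefficients\<close>.\<close>

definition steps :: "nat \<Rightarrow> 'v set" where
  "steps n = {x. \<exists>d. x = (\<Sum>j\<in>{1..p}. scale (d j) (v j)) \<and> (\<forall>j\<in>{1..p}. n < m j \<longrightarrow> d j = 0)}"

lemma subspace_steps: "subspace (steps n)"
proof (rule subspaceI)
  show "0 \<in> steps n" unfolding steps_def by (intro CollectI exI[of _ "\<lambda>_. 0"]) simp
next
  fix x y assume "x \<in> steps n" "y \<in> steps n"
  then obtain d d' where "x = (\<Sum>j\<in>{1..p}. scale (d j) (v j))" "\<forall>j\<in>{1..p}. n < m j \<longrightarrow> d j = 0"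
    "y = (\<Sum>j\<in>{1..p}. scale (d' j) (v j))" "\<forall>j\<in>{1..p}. n < m j \<longrightarrow> d' j = 0"
    unfolding steps_def by blast
  thus "x + y \<in> steps n"
    unfolding steps_def by (intro CollectI exI[of _ "\<lambda>j. d j + d' j"]) (simp add: scale_left_distrib sum.distrib)
next
  fix a x assume "x \<in> steps n"
  then obtain d where "x = (\<Sum>j\<in>{1..p}. scale (d j) (v j))" "\<forall>j\<in>{1..p}. n < m j \<longrightarrow> d j = 0"
    unfolding steps_def by blast
  thus "scale a x \<in> steps n"
    unfolding steps_def by (intro CollectI exI[of _ "\<lambda>j. a * d j"]) (simp add: scale_sum_right)
qed

lemma form_steps:
  assumes "x \<in> steps n"
  shows "x = (\<Sum>j\<in>{1..p}. scale (form j x) (v j))" "j \<in> {1..p} \<Longrightarrow> n < m j \<Longrightarrow> form j x = 0"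
proof -
  obtain d where d: "x = (\<Sum>j\<in>{1..p}. scale (d j) (v j))" "\<forall>j\<in>{1..p}. n < m j \<longrightarrow> d j = 0"
    using assms unfolding steps_def by blast
  have f: "form j x = d j" if "j \<in> {1..p}" for j
  proof -
    have "form j x = (\<Sum>i\<in>{1..p}. if i = j then d j else 0)"
      unfolding d(1) form_sum form_scale using that by (intro sum.cong) (auto simp: form_v)
    thus ?thesis using that by simp
  qed
  show "x = (\<Sum>j\<in>{1..p}. scale (form j x) (v j))"
    by (subst d(1), intro sum.cong) (simp_all add: f)
  show "j \<in> {1..p} \<Longrightarrow> n < m j \<Longrightarrow> form j x = 0" using f d(2) by simp
qed

lemma steps_mono: "steps n \<subseteq> steps (Suc n)"
proof
  fix x assume "x \<in> steps n"
  then obtain d where "x = (\<Sum>j\<in>{1..p}. scale (d j) (v j))" "\<forall>j\<in>{1..p}. n < m j \<longrightarrow> d j = 0"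
    unfolding steps_def by blast
  thus "x \<in> steps (Suc n)"
    unfolding steps_def by (intro CollectI exI[of _ d]) simp
qed

lemma e_steps: "e (k - 1) n \<in> steps n"
  unfolding steps_def by (intro CollectI exI[of _ "\<lambda>j. c j n"]) (simp add: expand below)

lemma F_steps:
  assumes "y \<in> carrier F"
  shows "y (k - 1) n \<in> steps n"
proof (rule generated_coefficients[where W = steps])
  show "y \<in> generated \<Xi> e" using assms by (simp only: F_simps)
  show "k \<le> Suc (k - 1)" by simp
qed (rule e subspace_steps steps_mono e_steps)+

text \<open>The Pochhammer symbol of \<alpha>, from
  \<open>b^n s^(\<alpha>-1) = s^(\<alpha>+n-1) / rising n\<close>. It normalizes the top
  coefficients so that b becomes multiplication by X.\<close>

definition rising :: "nat \<Rightarrow> complex" where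
  "rising n = (\<Prod>i<n. expo i)"

lemma rising_nonzero: "rising n \<noteq> 0"
  by (simp add: rising_def expo_nonzero)

definition top_coord :: "(nat \<Rightarrow> nat \<Rightarrow> 'v) \<Rightarrow> nat \<Rightarrow> complex fps" where
  "top_coord y j = (if j \<in> {1..p} then Abs_fps (\<lambda>n. rising n * form j (y (k - 1) n)) else 0)"

lemma integ_top:
  assumes "f \<in> carrier \<Xi>"
  shows "scale (expo n) (integ f (k - 1) (Suc n)) = f (k - 1) n"
proof -
  have "integ f (Suc (k - 1)) (Suc n) = 0"
    using integ_mem[of f] by (simp add: carrier_\<Xi>)
  thus ?thesis using fun_cong[OF euler_integ[OF assms, of n], of "k - 1"] by (simp add: euler_def)
qed

lemma top_coord_smult:
  assumes "f \<in> carrier \<Xi>"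
  shows "top_coord (S \<odot>\<^bsub>\<Xi>\<^esub> f) = (\<lambda>j. S * top_coord f j)"
proof
  fix j
  have "rising (Suc n) * form j (integ f (k - 1) (Suc n)) = rising n * form j (f (k - 1) n)"
    if "f \<in> carrier \<Xi>" for f n
    by (simp add: rising_def form_scale flip: integ_top[OF that])
  hence "Abs_fps (\<lambda>n. rising n * form j ((S \<odot>\<^bsub>\<Xi>\<^esub> f) (k - 1) n))
      = S * Abs_fps (\<lambda>n. rising n * form j (f (k - 1) n))"
    by (intro coefficient_map_smult[where h = "\<lambda>n u. rising n * form j (u (k - 1))"])
      (simp_all add: form_add form_scale algebra_simps assms)
  thus "top_coord (S \<odot>\<^bsub>\<Xi>\<^esub> f) j = S * top_coord f j" by (simp add: top_coord_def)
qed

lemma top_coord_aop: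
  "top_coord (aop \<Xi> f) = (\<lambda>j. fps_X * twist (\<lambda>_. of_rat \<alpha>) (\<lambda>_. 0) id (top_coord f) j)"
proof (intro ext fps_ext)
  fix j n
  show "fps_nth (top_coord (aop \<Xi> f) j) n
      = fps_nth (fps_X * twist (\<lambda>_. of_rat \<alpha>) (\<lambda>_. 0) id (top_coord f) j) n"
    by (cases n) (simp_all add: top_coord_def \<Xi>_simps form_zero twist_nth rising_def expo_def)
qed

lemma top_coord_add: "top_coord (f \<oplus>\<^bsub>\<Xi>\<^esub> g) = top_coord f + top_coord g"
  by (auto simp: top_coord_def \<Xi>_simps form_add fps_eq_iff algebra_simps)

text \<open>The forms are blind to the complement of the span of the \<open>v j\<close>. By
  \<open>F_steps\<close> the top coefficients of elements of F stay in this span, so there vanishing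
  forms mean vanishing coefficients.\<close>

lemma ss_filt_kernel: "ss_filt F (k - 1) = {y \<in> carrier F. top_coord y = 0}"
proof -
  have "(\<forall>j\<ge>k - 1. \<forall>n. y j n = 0) \<longleftrightarrow> top_coord y = 0" if y: "y \<in> carrier F" for y
  proof
    assume "\<forall>j\<ge>k - 1. \<forall>n. y j n = 0"
    hence "y (k - 1) n = 0" for n by simp
    thus "top_coord y = 0" by (intro ext) (simp add: top_coord_def form_zero fps_eq_iff)
  next
    assume 0: "top_coord y = 0"
    have "form j (y (k - 1) n) = 0" if "j \<in> {1..p}" for j n
      using arg_cong[OF fun_cong[OF 0, of j], of "\<lambda>f. fps_nth f n"] that rising_nonzero
      by (simp add: top_coord_def)
    hence top: "y (k - 1) n = 0" for n
      by (subst form_steps(1)[OF F_steps[OF y]]) (intro sum.neutral, simp)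
    show "\<forall>j\<ge>k - 1. \<forall>n. y j n = 0"
    proof (intro allI impI)
      fix j n assume "k - 1 \<le> j"
      hence "j = k - 1 \<or> k \<le> j" by auto
      thus "y j n = 0" using top F_subset[OF y] by (auto simp: carrier_\<Xi>)
    qed
  qed
  thus ?thesis unfolding ss_filt_F by blast
qed

lemma realized_top_quot: "realized_quot F top_coord (ss_filt F (k - 1)) {1..p} (\<lambda>_. of_rat \<alpha>) (\<lambda>_. 0) id"
  by unfold_locales
    (auto simp: F_simps(3-5) top_coord_add top_coord_smult top_coord_aop F_subset ss_filt_kernel
      F.smult_mem[unfolded F_simps(4)] F.aop_mem[unfolded F_simps(5)] top_coord_def[of _ "_ :: nat"])

definition top_value :: "(nat \<Rightarrow> nat \<Rightarrow> 'v) set \<Rightarrow> nat \<Rightarrow> complex fps" where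
  "top_value = fibre_value top_coord"

lemma top_distinct_orders:
  "distinct_orders top_quot top_value {1..p} (of_rat \<alpha>) id m
     (ss_filt F (k - 1) +>\<^bsub>F\<^esub> e)"
proof -
  interpret Q: realized_quot F top_coord "ss_filt F (k - 1)" "{1..p}" "\<lambda>_. of_rat \<alpha>" "\<lambda>_. 0" id
    by (rule realized_top_quot)
  interpret R: realized top_quot top_value "{1..p}" "\<lambda>_. of_rat \<alpha>" "\<lambda>_. 0" id
    unfolding top_value_def by (rule Q.realized)
  show ?thesis
  proof unfold_locales
    fix C j n assume C: "C \<in> carrier top_quot" and jn: "j \<in> {1..p}" "n < m j"
    obtain y where y: "y \<in> carrier F" "C = ss_filt F (k - 1) +>\<^bsub>F\<^esub> y" using C by (rule Q.quotE)
    show "fps_nth (top_value C j) n = 0"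
      using form_steps(2)[OF F_steps[OF y(1)] jn] jn(1)
      by (simp add: y(2) top_value_def Q.fibre_value_coset[OF y(1)] top_coord_def)
  next
    show "ss_filt F (k - 1) +>\<^bsub>F\<^esub> e \<in> carrier top_quot"
      unfolding Q.carrier_quot using e_mem by blast
  next
    fix j assume j: "j \<in> {1..p}"
    have "form j (e (k - 1) (m j)) = (\<Sum>i\<in>{1..p}. if i = j then c j (m j) else 0)"
      unfolding expand form_sum form_scale using j by (intro sum.cong) (auto simp: form_v)
    hence "form j (e (k - 1) (m j)) = c j (m j)" using j by simp
    thus "fps_nth (top_value (ss_filt F (k - 1) +>\<^bsub>F\<^esub> e) j) (m j) \<noteq> 0"
      using j lead[OF j] rising_nonzero
      by (simp add: top_value_def Q.fibre_value_coset[OF e_mem] top_coord_def)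
  qed (rule m_inj)
qed

lemma rank_top: "ab_rank top_quot = p"
proof -
  interpret D: distinct_orders top_quot top_value "{1..p}" "of_rat \<alpha>" id m
    "ss_filt F (k - 1) +>\<^bsub>F\<^esub> e"
    by (rule top_distinct_orders)
  show ?thesis using D.ab_rank_eq[OF D.has_rank_card] by simp
qed

lemma bernstein_top: "bernstein_nth k F = (\<Prod>j\<in>{1..p}. [:of_rat \<alpha> + of_nat (m j), 1:])"
  unfolding bernstein_nth_F by (rule distinct_orders.bernstein_eq[OF top_distinct_orders])

end

section \<open>Greedy echelon form of a sequence of vectors\<close>

definition (in vector_space) jumps :: "(nat \<Rightarrow> 'b) \<Rightarrow> nat set" where
  "jumps g = {n. g n \<notin> span (g ` {..<n})}"

context finite_dimensional_vector_space
begin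

lemma inj_on_jumps: "inj_on g (jumps g)"
proof (rule linorder_inj_onI')
  fix a b assume "a \<in> jumps g" "b \<in> jumps g" "a < b"
  hence "g a \<in> span (g ` {..<b})" "g b \<notin> span (g ` {..<b})"
    by (auto simp: jumps_def intro: span_base)
  thus "g a \<noteq> g b" by metis
qed

lemma independent_jumps_finite:
  assumes "finite A" "A \<subseteq> jumps g" shows "independent (g ` A)"
  using assms
proof (induction A rule: finite_linorder_max_induct)
  case empty
  show ?case using independent_empty by simp
next
  case (insert b A)
  have "g b \<notin> span (g ` {..<b})" using insert.prems by (simp add: jumps_def)
  moreover have "g ` A \<subseteq> g ` {..<b}" using insert.hyps by auto
  ultimately have "g b \<notin> span (g ` A)" using span_mono by blast
  thus ?case using insert by (simp add: independent_insertI)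
qed

lemma finite_jumps: "finite (jumps g)"
proof (rule ccontr)
  assume "infinite (jumps g)"
  then obtain A where A: "finite A" "card A = Suc (card Basis)" "A \<subseteq> jumps g"
    using infinite_arbitrarily_large by blast
  have "card (g ` A) \<le> card Basis"
    using independent_span_bound[OF finite_Basis independent_jumps_finite[OF A(1,3)]] span_Basis by simp
  moreover have "card (g ` A) = card A"
    by (rule card_image) (rule inj_on_subset[OF inj_on_jumps A(3)])
  ultimately show False using A(2) by simp
qed

lemma in_span_jumps: "g n \<in> span (g ` {i \<in> jumps g. i \<le> n})"
proof (induction n rule: less_induct)
  case (less n)
  show ?case
  proof (cases "n \<in> jumps g")
    case True
    thus ?thesis by (intro span_base imageI) simp
  next
    case False
    have "g i \<in> span (g ` {i \<in> jumps g. i \<le> n})" if "i < n" for i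
    proof -
      have "g ` {j \<in> jumps g. j \<le> i} \<subseteq> g ` {i \<in> jumps g. i \<le> n}" using that by auto
      thus ?thesis using less.IH[OF that] span_mono by blast
    qed
    hence "g ` {..<n} \<subseteq> span (g ` {i \<in> jumps g. i \<le> n})" by auto
    hence "span (g ` {..<n}) \<subseteq> span (g ` {i \<in> jumps g. i \<le> n})"
      by (rule span_minimal) (rule subspace_span)
    thus ?thesis using False by (auto simp: jumps_def)
  qed
qed

text \<open>\<open>g n\<close> lies in the span of the vectors selected up to n, and coordinates do
  not change when an independent set is enlarged. So the coefficients of \<open>v j\<close> start
  exactly at \<open>m j\<close>, with the value 1.\<close>

lemma ex_triangular:
  obtains p v m c where "inj_on v {1..p}" "independent (v ` {1..p})" "strict_mono_on {1..p} (m :: nat \<Rightarrow> nat)"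
    "\<forall>n. g n = (\<Sum>j\<in>{1..p}. scale (c j n) (v j))" "\<forall>j\<in>{1..p}. \<forall>n<m j. c j n = 0"
    "\<forall>j\<in>{1..p}. c j (m j) \<noteq> (0 :: 'a)" "\<forall>j\<in>{1..p}. v j = g (m j)"
proof -
  define p where "p = card (jumps g)"
  obtain h where h: "bij_betw h {..<p} (jumps g)" "strict_mono_on {..<p} h"
    unfolding p_def using ex_bij_betw_strict_mono_card[OF finite_jumps] by blast
  \<comment> \<open>\<open>h\<close> enumerates the jumps from 0, whereas the vectors are numbered
    from 1.\<close>
  define m where "m = (\<lambda>j. h (j - 1))"
  define v where "v = (\<lambda>j. g (m j))"
  define c where "c = (\<lambda>j n. representation (v ` {1..p}) (g n) (v j))"
  have m_jump: "m j \<in> jumps g" if "j \<in> {1..p}" for j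
  proof -
    have "j - 1 \<in> {..<p}" using that by auto
    thus ?thesis unfolding m_def bij_betw_imp_surj_on[OF h(1), symmetric] by (rule imageI)
  qed
  have mono: "strict_mono_on {1..p} m"
  proof (rule strict_mono_onI)
    fix i j assume "i \<in> {1..p}" "j \<in> {1..p}" "i < j"
    thus "m i < m j" unfolding m_def by (intro strict_mono_onD[OF h(2)]) auto
  qed
  have m_surj: "\<exists>j\<in>{1..p}. m j = n" if n: "n \<in> jumps g" for n
  proof -
    have "n \<in> h ` {..<p}" using n by (simp only: bij_betw_imp_surj_on[OF h(1)])
    then obtain i where "i < p" "h i = n" by auto
    thus ?thesis by (intro bexI[of _ "Suc i"]) (auto simp: m_def)
  qed
  have v_inj: "inj_on v {1..p}"
  proof (rule inj_onI)
    fix i j assume ij: "i \<in> {1..p}" "j \<in> {1..p}" "v i = v j"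
    hence "m i = m j" using inj_onD[OF inj_on_jumps] m_jump by (metis v_def)
    thus "i = j" using inj_onD[OF strict_mono_on_imp_inj_on[OF mono]] ij by blast
  qed
  have "v ` {1..p} = g ` m ` {1..p}" by (auto simp: v_def)
  moreover have "m ` {1..p} \<subseteq> jumps g" using m_jump by (rule image_subsetI)
  ultimately have indep: "independent (v ` {1..p})"
    using independent_jumps_finite[of "m ` {1..p}" g] by simp
  have sub: "g n \<in> span (v ` {j \<in> {1..p}. m j \<le> n})" for n
  proof -
    have "g ` {i \<in> jumps g. i \<le> n} \<subseteq> v ` {j \<in> {1..p}. m j \<le> n}"
    proof (rule image_subsetI)
      fix i assume i: "i \<in> {i \<in> jumps g. i \<le> n}"
      then obtain j where "j \<in> {1..p}" "m j = i" using m_surj[of i] by auto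
      thus "g i \<in> v ` {j \<in> {1..p}. m j \<le> n}" using i by (auto simp: v_def)
    qed
    thus ?thesis using in_span_jumps[of g n] span_mono by blast
  qed
  have c_sub: "c j n = representation (v ` {j \<in> {1..p}. m j \<le> n}) (g n) (v j)" for j n
    unfolding c_def by (subst representation_extend[OF indep sub]) auto
  show thesis
  proof (rule that[OF v_inj indep mono]; intro allI ballI impI)
    show "g n = (\<Sum>j\<in>{1..p}. scale (c j n) (v j))" for n
    proof -
      have "g n \<in> span (v ` {1..p})"
        using sub[of n] span_mono[of "v ` {j \<in> {1..p}. m j \<le> n}" "v ` {1..p}"] by blast
      hence "g n = (\<Sum>b\<in>v ` {1..p}. scale (representation (v ` {1..p}) (g n) b) b)"
        using sum_representation_eq[OF indep] by force
      thus ?thesis by (simp add: sum.reindex[OF v_inj] c_def)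
    qed
    show "c j n = 0" if j: "j \<in> {1..p}" "n < m j" for j n
    proof -
      have "v j \<notin> v ` {j \<in> {1..p}. m j \<le> n}"
        using j inj_onD[OF v_inj] by fastforce
      thus ?thesis unfolding c_sub using representation_ne_zero by blast
    qed
    show "c j (m j) \<noteq> 0" if j: "j \<in> {1..p}" for j
    proof -
      have "representation (v ` {1..p}) (v j) = (\<lambda>b. if b = v j then 1 else 0)"
        using j by (intro representation_basis[OF indep]) auto
      thus ?thesis by (simp add: c_def v_def)
    qed
  qed (simp add: v_def)
qed

end

section \<open>Action of C[[b]] on the top power of Log s\<close>

context xi_space
begin

lemma integ_top_eq:
  assumes "0 < k"
  shows "integ f (k - 1) (Suc n) = scale (1 / expo n) (f (k - 1) n)"
proof -
  have "{k - 1..<k} = {k - 1}" using assms by auto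
  thus ?thesis by (simp add: integ_Suc log_int_coeff_def)
qed

lemma integ_pow_log_monom:
  assumes "0 < k"
  shows "(integ ^^ l) (log_monom m (k - 1) w) (k - 1) n
    = (if n = m + l then scale (1 / (\<Prod>i<l. expo (m + i))) w else 0)"
proof (induction l arbitrary: n)
  case (Suc l)
  thus ?case
    by (cases n) (simp_all add: integ_0 integ_top_eq[OF assms])
qed (simp add: log_monom_def)

lemma smult_log_monom:
  assumes "0 < k"
  shows "(S \<odot>\<^bsub>\<Xi>\<^esub> log_monom m (k - 1) w) (k - 1) n
    = scale (if n < m then 0 else fps_nth S (n - m) / (\<Prod>i<n - m. expo (m + i))) w"
proof -
  have "(S \<odot>\<^bsub>\<Xi>\<^esub> log_monom m (k - 1) w) (k - 1) n
    = (\<Sum>l\<le>n. if n = m + l then scale (fps_nth S l / (\<Prod>i<l. expo (m + i))) w else 0)"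
    unfolding \<Xi>_simps by (intro sum.cong) (simp_all add: integ_pow_log_monom[OF assms])
  also have "\<dots> = (\<Sum>l\<le>n. if l = n - m then if n < m then 0 else scale (fps_nth S (n - m) / (\<Prod>i<n - m. expo (m + i))) w else 0)"
    by (intro sum.cong) auto
  also have "\<dots> = scale (if n < m then 0 else fps_nth S (n - m) / (\<Prod>i<n - m. expo (m + i))) w"
    by simp
  finally show ?thesis .
qed

lemma log_monom_mem: "0 < k \<Longrightarrow> log_monom m (k - 1) w \<in> carrier \<Xi>"
  by (auto simp: carrier_\<Xi> log_monom_def)

text \<open>For \<open>k = 0\<close> the space \<Xi> is 0, but \<open>k - 1\<close> is 0 as a
  natural number and \<open>log_monom\<close> may leave \<Xi>. The alternative \<open>p = 0\<close>
  then makes the sum empty.\<close>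

lemma expansion_iff:
  assumes "0 < k \<or> p = 0"
  shows "expansion scale \<alpha> k e p v m S \<psi> \<longleftrightarrow>
    inj_on v {1..p} \<and> independent (v ` {1..p}) \<and> (\<forall>j\<in>{1..p}. S j dvd 1) \<and>
    (\<forall>j\<ge>k - 1. \<forall>n. \<psi> j n = 0) \<and>
    e = (\<lambda>i n. (\<Sum>j\<in>{1..p}. (S j \<odot>\<^bsub>\<Xi>\<^esub> log_monom (m j) (k - 1) (v j)) i n) + \<psi> i n)"
proof -
  have "\<psi> \<in> carrier (Xi scale UNIV \<alpha> (int k - 2)) \<longleftrightarrow> (\<forall>j\<ge>k - 1. \<forall>n. \<psi> j n = 0)"
    by (auto simp: Xi_def)
  moreover have "(\<Oplus>\<^bsub>\<Xi>\<^esub> j\<in>{1..p}. S j \<odot>\<^bsub>\<Xi>\<^esub> log_monom (m j) (k - 1) (v j))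
      = (\<lambda>i n. \<Sum>j\<in>{1..p}. (S j \<odot>\<^bsub>\<Xi>\<^esub> log_monom (m j) (k - 1) (v j)) i n)"
    using assms by (intro finsum_\<Xi>_apply) (auto intro!: X.smult_mem log_monom_mem)
  ultimately show ?thesis
    unfolding expansion_def Let_def by (simp only: \<Xi>_simps(2))
qed

end

context xi_fresco
begin

abbreviation top_rank :: nat where
  "top_rank \<equiv> ab_rank top_quot"

lemma echelonI:
  assumes "inj_on v {1..p}" "independent (v ` {1..p})" "strict_mono_on {1..p} m"
    "\<And>n. e (k - 1) n = (\<Sum>j\<in>{1..p}. scale (c j n) (v j))"
    "\<And>j n. j \<in> {1..p} \<Longrightarrow> n < m j \<Longrightarrow> c j n = 0" "\<And>j. j \<in> {1..p} \<Longrightarrow> c j (m j) \<noteq> 0"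
  shows "echelon scale Basis \<alpha> k e p v m c"
  using xi_fresco_axioms assms strict_mono_on_imp_inj_on[OF assms(3)]
  by (simp add: echelon_def echelon_axioms_def)

lemma ex_echelon:
  obtains v m c where "echelon scale Basis \<alpha> k e top_rank v m c" "strict_mono_on {1..top_rank} m"
    "0 < k \<or> top_rank = 0"
proof -
  obtain v and p :: nat and m c where h: "inj_on v {1..p}" "independent (v ` {1..p})" "strict_mono_on {1..p} m"
    "\<forall>n. e (k - 1) n = (\<Sum>j\<in>{1..p}. scale (c j n) (v j))" "\<forall>j\<in>{1..p}. \<forall>n<m j. c j n = 0"
    "\<forall>j\<in>{1..p}. c j (m j) \<noteq> 0" "\<forall>j\<in>{1..p}. v j = e (k - 1) (m j)"
    by (rule ex_triangular[of "e (k - 1)"]) (rule that; assumption)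
  have E: "echelon scale Basis \<alpha> k e p v m c"
    by (rule echelonI[OF h(1-3)]) (use h(4-6) in blast)+
  have rank: "top_rank = p" by (rule echelon.rank_top[OF E])
  \<comment> \<open>For \<open>k = 0\<close> the generator is 0, so all \<open>v j\<close>, being
    coefficients of it, would vanish, contrary to independence.\<close>
  have "p = 0" if "k = 0"
  proof (rule ccontr)
    assume "p \<noteq> 0"
    hence "1 \<in> {1..p}" by simp
    hence "v 1 = e (k - 1) (m 1)" by (rule bspec[OF h(7)])
    also have "\<dots> = 0" using e[unfolded carrier_\<Xi>] that by simp
    finally have "v 1 = 0" .
    hence "0 \<in> v ` {1..p}" using \<open>1 \<in> {1..p}\<close> by (metis imageI)
    thus False using h(2) dependent_zero by blast
  qed
  thus thesis using that E h(3) unfolding rank by blast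
qed

lemma ex_expansion:
  "\<exists>v m S \<psi>. expansion scale \<alpha> k e top_rank v m S \<psi> \<and> strict_mono_on {1..top_rank} m"
proof -
  obtain v m c where E: "echelon scale Basis \<alpha> k e top_rank v m c" and mono: "strict_mono_on {1..top_rank} m"
    and k: "0 < k \<or> top_rank = 0"
    by (rule ex_echelon)
  interpret E: echelon scale Basis \<alpha> k e top_rank v m c by (rule E)
  \<comment> \<open>The products compensate the denominators of repeated integration, so the top
    part of \<open>S j\<close> applied to its monomial has the coefficients \<open>c j n\<close>.
    The constant term \<open>c j (m j)\<close> is nonzero, which makes \<open>S j\<close>
    invertible.\<close>
  define S where "S = (\<lambda>j. Abs_fps (\<lambda>l. c j (m j + l) * (\<Prod>i<l. expo (m j + i))))"
  define t where "t = (\<lambda>i n. \<Sum>j\<in>{1..top_rank}. (S j \<odot>\<^bsub>\<Xi>\<^esub> log_monom (m j) (k - 1) (v j)) i n)"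
  define \<psi> where "\<psi> = (\<lambda>i n. e i n - t i n)"
  have top: "t (k - 1) n = e (k - 1) n" for n
    unfolding t_def E.expand
  proof (intro sum.cong refl)
    fix j assume j: "j \<in> {1..top_rank}"
    hence "0 < k" using k by auto
    have "(if n < m j then 0 else fps_nth (S j) (n - m j) / (\<Prod>i<n - m j. expo (m j + i))) = c j n"
      using E.below[OF j, of n] by (simp add: S_def expo_nonzero)
    thus "(S j \<odot>\<^bsub>\<Xi>\<^esub> log_monom (m j) (k - 1) (v j)) (k - 1) n = scale (c j n) (v j)"
      by (simp only: smult_log_monom[OF \<open>0 < k\<close>])
  qed
  have above: "t j n = 0" if "k \<le> j" for j n
    unfolding t_def
  proof (intro sum.neutral ballI)
    fix i assume "i \<in> {1..top_rank}"
    hence "0 < k" using k by auto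
    thus "(S i \<odot>\<^bsub>\<Xi>\<^esub> log_monom (m i) (k - 1) (v i)) j n = 0"
      using smult_\<Xi>_mem[OF log_monom_mem] that by (simp add: carrier_\<Xi>)
  qed
  have "expansion scale \<alpha> k e top_rank v m S \<psi>"
    unfolding expansion_iff[OF k]
  proof (intro conjI E.v_inj E.indep ballI allI impI)
    show "S j dvd 1" if "j \<in> {1..top_rank}" for j
      using E.lead[OF that] by (simp add: S_def)
    show "\<psi> j n = 0" if "k - 1 \<le> j" for j n
    proof (cases "k \<le> j")
      case True
      thus ?thesis using above e by (simp add: \<psi>_def carrier_\<Xi>)
    next
      case False
      hence "j = k - 1" using that by auto
      thus ?thesis by (simp add: \<psi>_def top)
    qed
  qed (simp add: \<psi>_def t_def)
  thus ?thesis using mono by blast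
qed

text \<open>The coefficients of e in the given expansion again form an \<open>echelon\<close>: a
  unit has nonzero constant term, so the j-th sequence has exact order \<open>m j\<close>. The
  formula thus holds for any choice of vectors.\<close>

lemma bernstein_expansion:
  assumes "expansion scale \<alpha> k e top_rank v m S \<psi>" and mono: "strict_mono_on {1..top_rank} m"
  shows "bernstein_nth k F = (\<Prod>j\<in>{1..top_rank}. [:of_rat \<alpha> + of_nat (m j), 1:])"
proof -
  have k: "0 < k \<or> top_rank = 0" by (rule ex_echelon)
  have h: "inj_on v {1..top_rank}" "independent (v ` {1..top_rank})" "\<forall>j\<in>{1..top_rank}. S j dvd 1"
    "\<forall>j\<ge>k - 1. \<forall>n. \<psi> j n = 0"
    "e = (\<lambda>i n. (\<Sum>j\<in>{1..top_rank}. (S j \<odot>\<^bsub>\<Xi>\<^esub> log_monom (m j) (k - 1) (v j)) i n) + \<psi> i n)"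
    using assms(1) unfolding expansion_iff[OF k] by blast+
  define c where "c = (\<lambda>j n. if n < m j then 0 else fps_nth (S j) (n - m j) / (\<Prod>i<n - m j. expo (m j + i)))"
  have "echelon scale Basis \<alpha> k e top_rank v m c"
  proof (rule echelonI[OF h(1,2) mono])
    show "e (k - 1) n = (\<Sum>j\<in>{1..top_rank}. scale (c j n) (v j))" for n
    proof -
      have "e (k - 1) n = (\<Sum>j\<in>{1..top_rank}. (S j \<odot>\<^bsub>\<Xi>\<^esub> log_monom (m j) (k - 1) (v j)) (k - 1) n)"
        using fun_cong[OF fun_cong[OF h(5), of "k - 1"], of n] h(4) by simp
      also have "\<dots> = (\<Sum>j\<in>{1..top_rank}. scale (c j n) (v j))"
      proof (intro sum.cong refl)
        fix j assume "j \<in> {1..top_rank}"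
        hence "0 < k" using k by auto
        thus "(S j \<odot>\<^bsub>\<Xi>\<^esub> log_monom (m j) (k - 1) (v j)) (k - 1) n = scale (c j n) (v j)"
          by (simp only: smult_log_monom c_def)
      qed
      finally show ?thesis .
    qed
    show "c j (m j) \<noteq> 0" if "j \<in> {1..top_rank}" for j
      using h(3) that by (simp add: c_def)
  qed (simp add: c_def)
  thus ?thesis by (rule echelon.bernstein_top)
qed

end

theorem corollary2p0p3:
  fixes \<alpha> :: rat and k p :: nat
    and scale :: "complex \<Rightarrow> 'v::ab_group_add \<Rightarrow> 'v" and Basis :: "'v set"
    and e :: "nat \<Rightarrow> nat \<Rightarrow> 'v" and F :: "(nat \<Rightarrow> nat \<Rightarrow> 'v) abm"
  assumes "0 < \<alpha>" "\<alpha> \<le> 1"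
    and "finite_dimensional_vector_space scale Basis"
    and "e \<in> carrier (Xi scale UNIV \<alpha> (int k - 1))"
    and "F = sub (Xi scale UNIV \<alpha> (int k - 1)) (generated (Xi scale UNIV \<alpha> (int k - 1)) e)"
    and "primitive_fresco \<alpha> F"
    and "nilp_order F = k"
    and "p = ab_rank (quot F (ss_filt F (k - 1)))"
  shows "(\<exists>v m S \<psi>. expansion scale \<alpha> k e p v m S \<psi>)
    \<and> (\<exists>v m S \<psi>. expansion scale \<alpha> k e p v m S \<psi> \<and> strict_mono_on {1..p} m)
    \<and> (\<forall>v m S \<psi>. expansion scale \<alpha> k e p v m S \<psi> \<and> strict_mono_on {1..p} m \<longrightarrow>
         bernstein_nth k F = (\<Prod>j\<in>{1..p}. [:of_rat \<alpha> + of_nat (m j), 1:]))"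
proof -
  have "ab_module F" using assms(6) by (simp add: primitive_fresco_def fresco_def)
  hence "xi_fresco scale Basis \<alpha> k e"
    using assms(1,3,4,5)
    by (simp add: xi_fresco_def xi_fresco_axioms_def xi_space_def xi_space_axioms_def)
  then interpret xi_fresco scale Basis \<alpha> k e .
  show ?thesis
    using ex_expansion bernstein_expansion unfolding assms(5,8) by blast
qed

end
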